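(* Let $(\mathsf{f}_t)_{t\in\mathbb{R}}$ be a mixing, locally uniformly shearing (LUS) flow. Then $(\mathsf{f}_t)_{t\in\mathbb{R}}$ is mixing of all orders.
   Context: Setting. $(X,\mathrm{d})$ is a complete, locally compact, $\sigma$-compact metric space, $\mu$ is a Radon probability measure on $X$, and $(\mathsf{f}_t)_{t\in\mathbb{R}}$ is a measure preserving flow on $(X,\mu)$. A $k$-tuple of times is $\mathbf{t}=(t_0,\dots,t_{k-1})$ with $0=t_0<t_1<\dots<t_{k-1}$; $\Delta\mathbf{t}=\min_{0<i<k}(t_i-t_{i-1})$ ($\Delta(0)=\infty$). The flow is mixing of order $k$ if $\mu(\bigcap_{i<k}\mathsf{f}_{t_i}A_i)\to\prod_{i<k}\mu(A_i)$ as $\Delta\mathbf{t}\to\infty$ for all measurable $A_0,\dots,A_{k-1}$; mixing means mixing of order 2; mixing of all orders means mixing of order $k$ for all $k\ge2$. Almost measure preserving maps. A measurable map $\mathsf{g}:(X,\mu)\to(Y,\nu)$ is $\varepsilon$-almost measure preserving if there are $X_0\subseteq X$, $Y_0\subseteq Y$ (its proper domain and proper codomain) with $\mu(X\setminus X_0)<\varepsilon\mu(X)$, $\nu(Y\setminus Y_0)<\varepsilon\nu(Y)$ and $(1-\varepsilon)\nu(A)\le\mu(\mathsf{g}^{-1}(A)\cap X_0)\le(1+\varepsilon)\nu(A)$ for all measurable $A\subseteq Y_0$. Towers. A tower with base $B$ (measurable) and height $h\ge0$ is a set $\bigcup_{0\le t\le h}\mathsf{f}_t(B)$ such that $\mathsf{f}_t(B)\cap\mathsf{f}_{t'}(B)=\emptyset$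 for all $t\ne t'$ in $[0,h]$. Almost partitions. A family $\{P_a\}$ of pairwise disjoint measurable sets is an $\varepsilon$-almost partition of $A$ if $\mu\big(A\,\triangle\,\bigcup\{P_a:P_a\cap A\ne\emptyset\}\big)<\varepsilon\mu(A)$. LUS. The flow is locally uniformly shearing (LUS) if there exist $a\in(0,1/2]$, $d\ge1$, a sequence $(M_s)_{s\in\mathbb{N}}$ increasing to infinity and, for every $\delta>0$ and integer $k\ge1$, there exists $M_{k,\delta}>\delta^{-2}$ such that for every $M_s,h\ge M_{k,\delta}$ there exist $t_{h,M_s}\ge\max\{M_s,h\}$ and a $\delta$-almost partition $\{\mathcal{R}_\varrho\}_{\varrho=1}^d$ of $X$ into towers $\mathcal{R}_\varrho$ of heights $h_\varrho\in[h^{1/2},h^{3/2}]$ such that, for every $(k+1)$-tuple of times $\mathbf{t}$ with $\Delta\mathbf{t}>t_{h,M_s}$, the following hold, where $K_\delta=\lfloor\delta^{-1}\rfloor$: (LUS1) there exist $\delta$-almost measure preserving maps $\mathsf{g}^{\mathbf{t}}_m:\bigcup_\varrho\mathcal{R}_\varrho\to\bigcup_\varrho\mathcal{R}_\varrho$, $m=0,\dots,K_\delta$, such that (a) $\mathrm{d}(\mathsf{g}^{\mathbf{t}}_m(x),x)\le\delta$ for all $x$ in the proper domain of $\mathsf{g}^{\mathbf{t}}_m$; (b) for any tower $\mathcal{T}$ of height $H\ge h^{1/2}$ there is a tower $\overline{\mathcal{T}}\subseteq(\mathsf{g}^{\mathbf{t}}_m)^{-1}(\mathcal{T})$ of height $h^{1/4}$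 with $\mu\big((\mathsf{g}^{\mathbf{t}}_m)^{-1}(\mathcal{T})\setminus\overline{\mathcal{T}}\big)\le d\,\delta$; (LUS2) for every $\varrho$ there is a $\delta$-almost partition $\{\mathrm{Tow}_{\varrho,j}\}_{j=1}^k$ of $\mathcal{R}_\varrho$ into towers $\mathrm{Tow}_{\varrho,j}\subseteq\mathcal{R}_\varrho$ of the same height $h_\varrho$ such that, for every $m=0,\dots,K_\delta$, $\max_{1\le j\le k}\sup_{x\in\mathrm{Tow}_{\varrho,j}}\mathrm{d}\big(\mathsf{f}_{t_j}(\mathsf{g}^{\mathbf{t}}_mx),\mathsf{f}_{t_j+mM_s^a}(x)\big)\le\delta$; (LUS3) for every $\varrho$, every $i=1,\dots,k$ and every $m=0,\dots,K_\delta$ there is a $\delta$-almost partition of $\mathcal{R}_\varrho$ into (possibly empty) towers $R_\varrho(i,m,\ell)\subseteq\mathcal{R}_\varrho$, $\ell=0,\dots,\delta^{-1}M_s-1$, of the same height $h_\varrho$ such that $\sup_{x\in R_\varrho(i,m,\ell)}\mathrm{d}\big(\mathsf{f}_{t_i}(\mathsf{g}^{\mathbf{t}}_mx),\mathsf{f}_{t_i+\ell\delta}(x)\big)\le\delta$ for every such $\ell$. *)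

theory Defs
  imports "HOL-Probability.Probability"
begin

section \<open>The ambient space and the flow\<close>

definition sigma_compact_space :: "'a topology \<Rightarrow> bool" where
  "sigma_compact_space X \<longleftrightarrow>
     (\<exists>C :: nat \<Rightarrow> 'a set. (\<forall>n. compactin X (C n)) \<and> (\<Union>n. C n) = topspace X)"

definition radon_measure :: "'a :: topological_space measure \<Rightarrow> bool" where
  "radon_measure M \<longleftrightarrow>
     sets M = sets borel \<and>
     (\<forall>x. \<exists>U. open U \<and> x \<in> U \<and> emeasure M U < \<infinity>) \<and>
     (\<forall>A \<in> sets M. emeasure M A = (SUP K \<in> {K. compact K \<and> K \<subseteq> A}. emeasure M K))"

text \<open>No joint measurability of \<open>(t, x) \<mapsto> f t x\<close> is imposed.\<close>

definition measure_preserving_flow :: "'a measure \<Rightarrow> (real \<Rightarrow> 'a \<Rightarrow> 'a) \<Rightarrow> bool" where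
  "measure_preserving_flow M f \<longleftrightarrow>
     (\<forall>x. f 0 x = x) \<and>
     (\<forall>s t x. f (s + t) x = f s (f t x)) \<and>
     (\<forall>t. f t \<in> measurable M M \<and> distr M M (f t) = M)"

section \<open>Tuples of times and mixing\<close>

text \<open>A \<open>k\<close>-tuple is a function on \<open>nat\<close> of which only the values below \<open>k\<close> matter.\<close>

definition time_tuple :: "nat \<Rightarrow> (nat \<Rightarrow> real) \<Rightarrow> bool" where
  "time_tuple k t \<longleftrightarrow> t 0 = 0 \<and> (\<forall>i. 0 < i \<and> i < k \<longrightarrow> t (i - 1) < t i)"

text \<open>For \<open>k = 1\<close> the infimum is over the empty set, so the gap of the tuple \<open>(0)\<close> is \<open>\<infinity>\<close>.\<close>

definition time_gap :: "nat \<Rightarrow> (nat \<Rightarrow> real) \<Rightarrow> ereal" where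
  "time_gap k t = (INF i \<in> {0<..<k}. ereal (t i - t (i - 1)))"

definition mixing_of_order :: "nat \<Rightarrow> 'a measure \<Rightarrow> (real \<Rightarrow> 'a \<Rightarrow> 'a) \<Rightarrow> bool" where
  "mixing_of_order k M f \<longleftrightarrow>
     (\<forall>A :: nat \<Rightarrow> 'a set. (\<forall>i<k. A i \<in> sets M) \<longrightarrow>
       (\<forall>\<epsilon>>0. \<exists>N :: real. \<forall>t. time_tuple k t \<and> time_gap k t > ereal N \<longrightarrow>
          \<bar>measure M (\<Inter>i<k. f (t i) ` A i) - (\<Prod>i<k. measure M (A i))\<bar> < \<epsilon>))"

definition mixing :: "'a measure \<Rightarrow> (real \<Rightarrow> 'a \<Rightarrow> 'a) \<Rightarrow> bool" where
  "mixing M f \<longleftrightarrow> mixing_of_order 2 M f"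

definition mixing_of_all_orders :: "'a measure \<Rightarrow> (real \<Rightarrow> 'a \<Rightarrow> 'a) \<Rightarrow> bool" where
  "mixing_of_all_orders M f \<longleftrightarrow> (\<forall>k\<ge>2. mixing_of_order k M f)"

section \<open>Almost measure preserving maps, towers, almost partitions\<close>

text \<open>The proper domain \<open>X0\<close> and the proper codomain \<open>Y0\<close> are part of the data.  All measures
  here are finite, so the real-valued \<^const>\<open>measure\<close> is used.\<close>

definition almost_measure_preserving ::
    "real \<Rightarrow> 'a measure \<Rightarrow> 'b measure \<Rightarrow> ('a \<Rightarrow> 'b) \<Rightarrow> 'a set \<Rightarrow> 'b set \<Rightarrow> bool" where
  "almost_measure_preserving \<epsilon> M N g X0 Y0 \<longleftrightarrow>
     g \<in> measurable M N \<and> X0 \<in> sets M \<and> Y0 \<in> sets N \<and>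
     measure M (space M - X0) < \<epsilon> * measure M (space M) \<and>
     measure N (space N - Y0) < \<epsilon> * measure N (space N) \<and>
     (\<forall>A \<in> sets N. A \<subseteq> Y0 \<longrightarrow>
        (1 - \<epsilon>) * measure N A \<le> measure M (g -` A \<inter> X0) \<and>
        measure M (g -` A \<inter> X0) \<le> (1 + \<epsilon>) * measure N A)"

text \<open>\<open>T\<close> is a tower of height \<open>h\<close>, possibly with empty base.  Measurability of \<open>T\<close> is
  demanded besides that of the base, so that its measure makes sense; on a Polish space it is
  automatic for jointly Borel flows, since \<open>(t, x) \<mapsto> f t x\<close> is injective on
  \<open>{0..h} \<times> B\<close> (Lusin-Souslin).\<close>

definition tower :: "'a measure \<Rightarrow> (real \<Rightarrow> 'a \<Rightarrow> 'a) \<Rightarrow> real \<Rightarrow> 'a set \<Rightarrow> bool" where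
  "tower M f h T \<longleftrightarrow>
     0 \<le> h \<and> T \<in> sets M \<and>
     (\<exists>B \<in> sets M. T = (\<Union>t\<in>{0..h}. f t ` B) \<and>
        (\<forall>t\<in>{0..h}. \<forall>t'\<in>{0..h}. t \<noteq> t' \<longrightarrow> f t ` B \<inter> f t' ` B = {}))"

definition almost_partition :: "'a measure \<Rightarrow> real \<Rightarrow> 'a set \<Rightarrow> 'i set \<Rightarrow> ('i \<Rightarrow> 'a set) \<Rightarrow> bool" where
  "almost_partition M \<epsilon> A I P \<longleftrightarrow>
     A \<in> sets M \<and> (\<forall>a\<in>I. P a \<in> sets M) \<and> disjoint_family_on P I \<and>
     (let U = (\<Union>a\<in>{a\<in>I. P a \<inter> A \<noteq> {}}. P a)
      in measure M ((A - U) \<union> (U - A)) < \<epsilon> * measure M A)"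

section \<open>Locally uniformly shearing flows\<close>

text \<open>In the three conditions \<open>R \<rho>\<close> (\<open>1 \<le> \<rho> \<le> d\<close>) are the towers of the ambient almost
  partition, \<open>H \<rho>\<close> their heights, \<open>K\<close> is the integer part of \<open>1 / \<delta>\<close>, \<open>Ms\<close> is
  a term of the sequence \<open>(M s)\<close>, and \<open>t\<close> is a \<open>(k + 1)\<close>-tuple of times.  The maps \<open>g m\<close> are
  only relevant on the union of the towers, whence the restricted measure spaces and preimages.\<close>

definition LUS1 ::
    "'a :: metric_space measure \<Rightarrow> (real \<Rightarrow> 'a \<Rightarrow> 'a) \<Rightarrow> real \<Rightarrow> nat \<Rightarrow> real \<Rightarrow> (nat \<Rightarrow> 'a set) \<Rightarrow>
     nat \<Rightarrow> (nat \<Rightarrow> 'a \<Rightarrow> 'a) \<Rightarrow> bool" where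
  "LUS1 M f \<delta> d h R K g \<longleftrightarrow>
     (let W = (\<Union>\<rho>\<in>{1..d}. R \<rho>) in
      \<forall>m\<le>K. \<exists>X0 Y0.
        almost_measure_preserving \<delta> (restrict_space M W) (restrict_space M W) (g m) X0 Y0 \<and>
        (\<forall>x\<in>X0. dist (g m x) x \<le> \<delta>) \<and>
        (\<forall>H T. H \<ge> h powr (1/2) \<and> tower M f H T \<longrightarrow>
           (\<exists>T'. tower M f (h powr (1/4)) T' \<and> T' \<subseteq> g m -` T \<inter> W \<and>
                 measure M ((g m -` T \<inter> W) - T') \<le> real d * \<delta>)))"

definition LUS2 ::
    "'a :: metric_space measure \<Rightarrow> (real \<Rightarrow> 'a \<Rightarrow> 'a) \<Rightarrow> real \<Rightarrow> real \<Rightarrow> nat \<Rightarrow> nat \<Rightarrow> real \<Rightarrow>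
     (nat \<Rightarrow> 'a set) \<Rightarrow> (nat \<Rightarrow> real) \<Rightarrow> nat \<Rightarrow> (nat \<Rightarrow> 'a \<Rightarrow> 'a) \<Rightarrow> (nat \<Rightarrow> real) \<Rightarrow> bool" where
  "LUS2 M f a \<delta> k d Ms R H K g t \<longleftrightarrow>
     (\<forall>\<rho>\<in>{1..d}. \<exists>Tow :: nat \<Rightarrow> 'a set.
        almost_partition M \<delta> (R \<rho>) {1..k} Tow \<and>
        (\<forall>j\<in>{1..k}. tower M f (H \<rho>) (Tow j) \<and> Tow j \<subseteq> R \<rho>) \<and>
        (\<forall>m\<le>K. \<forall>j\<in>{1..k}. \<forall>x\<in>Tow j.
           dist (f (t j) (g m x)) (f (t j + real m * Ms powr a) x) \<le> \<delta>))"

text \<open>\<open>Ms / \<delta>\<close> need not be an integer: the index set is that of all integers between \<open>0\<close>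
  and \<open>Ms / \<delta> - 1\<close>.\<close>

definition LUS3 ::
    "'a :: metric_space measure \<Rightarrow> (real \<Rightarrow> 'a \<Rightarrow> 'a) \<Rightarrow> real \<Rightarrow> nat \<Rightarrow> nat \<Rightarrow> real \<Rightarrow>
     (nat \<Rightarrow> 'a set) \<Rightarrow> (nat \<Rightarrow> real) \<Rightarrow> nat \<Rightarrow> (nat \<Rightarrow> 'a \<Rightarrow> 'a) \<Rightarrow> (nat \<Rightarrow> real) \<Rightarrow> bool" where
  "LUS3 M f \<delta> k d Ms R H K g t \<longleftrightarrow>
     (let L = {l :: nat. real l \<le> Ms / \<delta> - 1} in
      \<forall>\<rho>\<in>{1..d}. \<forall>i\<in>{1..k}. \<forall>m\<le>K. \<exists>Q :: nat \<Rightarrow> 'a set.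
        almost_partition M \<delta> (R \<rho>) L Q \<and>
        (\<forall>l\<in>L. tower M f (H \<rho>) (Q l) \<and> Q l \<subseteq> R \<rho>) \<and>
        (\<forall>l\<in>L. \<forall>x\<in>Q l. dist (f (t i) (g m x)) (f (t i + real l * \<delta>) x) \<le> \<delta>))"

definition locally_uniformly_shearing ::
    "'a :: metric_space measure \<Rightarrow> (real \<Rightarrow> 'a \<Rightarrow> 'a) \<Rightarrow> bool" where
  "locally_uniformly_shearing M f \<longleftrightarrow>
     (\<exists>(a :: real) (d :: nat) (Mseq :: nat \<Rightarrow> real).
        0 < a \<and> a \<le> 1/2 \<and> d \<ge> 1 \<and> incseq Mseq \<and> filterlim Mseq at_top sequentially \<and>
        (\<forall>\<delta>>0. \<forall>k\<ge>1. \<exists>M0 :: real. M0 > 1 / \<delta>\<^sup>2 \<and>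
          (\<forall>s. \<forall>h :: real. Mseq s \<ge> M0 \<and> h \<ge> M0 \<longrightarrow>
            (\<exists>(t0 :: real) (R :: nat \<Rightarrow> 'a set) (H :: nat \<Rightarrow> real).
               t0 \<ge> max (Mseq s) h \<and>
               almost_partition M \<delta> (space M) {1..d} R \<and>
               (\<forall>\<rho>\<in>{1..d}. tower M f (H \<rho>) (R \<rho>) \<and>
                  h powr (1/2) \<le> H \<rho> \<and> H \<rho> \<le> h powr (3/2)) \<and>
               (\<forall>t. time_tuple (Suc k) t \<and> time_gap (Suc k) t > ereal t0 \<longrightarrow>
                  (let K = nat \<lfloor>1 / \<delta>\<rfloor> in
                   \<exists>g :: nat \<Rightarrow> 'a \<Rightarrow> 'a.
                     LUS1 M f \<delta> d h R K g \<and>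
                     LUS2 M f a \<delta> k d (Mseq s) R H K g t \<and>
                     LUS3 M f \<delta> k d (Mseq s) R H K g t))))))"

end

theory Submission
  imports Defs
begin

text \<open>The proof climbs from order \<open>k\<close> to order \<open>k + 1\<close>.  By approximation and multilinearity it
  suffices to show that \<open>\<integral> \<phi>\<^sub>0 \<cdot> \<phi>\<^sub>1 \<circ> f t\<^sub>1 \<cdots> \<phi>\<^sub>k \<circ> f t\<^sub>k\<close> tends to \<open>0\<close> for uniformly
  continuous \<open>\<phi>\<^sub>i\<close> of zero mean.  Since \<open>g m\<close> almost preserves \<open>\<mu>\<close> and is close to the identity,
  the integral hardly changes when the last \<open>k\<close> factors are precomposed with \<open>g m\<close>; average over \<open>m\<close> and
  apply Cauchy-Schwarz.  In the correlation of \<open>m \<noteq> m'\<close>, (LUS2) and (LUS3) cut the space into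
  intersections of towers on which the \<open>i\<close>-th factor is \<open>(\<phi>\<^sub>i \<circ> f u\<^sub>i \<cdot> \<phi>\<^sub>i \<circ> f u\<^sub>i') \<circ> f t\<^sub>i\<close>
  with constant shifts, and on each piece one factor \<open>j\<close> has shifts that differ by at least \<open>M\<^sub>s\<^sup>a\<close>, so
  that mixing makes its mean small.  Towers of large height are almost invariant under bounded times, hence mixing
  of order \<open>k\<close> makes the integral over each piece almost the measure of the piece times the product
  of the means.  The parameters are chosen in the order \<open>\<delta>\<close>, \<open>M\<^sub>s\<close>, \<open>h\<close>, \<open>t\<close>.\<close>

section \<open>Correlations along a tuple of times\<close>

text \<open>Why order \<open>k\<close> suffices for \<open>k + 1\<close> factors: \<open>g m\<close>
  is close to the identity, so after averaging over \<open>m\<close> the factor at time 0 stands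
  outside the average and Cauchy-Schwarz removes it, leaving correlations of two products of
  \<open>k\<close> factors. The obstacle is that maps and pieces depend on the tuple of times, so
  mixing cannot be applied with the indicators of the pieces as fixed functions. Two facts overcome
  it. The shifts come from a finite set determined by \<open>\<delta>\<close> and \<open>Ms\<close>,
  hence only finitely many families of functions have to be decorrelated, and these are known before
  \<open>h\<close> and \<open>t\<close>. The indicators enter only as weights that are almost
  invariant up to some time \<open>T\<close>, and decorrelation from such weights is uniform in the
  weight. Errors proportional to the measure of a piece add up to one copy; absolute errors are
  multiplied by the number of pairs of pieces, which is known when their size is chosen.\<close>

definition gaps :: "nat \<Rightarrow> real \<Rightarrow> (nat \<Rightarrow> real) \<Rightarrow> bool" where
  "gaps k N t \<longleftrightarrow> (\<forall>i. Suc i < k \<longrightarrow> t i + N < t (Suc i))"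

lemma gaps_mono: "gaps k N t \<Longrightarrow> N' \<le> N \<Longrightarrow> gaps k N' t"
  unfolding gaps_def by (meson add_left_mono order_le_less_trans)

text \<open>No starting time is fixed by \<open>gaps\<close>. This allows mixing of order
  \<open>k\<close> to be applied to the last \<open>k\<close> of \<open>k + 1\<close> times, which
  do not start at 0.\<close>

lemma gaps_shift: "gaps k N (\<lambda>i. t i + s) \<longleftrightarrow> gaps k N t"
  unfolding gaps_def by (simp add: algebra_simps)

text \<open>Mixing of sets is stated with images, and the indicator of the image of \<open>A\<close>
  under \<open>f t\<close> is that of \<open>A\<close> composed with \<open>f (- t)\<close>. Passing
  from sets to functions therefore negates the times and reverses their order.\<close>

lemma gaps_reverse:
  assumes "gaps k N t"
  shows "gaps k N (\<lambda>i. c - t (k - Suc i))"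
  unfolding gaps_def
proof (intro allI impI)
  fix i assume i: "Suc i < k"
  then have "Suc (k - Suc (Suc i)) = k - Suc i" "Suc (k - Suc (Suc i)) < k" by simp_all
  with assms have "t (k - Suc (Suc i)) + N < t (k - Suc i)"
    unfolding gaps_def by metis
  then show "c - t (k - Suc i) + N < c - t (k - Suc (Suc i))" by simp
qed

text \<open>An infimum of numbers above \<open>N\<close> is only known to be at least
  \<open>N\<close>, hence the slack between \<open>N'\<close> and \<open>N\<close>.\<close>

lemma time_tuple_gapsI:
  assumes "t 0 = 0" "gaps k N t" "N' < N" "0 \<le> N'"
  shows "time_tuple k t" "time_gap k t > ereal N'"
proof -
  have *: "t (i - 1) + N < t i" if "0 < i" "i < k" for i
    using assms(2) that unfolding gaps_def by (cases i) auto
  show "time_tuple k t"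
    unfolding time_tuple_def
  proof (intro conjI allI impI)
    fix i assume "0 < i \<and> i < k"
    with *[of i] assms(3,4) show "t (i - 1) < t i" by simp
  qed (rule assms(1))
  have "ereal N \<le> time_gap k t"
    unfolding time_gap_def
  proof (intro INF_greatest)
    fix i assume "i \<in> {0<..<k}"
    with *[of i] show "ereal N \<le> ereal (t i - t (i - 1))" by simp
  qed
  then show "time_gap k t > ereal N'"
    using assms(3) by (metis less_ereal.simps(1) order_less_le_trans)
qed

lemma time_gap_gaps:
  assumes "time_gap k t > ereal N"
  shows "gaps k N t"
  unfolding gaps_def
proof (intro allI impI)
  fix i assume "Suc i < k"
  then have "time_gap k t \<le> ereal (t (Suc i) - t (Suc i - 1))"
    unfolding time_gap_def by (intro INF_lower) auto
  with assms have "ereal N < ereal (t (Suc i) - t i)"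
    by (metis diff_Suc_1 order_less_le_trans)
  then show "t i + N < t (Suc i)" by simp
qed

text \<open>A filter makes limit laws and finite conjunctions of eventual statements available. For
  \<open>k \<le> 1\<close> the predicate \<open>gaps\<close> always holds and this is the top
  filter.\<close>

definition gap_filter :: "nat \<Rightarrow> (nat \<Rightarrow> real) filter" where
  "gap_filter k = (INF N. principal {t. gaps k N t})"

lemma eventually_gap_filter:
  "eventually P (gap_filter k) \<longleftrightarrow> (\<exists>N. \<forall>t. gaps k N t \<longrightarrow> P t)"
proof -
  have "\<exists>N\<in>UNIV. principal {t. gaps k N t} \<le> inf (principal {t. gaps k a t}) (principal {t. gaps k b t})"
    for a b :: real
    by (rule bexI[of _ "max a b"]) (auto intro: gaps_mono)
  then show ?thesis
    unfolding gap_filter_def by (subst eventually_INF_base) (auto simp: eventually_principal)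
qed

section \<open>Mixing for functions and its equivalence with mixing for sets\<close>

locale mp_flow = prob_space M
  for M :: "'a :: metric_space measure" and f :: "real \<Rightarrow> 'a \<Rightarrow> 'a" +
  assumes sets_M: "sets M = sets borel"
    and flow: "measure_preserving_flow M f"
begin

lemma space_M [simp]: "space M = UNIV"
  using sets_eq_imp_space_eq[OF sets_M] by simp

lemma flow_0 [simp]: "f 0 x = x"
  and flow_add: "f (s + t) x = f s (f t x)"
  and flow_measurable [measurable]: "f t \<in> measurable M M"
  and flow_distr: "distr M M (f t) = M"
  using flow unfolding measure_preserving_flow_def by auto

lemma flow_add': "f s (f t x) = f (s + t) x"
  by (simp add: flow_add)

lemma flow_image: "f t ` A = f (- t) -` A"
proof (intro set_eqI iffI)
  fix x assume "x \<in> f (- t) -` A"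
  then have "f t (f (- t) x) \<in> f t ` A" by blast
  then show "x \<in> f t ` A" by (simp add: flow_add')
qed (auto simp: flow_add')

lemma measurable_flow_comp [measurable]:
  assumes "F \<in> borel_measurable M"
  shows "(\<lambda>x. F (f t x)) \<in> borel_measurable M"
  using measurable_compose[OF flow_measurable assms] .

lemma integral_flow:
  fixes F :: "'a \<Rightarrow> real"
  assumes "F \<in> borel_measurable M"
  shows "(\<integral>x. F (f t x) \<partial>M) = (\<integral>x. F x \<partial>M)"
  using integral_distr[OF flow_measurable assms, of t] by (simp add: flow_distr)

lemma integrable_flow:
  fixes F :: "'a \<Rightarrow> real"
  assumes "integrable M F"
  shows "integrable M (\<lambda>x. F (f t x))"
  using integrable_distr[OF flow_measurable, of t F] assms by (simp add: flow_distr)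

lemma continuous_measurable: "continuous_on UNIV F \<Longrightarrow> F \<in> borel_measurable M"
  for F :: "'a \<Rightarrow> real"
  using measurable_cong_sets[OF sets_M refl] borel_measurable_continuous_onI by blast

lemma integrable_bounded:
  fixes F :: "'a \<Rightarrow> real"
  assumes "F \<in> borel_measurable M" "\<And>x. \<bar>F x\<bar> \<le> C"
  shows "integrable M F"
  using assms by (intro integrable_const_bound[where B = C]) auto

lemma integral_le_bound:
  fixes F :: "'a \<Rightarrow> real"
  assumes "F \<in> borel_measurable M" "\<And>x. \<bar>F x\<bar> \<le> C"
  shows "\<bar>\<integral>x. F x \<partial>M\<bar> \<le> C"
proof -
  have "\<bar>\<integral>x. F x \<partial>M\<bar> \<le> (\<integral>x. \<bar>F x\<bar> \<partial>M)"
    by simp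
  also have "\<dots> \<le> (\<integral>x. C \<partial>M)"
    using assms by (intro integral_mono integrable_abs integrable_bounded) auto
  finally show ?thesis by (simp add: prob_space[simplified])
qed

definition corr :: "nat \<Rightarrow> (nat \<Rightarrow> 'a \<Rightarrow> real) \<Rightarrow> (nat \<Rightarrow> real) \<Rightarrow> real" where
  "corr k \<phi> t = (\<integral>x. (\<Prod>i<k. \<phi> i (f (t i) x)) \<partial>M)"

definition dev :: "nat \<Rightarrow> (nat \<Rightarrow> 'a \<Rightarrow> real) \<Rightarrow> (nat \<Rightarrow> real) \<Rightarrow> real" where
  "dev k \<phi> t = corr k \<phi> t - (\<Prod>i<k. \<integral>x. \<phi> i x \<partial>M)"

definition fmix :: "nat \<Rightarrow> (nat \<Rightarrow> 'a \<Rightarrow> real) \<Rightarrow> bool" where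
  "fmix k \<phi> \<longleftrightarrow> (dev k \<phi> \<longlongrightarrow> 0) (gap_filter k)"

lemma fmix_iff:
  "fmix k \<phi> \<longleftrightarrow> (\<forall>\<epsilon>>0. \<exists>N. \<forall>t. gaps k N t \<longrightarrow> \<bar>dev k \<phi> t\<bar> < \<epsilon>)"
  unfolding fmix_def tendsto_iff eventually_gap_filter by simp

lemma fmixD:
  assumes "fmix k \<phi>" "\<epsilon> > 0"
  obtains N where "N \<ge> N0" "\<And>t. gaps k N t \<Longrightarrow> \<bar>dev k \<phi> t\<bar> < \<epsilon>"
proof -
  from assms obtain N where "\<And>t. gaps k N t \<Longrightarrow> \<bar>dev k \<phi> t\<bar> < \<epsilon>"
    unfolding fmix_iff by blast
  then show ?thesis
    using gaps_mono[of k "max N N0" _ N] by (intro that[of "max N N0"]) auto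
qed

lemma dev_cong:
  assumes "\<And>i. i < k \<Longrightarrow> \<phi> i = \<psi> i"
  shows "dev k \<phi> t = dev k \<psi> t"
  using assms unfolding dev_def corr_def by (auto intro!: arg_cong2[of _ _ _ _ "(-)"] prod.cong Bochner_Integration.integral_cong)

lemma fmix_cong:
  assumes "\<And>i. i < k \<Longrightarrow> \<phi> i = \<psi> i"
  shows "fmix k \<phi> \<longleftrightarrow> fmix k \<psi>"
  using dev_cong[OF assms] unfolding fmix_iff by simp

lemma measurable_prod_flow:
  assumes "\<And>i. i \<in> I \<Longrightarrow> \<phi> i \<in> borel_measurable M"
  shows "(\<lambda>x. \<Prod>i\<in>I. \<phi> i (f (t i) x) :: real) \<in> borel_measurable M"
  using assms by (intro borel_measurable_prod measurable_flow_comp)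

lemma corr_shift:
  assumes "\<And>i. i < k \<Longrightarrow> \<phi> i \<in> borel_measurable M"
  shows "corr k \<phi> (\<lambda>i. t i + s) = corr k \<phi> t"
proof -
  have "(\<lambda>x. \<Prod>i<k. \<phi> i (f (t i) x)) \<in> borel_measurable M"
    using assms by (intro measurable_prod_flow) auto
  from integral_flow[OF this, of s] show ?thesis
    unfolding corr_def by (simp add: flow_add')
qed

text \<open>The number \<open>c\<close> is free because the measure is invariant under
  \<open>f c\<close>. It serves to undo a normalisation of the times in one direction of the
  equivalence and is 0 in the other.\<close>

lemma measure_Inter_eq_corr:
  assumes "\<And>i. i < k \<Longrightarrow> A i \<in> sets M"
  shows "measure M (\<Inter>i<k. f (t i) ` A i)
    = corr k (\<lambda>i. indicator (A (k - Suc i))) (\<lambda>i. c - t (k - Suc i))"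
proof -
  let ?S = "\<Inter>i<k. f (t i) ` A i"
  have m: "f (t i) ` A i \<in> sets M" if "i < k" for i
    unfolding flow_image using measurable_sets[OF flow_measurable assms[OF that]] by simp
  have S: "?S \<in> sets M"
  proof (cases "k = 0")
    case False
    then show ?thesis using m by (intro sets.finite_INT) auto
  qed (use sets.top[of M] in simp)
  have ind: "indicator ?S x = (\<Prod>i<k. indicator (A i) (f (- t i) x) :: real)" for x
    unfolding flow_image by (auto simp: indicator_def prod_zero_iff)
  have "measure M ?S = (\<integral>x. indicator ?S x \<partial>M)"
    using S by simp
  also have "\<dots> = (\<integral>x. indicator ?S (f c x) \<partial>M)"
    using S by (intro integral_flow[symmetric]) auto
  also have "\<dots> = (\<integral>x. (\<Prod>i<k. indicator (A i) (f (c - t i) x)) \<partial>M)"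
    by (simp add: ind flow_add')
  also have "\<dots> = corr k (\<lambda>i. indicator (A (k - Suc i))) (\<lambda>i. c - t (k - Suc i))"
    unfolding corr_def
    by (intro Bochner_Integration.integral_cong refl prod.nat_diff_reindex[symmetric])
  finally show ?thesis .
qed

lemma mixing_of_order_imp_fmix:
  assumes mix: "mixing_of_order k M f" and A: "\<And>i. i < k \<Longrightarrow> A i \<in> sets M"
  shows "fmix k (\<lambda>i. indicator (A i))"
  unfolding fmix_iff
proof (intro allI impI)
  fix \<epsilon> :: real assume "\<epsilon> > 0"
  define B where "B i = A (k - Suc i)" for i
  have B: "\<forall>i<k. B i \<in> sets M" using A by (simp add: B_def)
  with mix \<open>\<epsilon> > 0\<close> obtain N where N: "\<And>t. time_tuple k t \<and> time_gap k t > ereal N \<Longrightarrow>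
      \<bar>measure M (\<Inter>i<k. f (t i) ` B i) - (\<Prod>i<k. measure M (B i))\<bar> < \<epsilon>"
    unfolding mixing_of_order_def by meson
  \<comment> \<open>\<open>N\<close> may be negative: the maximum with 0 makes the tuple increasing,
    and the added 1 gives a strict bound on the infimum of the gaps.\<close>
  have "\<bar>dev k (\<lambda>i. indicator (A i)) t\<bar> < \<epsilon>" if t: "gaps k (max N 0 + 1) t" for t
  proof -
    \<comment> \<open>The reversed tuple, translated so that it starts at 0; reversing it again
      gives back \<open>t\<close>.\<close>
    define s where "s i = t (k - 1) - t (k - Suc i)" for i
    have s: "gaps k (max N 0 + 1) s"
      unfolding s_def by (rule gaps_reverse[OF t])
    have "s 0 = 0" by (simp add: s_def)
    from time_tuple_gapsI[OF this s, of "max N 0"]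
    have "time_tuple k s" "time_gap k s > ereal (max N 0)" by auto
    moreover have "ereal N \<le> ereal (max N 0)" by simp
    ultimately have "time_tuple k s \<and> time_gap k s > ereal N"
      by (metis order_le_less_trans)
    from N[OF this] have *: "\<bar>measure M (\<Inter>i<k. f (s i) ` B i) - (\<Prod>i<k. measure M (B i))\<bar> < \<epsilon>" .
    have "measure M (\<Inter>i<k. f (s i) ` B i)
      = corr k (\<lambda>i. indicator (B (k - Suc i))) (\<lambda>i. t (k - 1) - s (k - Suc i))"
      using B by (intro measure_Inter_eq_corr) auto
    also have "\<dots> = corr k (\<lambda>i. indicator (A i)) t"
      unfolding corr_def s_def B_def by (intro Bochner_Integration.integral_cong prod.cong refl) simp
    finally have 1: "measure M (\<Inter>i<k. f (s i) ` B i) = corr k (\<lambda>i. indicator (A i)) t" .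
    have "(\<Prod>i<k. measure M (B i)) = (\<Prod>i<k. measure M (A i))"
      unfolding B_def by (rule prod.nat_diff_reindex)
    also have "\<dots> = (\<Prod>i<k. \<integral>x. indicator (A i) x \<partial>M)"
      using A by (intro prod.cong) auto
    finally show ?thesis using * 1 by (simp add: dev_def)
  qed
  then show "\<exists>N. \<forall>t. gaps k N t \<longrightarrow> \<bar>dev k (\<lambda>i. indicator (A i)) t\<bar> < \<epsilon>" by blast
qed

lemma fmix_imp_mixing_of_order:
  assumes mix: "\<And>A. (\<And>i. i < k \<Longrightarrow> A i \<in> sets M) \<Longrightarrow> fmix k (\<lambda>i. indicator (A i))"
  shows "mixing_of_order k M f"
  unfolding mixing_of_order_def
proof (intro allI impI)
  fix A :: "nat \<Rightarrow> 'a set" and \<epsilon> :: real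
  assume A: "\<forall>i<k. A i \<in> sets M" and "\<epsilon> > 0"
  define B where "B i = A (k - Suc i)" for i
  have B: "\<And>i. i < k \<Longrightarrow> B i \<in> sets M" using A by (simp add: B_def)
  obtain N where N: "\<And>t. gaps k N t \<Longrightarrow> \<bar>dev k (\<lambda>i. indicator (B i)) t\<bar> < \<epsilon>"
    using fmixD[OF mix[of B] \<open>\<epsilon> > 0\<close>] B by blast
  have "\<bar>measure M (\<Inter>i<k. f (t i) ` A i) - (\<Prod>i<k. measure M (A i))\<bar> < \<epsilon>"
    if t: "time_gap k t > ereal N" for t
  proof -
    have "gaps k N (\<lambda>i. 0 - t (k - Suc i))"
      by (rule gaps_reverse[OF time_gap_gaps[OF t]])
    from N[OF this] have *: "\<bar>dev k (\<lambda>i. indicator (B i)) (\<lambda>i. 0 - t (k - Suc i))\<bar> < \<epsilon>" .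
    have "(\<Prod>i<k. \<integral>x. indicator (B i) x \<partial>M) = (\<Prod>i<k. measure M (B i))"
      using B by (intro prod.cong) auto
    also have "\<dots> = (\<Prod>i<k. measure M (A i))"
      unfolding B_def by (rule prod.nat_diff_reindex)
    finally show ?thesis
      using * measure_Inter_eq_corr[of k A t 0] A by (simp add: dev_def B_def)
  qed
  then show "\<exists>N. \<forall>t. time_tuple k t \<and> time_gap k t > ereal N \<longrightarrow>
      \<bar>measure M (\<Inter>i<k. f (t i) ` A i) - (\<Prod>i<k. measure M (A i))\<bar> < \<epsilon>" by blast
qed

section \<open>From sets to bounded functions and back\<close>

lemma prod_flow_bound:
  assumes "\<And>i x. i \<in> I \<Longrightarrow> \<bar>\<phi> i x\<bar> \<le> C"
  shows "\<bar>\<Prod>i\<in>I. \<phi> i (f (t i) x)\<bar> \<le> (C::real) ^ card I"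
proof -
  have "\<bar>\<Prod>i\<in>I. \<phi> i (f (t i) x)\<bar> = (\<Prod>i\<in>I. \<bar>\<phi> i (f (t i) x)\<bar>)"
    by (rule abs_prod)
  also have "\<dots> \<le> (\<Prod>i\<in>I. C)"
    using assms by (intro prod_mono) auto
  finally show ?thesis by simp
qed

lemma corr_upd:
  assumes "n < k"
  shows "corr k (\<phi>(n := a)) t = (\<integral>x. a (f (t n) x) * (\<Prod>i\<in>{..<k} - {n}. \<phi> i (f (t i) x)) \<partial>M)"
  using assms unfolding corr_def
  by (subst prod.remove[of _ n]) (auto intro!: Bochner_Integration.integral_cong arg_cong2[of _ _ _ _ "(*)"] prod.cong)

lemma dev_upd:
  assumes "n < k"
  shows "dev k (\<phi>(n := a)) t = (\<integral>x. a (f (t n) x) * (\<Prod>i\<in>{..<k} - {n}. \<phi> i (f (t i) x)) \<partial>M)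
    - (\<integral>x. a x \<partial>M) * (\<Prod>i\<in>{..<k} - {n}. \<integral>x. \<phi> i x \<partial>M)"
proof -
  have "(\<Prod>i<k. \<integral>x. (\<phi>(n := a)) i x \<partial>M) = (\<integral>x. a x \<partial>M) * (\<Prod>i\<in>{..<k} - {n}. \<integral>x. \<phi> i x \<partial>M)"
    using assms by (subst prod.remove[of _ n]) (auto intro!: arg_cong2[of _ _ _ _ "(*)"] prod.cong)
  then show ?thesis
    using corr_upd[OF assms] by (simp add: dev_def)
qed

lemma integrable_mult_bounded:
  fixes F G :: "'a \<Rightarrow> real"
  assumes "integrable M F" "G \<in> borel_measurable M" "\<And>x. \<bar>G x\<bar> \<le> C"
  shows "integrable M (\<lambda>x. F x * G x)"
proof (rule Bochner_Integration.integrable_bound)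
  show "integrable M (\<lambda>x. F x * C)" using assms(1) by simp
  have "\<bar>G x\<bar> \<le> \<bar>C\<bar>" for x using assms(3)[of x] by linarith
  then show "AE x in M. norm (F x * G x) \<le> norm (F x * C)"
    by (simp add: abs_mult mult_left_mono)
qed (use assms in measurable)

context
  fixes k n :: nat and \<phi> :: "nat \<Rightarrow> 'a \<Rightarrow> real" and C :: real
  assumes n: "n < k"
    and meas: "\<And>i. i < k \<Longrightarrow> i \<noteq> n \<Longrightarrow> \<phi> i \<in> borel_measurable M"
    and bound: "\<And>i x. i < k \<Longrightarrow> i \<noteq> n \<Longrightarrow> \<bar>\<phi> i x\<bar> \<le> C"
begin

lemma integrable_upd:
  assumes "integrable M a"
  shows "integrable M (\<lambda>x. a (f s x) * (\<Prod>i\<in>{..<k} - {n}. \<phi> i (f (t i) x)))"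
  using assms meas bound prod_flow_bound[of "{..<k} - {n}" \<phi> C t]
  by (intro integrable_mult_bounded integrable_flow measurable_prod_flow) auto

lemma dev_upd_linear:
  assumes a: "integrable M a" and b: "integrable M b"
  shows "dev k (\<phi>(n := (\<lambda>x. c * a x + d * b x))) t
    = c * dev k (\<phi>(n := a)) t + d * dev k (\<phi>(n := b)) t"
  using integrable_upd[OF a, of "t n" t] integrable_upd[OF b, of "t n" t] a b
  by (simp add: dev_upd[OF n] ring_distribs mult.assoc)

text \<open>Both the correlation and the product of means are continuous in slot \<open>n\<close>
  for the L1 norm, with constant \<open>C ^ (k - 1)\<close> from the other slots.\<close>

lemma dev_upd_bound:
  assumes a: "integrable M a"
  shows "\<bar>dev k (\<phi>(n := a)) t\<bar> \<le> 2 * C ^ (k - 1) * (\<integral>x. \<bar>a x\<bar> \<partial>M)"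
proof -
  let ?P = "\<lambda>x. \<Prod>i\<in>{..<k} - {n}. \<phi> i (f (t i) x)"
  have card: "card ({..<k} - {n}) = k - 1" using n by simp
  have P: "\<bar>?P x\<bar> \<le> C ^ (k - 1)" for x
    using prod_flow_bound[of "{..<k} - {n}" \<phi> C t x] bound unfolding card by auto
  have "\<bar>\<integral>x. a (f (t n) x) * ?P x \<partial>M\<bar> \<le> (\<integral>x. \<bar>a (f (t n) x) * ?P x\<bar> \<partial>M)"
    by simp
  also have "\<dots> \<le> (\<integral>x. \<bar>a (f (t n) x)\<bar> * C ^ (k - 1) \<partial>M)"
    using integrable_abs[OF integrable_upd[OF a, of "t n" t]] integrable_flow[OF a, of "t n"] P
    by (intro integral_mono) (auto simp: abs_mult intro: mult_left_mono)
  also have "\<dots> = (\<integral>x. \<bar>a x\<bar> \<partial>M) * C ^ (k - 1)"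
    using integral_flow[of "\<lambda>x. \<bar>a x\<bar>" "t n"] a by simp
  finally have 1: "\<bar>\<integral>x. a (f (t n) x) * ?P x \<partial>M\<bar> \<le> C ^ (k - 1) * (\<integral>x. \<bar>a x\<bar> \<partial>M)"
    by (simp add: mult.commute)
  have "\<bar>\<Prod>i\<in>{..<k} - {n}. \<integral>x. \<phi> i x \<partial>M\<bar> = (\<Prod>i\<in>{..<k} - {n}. \<bar>\<integral>x. \<phi> i x \<partial>M\<bar>)"
    by (rule abs_prod)
  also have "\<dots> \<le> (\<Prod>i\<in>{..<k} - {n}. C)"
    using meas bound by (intro prod_mono) (auto intro: integral_le_bound)
  finally have 2: "\<bar>\<Prod>i\<in>{..<k} - {n}. \<integral>x. \<phi> i x \<partial>M\<bar> \<le> C ^ (k - 1)"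
    using card by simp
  have "\<bar>(\<integral>x. a x \<partial>M) * (\<Prod>i\<in>{..<k} - {n}. \<integral>x. \<phi> i x \<partial>M)\<bar> \<le> (\<integral>x. \<bar>a x\<bar> \<partial>M) * C ^ (k - 1)"
    unfolding abs_mult using 2 by (intro mult_mono) auto
  then show ?thesis
    unfolding dev_upd[OF n] using 1 by (simp add: mult.commute)
qed

lemma fmix_upd_linear:
  assumes "integrable M a" "integrable M b" "fmix k (\<phi>(n := a))" "fmix k (\<phi>(n := b))"
  shows "fmix k (\<phi>(n := (\<lambda>x. c * a x + d * b x)))"
proof -
  have "((\<lambda>t. c * dev k (\<phi>(n := a)) t + d * dev k (\<phi>(n := b)) t) \<longlongrightarrow> c * 0 + d * 0) (gap_filter k)"
    using assms(3,4) unfolding fmix_def by (intro tendsto_intros)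
  moreover have "dev k (\<phi>(n := (\<lambda>x. c * a x + d * b x)))
      = (\<lambda>t. c * dev k (\<phi>(n := a)) t + d * dev k (\<phi>(n := b)) t)"
    using dev_upd_linear[OF assms(1,2)] by blast
  ultimately show ?thesis
    unfolding fmix_def by simp
qed

text \<open>The preceding bound does not involve the times, so an L1 approximation in one slot
  changes \<open>dev\<close> uniformly in \<open>t\<close> and the limit survives.\<close>

lemma fmix_upd_L1_closed:
  assumes a: "integrable M a"
    and s: "\<And>\<epsilon>. \<epsilon> > 0 \<Longrightarrow> \<exists>b. integrable M b \<and> fmix k (\<phi>(n := b)) \<and> (\<integral>x. \<bar>a x - b x\<bar> \<partial>M) < \<epsilon>"
  shows "fmix k (\<phi>(n := a))"
  unfolding fmix_def tendsto_iff
proof (intro allI impI)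
  fix \<epsilon> :: real assume "\<epsilon> > 0"
  \<comment> \<open>If there is no other slot, nothing forces \<open>C\<close> to be nonnegative,
    hence the absolute value; the added 1 keeps \<open>D\<close> positive.\<close>
  define D where "D = 2 * \<bar>C\<bar> ^ (k - 1) + 1"
  have "D > 0" unfolding D_def by (intro add_nonneg_pos mult_nonneg_nonneg) auto
  obtain b where b: "integrable M b" "fmix k (\<phi>(n := b))" "(\<integral>x. \<bar>a x - b x\<bar> \<partial>M) < \<epsilon> / (2 * D)"
    using s[of "\<epsilon> / (2 * D)"] \<open>\<epsilon> > 0\<close> \<open>D > 0\<close> by auto
  have *: "\<bar>dev k (\<phi>(n := a)) t - dev k (\<phi>(n := b)) t\<bar> \<le> \<epsilon> / 2" for t
  proof -
    have "dev k (\<phi>(n := a)) t - dev k (\<phi>(n := b)) t = dev k (\<phi>(n := (\<lambda>x. a x - b x))) t"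
      using dev_upd_linear[OF a b(1), of 1 "-1" t] by simp
    then have "\<bar>dev k (\<phi>(n := a)) t - dev k (\<phi>(n := b)) t\<bar> \<le> 2 * C ^ (k - 1) * (\<integral>x. \<bar>a x - b x\<bar> \<partial>M)"
      using dev_upd_bound[of "\<lambda>x. a x - b x" t] a b(1) by simp
    also have "2 * C ^ (k - 1) \<le> 2 * \<bar>C\<bar> ^ (k - 1)"
      using abs_ge_self[of "C ^ (k - 1)"] by (simp add: power_abs)
    then have "2 * C ^ (k - 1) * (\<integral>x. \<bar>a x - b x\<bar> \<partial>M) \<le> D * (\<integral>x. \<bar>a x - b x\<bar> \<partial>M)"
      unfolding D_def by (intro mult_right_mono) auto
    also have "\<dots> \<le> D * (\<epsilon> / (2 * D))"
      using b(3) \<open>D > 0\<close> by (intro mult_left_mono) auto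
    also have "\<dots> = \<epsilon> / 2" using \<open>D > 0\<close> by simp
    finally show ?thesis .
  qed
  have "\<forall>\<^sub>F t in gap_filter k. \<bar>dev k (\<phi>(n := b)) t\<bar> < \<epsilon> / 2"
    using b(2) \<open>\<epsilon> > 0\<close> unfolding fmix_def tendsto_iff by (auto dest!: spec[of _ "\<epsilon> / 2"])
  then show "\<forall>\<^sub>F t in gap_filter k. dist (dev k (\<phi>(n := a)) t) 0 < \<epsilon>"
  proof eventually_elim
    case (elim t)
    then show ?case using *[of t] unfolding dist_real_def by linarith
  qed
qed

end

lemma L1_dominated_convergence:
  fixes a :: "'a \<Rightarrow> real"
  assumes "a \<in> borel_measurable M" "\<And>i. s i \<in> borel_measurable M" "integrable M w"
    and "\<And>x. (\<lambda>i. s i x) \<longlonglongrightarrow> a x" "\<And>i x. \<bar>s i x - a x\<bar> \<le> w x"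
  shows "(\<lambda>i. \<integral>x. \<bar>a x - s i x\<bar> \<partial>M) \<longlonglongrightarrow> 0"
proof -
  have "(\<lambda>i. \<integral>x. \<bar>a x - s i x\<bar> \<partial>M) \<longlonglongrightarrow> (\<integral>x. 0 \<partial>M)"
  proof (rule integral_dominated_convergence[where w = w])
    show "AE x in M. (\<lambda>i. \<bar>a x - s i x\<bar>) \<longlonglongrightarrow> 0"
    proof (intro AE_I2)
      fix x
      have "(\<lambda>i. \<bar>a x - s i x\<bar>) \<longlonglongrightarrow> \<bar>a x - a x\<bar>"
        by (intro tendsto_intros assms(4))
      then show "(\<lambda>i. \<bar>a x - s i x\<bar>) \<longlonglongrightarrow> 0" by simp
    qed
    show "AE x in M. norm \<bar>a x - s i x\<bar> \<le> w x" for i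
      using assms(5)[of i] by (auto simp: abs_minus_commute)
  qed (use assms in auto)
  then show ?thesis by simp
qed

text \<open>Indicators are replaced one slot at a time, the slots below \<open>n\<close> being those
  already arbitrary. In the slot under treatment the induction can run over all integrable
  functions, because linearity and L1 closedness require no bound there.\<close>

lemma fmix_bounded:
  assumes sets: "\<And>A. (\<And>i. i < k \<Longrightarrow> A i \<in> sets M) \<Longrightarrow> fmix k (\<lambda>i. indicator (A i))"
    and "\<And>i. i < k \<Longrightarrow> \<phi> i \<in> borel_measurable M" "\<And>i x. i < k \<Longrightarrow> \<bar>\<phi> i x\<bar> \<le> C"
  shows "fmix k \<phi>"
proof -
  have "fmix k \<psi>"
    if "n \<le> k" "\<And>i. i < n \<Longrightarrow> \<psi> i \<in> borel_measurable M \<and> (\<forall>x. \<bar>\<psi> i x\<bar> \<le> C)"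
      "\<And>i. n \<le> i \<Longrightarrow> i < k \<Longrightarrow> \<exists>A\<in>sets M. \<psi> i = indicator A" for n \<psi>
    using that
  proof (induction n arbitrary: \<psi>)
    case 0
    then have "\<forall>i\<in>{..<k}. \<exists>A. A \<in> sets M \<and> \<psi> i = indicator A" by auto
    from bchoice[OF this] obtain A where A: "\<And>i. i < k \<Longrightarrow> A i \<in> sets M \<and> \<psi> i = indicator (A i)"
      by auto
    then have "fmix k \<psi> \<longleftrightarrow> fmix k (\<lambda>i. indicator (A i))"
      by (intro fmix_cong) auto
    with sets[of A] A show ?case by blast
  next
    case (Suc n)
    \<comment> \<open>A common bound for the arbitrary slots and for the indicators in the
      others.\<close>
    define C' where "C' = max C 1"
    have m: "\<psi> i \<in> borel_measurable M" if "i < k" for i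
      using Suc.prems(2)[of i] Suc.prems(3)[of i] that by (cases "i < Suc n") auto
    have b: "\<bar>\<psi> i x\<bar> \<le> C'" if i: "i < k" for i x
    proof (cases "i < Suc n")
      case True
      then show ?thesis using Suc.prems(2)[of i] by (auto simp: C'_def le_max_iff_disj)
    next
      case False
      then obtain A where "\<psi> i = indicator A" using Suc.prems(3)[of i] i by auto
      then show ?thesis by (auto simp: C'_def indicator_def)
    qed
    have nk: "n < k" using Suc.prems(1) by simp
    have int: "integrable M (\<psi> n)"
      using m b nk by (intro integrable_bounded[of _ C']) auto
    have "fmix k (\<psi>(n := a))" if "integrable M a" for a
      using that
    proof (induction a rule: integrable_induct)
      case (base A c)
      have IH: "fmix k (\<psi>(n := indicator A))"
      proof (rule Suc.IH)
        fix i assume i: "n \<le> i" "i < k"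
        then show "\<exists>B\<in>sets M. (\<psi>(n := indicator A)) i = indicator B"
          using base Suc.prems(3)[of i] by (cases "i = n") auto
      qed (use Suc.prems in auto)
      have "fmix k (\<psi>(n := (\<lambda>x. c * indicator A x + 0 * indicator A x)))"
        using nk m b base IH by (intro fmix_upd_linear[where C = C']) auto
      then show ?case by (simp add: mult.commute fun_upd_def)
    next
      case (add a b')
      have "fmix k (\<psi>(n := (\<lambda>x. 1 * a x + 1 * b' x)))"
        using nk m b add by (intro fmix_upd_linear[where C = C']) (auto simp: fun_upd_def)
      then show ?case by (simp add: fun_upd_def)
    next
      case (lim a s)
      have conv: "(\<lambda>i. \<integral>x. \<bar>a x - s i x\<bar> \<partial>M) \<longlonglongrightarrow> 0"
      \<comment> \<open>The induction rule for integrable functions supplies approximants with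
        \<open>\<bar>s i x\<bar> \<le> 2 * \<bar>a x\<bar>\<close>.\<close>
      proof (rule L1_dominated_convergence[where w = "\<lambda>x. 3 * \<bar>a x\<bar>"])
        fix i x
        have "\<bar>s i x\<bar> \<le> 2 * \<bar>a x\<bar>" using lim.hyps(3)[of x i] by simp
        then show "\<bar>s i x - a x\<bar> \<le> 3 * \<bar>a x\<bar>" by linarith
      qed (use lim in auto)
      show ?case
      proof (rule fmix_upd_L1_closed[OF nk, where C = C'])
        fix \<epsilon> :: real assume "\<epsilon> > 0"
        with conv obtain i where "\<bar>\<integral>x. \<bar>a x - s i x\<bar> \<partial>M\<bar> < \<epsilon>"
          unfolding LIMSEQ_iff by fastforce
        then show "\<exists>b. integrable M b \<and> fmix k (\<psi>(n := b)) \<and> (\<integral>x. \<bar>a x - b x\<bar> \<partial>M) < \<epsilon>"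
          using lim.hyps(1) lim.IH by (intro exI[of _ "s i"]) (auto simp: fun_upd_def)
      qed (use m b lim in auto)
    qed
    from this[OF int] show ?case by simp
  qed
  from this[of k \<phi>] assms(2,3) show ?thesis by auto
qed

section \<open>Reduction to uniformly continuous functions\<close>

lemma indicator_uniformly_continuous_approx:
  fixes \<epsilon> :: real
  assumes "radon_measure M" "A \<in> sets M" "\<epsilon> > 0"
  shows "\<exists>\<psi> :: 'a \<Rightarrow> real. uniformly_continuous_on UNIV \<psi> \<and> (\<forall>x. \<bar>\<psi> x\<bar> \<le> 1)
    \<and> (\<integral>x. \<bar>indicator A x - \<psi> x\<bar> \<partial>M) < \<epsilon>"
proof -
  have "emeasure M A = (SUP K \<in> {K. compact K \<and> K \<subseteq> A}. emeasure M K)"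
    using assms unfolding radon_measure_def by blast
  then have sup: "ennreal (measure M A) = (SUP K \<in> {K. compact K \<and> K \<subseteq> A}. emeasure M K)"
    by (simp add: emeasure_eq_measure)
  \<comment> \<open>Inner regularity. If \<open>A\<close> has measure below
    \<open>\<epsilon> / 2\<close>, the empty set serves; otherwise the difference below stays
    nonnegative, so \<open>ennreal\<close> does not truncate it.\<close>
  obtain K where K: "compact K" "K \<subseteq> A" "measure M A < measure M K + \<epsilon> / 2"
  proof (cases "measure M A < \<epsilon> / 2")
    case True
    then show ?thesis by (intro that[of "{}"]) auto
  next
    case False
    then have "ennreal (measure M A - \<epsilon> / 2) < ennreal (measure M A)"
      using assms(3) by (intro ennreal_lessI) auto
    then obtain K where "compact K" "K \<subseteq> A" "ennreal (measure M A - \<epsilon> / 2) < emeasure M K"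
      unfolding sup less_SUP_iff by blast
    then show ?thesis
      using False by (intro that[of K]) (auto simp: emeasure_eq_measure ennreal_less_iff)
  qed
  have Km: "K \<in> sets M" using K(1) by (simp add: sets_M compact_imp_closed)
  have AK: "(\<integral>x. \<bar>indicator A x - indicator K x\<bar> \<partial>M) < \<epsilon> / 2"
  proof -
    have "(\<integral>x. \<bar>indicator A x - indicator K x :: real\<bar> \<partial>M) = (\<integral>x. indicator (A - K) x \<partial>M)"
      using K(2) by (intro Bochner_Integration.integral_cong) (auto simp: indicator_def)
    also have "\<dots> = measure M A - measure M K"
      using finite_measure_Diff[OF assms(2) Km K(2)] assms(2) Km by simp
    finally show ?thesis using K(3) by simp
  qed
  show ?thesis
  \<comment> \<open>By convention \<open>infdist x {}\<close> is 0, so the cutoffs used for nonempty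
    \<open>K\<close> would be 1 everywhere.\<close>
  proof (cases "K = {}")
    case True
    then show ?thesis
      using AK assms(3) by (intro exI[of _ "\<lambda>x. 0"]) (auto simp: uniformly_continuous_on_const)
  next
    case False
    \<comment> \<open>Lipschitz cutoffs with constant \<open>n\<close>; they decrease to the
      indicator of \<open>K\<close> because \<open>K\<close> is closed.\<close>
    define s where "s n x = max 0 (1 - real n * infdist x K)" for n x
    have uc: "uniformly_continuous_on UNIV (s n)" for n
      unfolding uniformly_continuous_on_def
    proof (intro allI impI)
      fix e :: real assume "0 < e"
      have "dist (s n x') (s n x) < e" if "dist x' x < e / (real n + 1)" for x x'
      proof -
        have "\<bar>infdist x' K - infdist x K\<bar> \<le> dist x' x"
          by (rule infdist_triangle_abs)
        then have *: "real n * \<bar>infdist x' K - infdist x K\<bar> \<le> real n * dist x' x"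
          by (intro mult_left_mono) auto
        have "dist (s n x') (s n x) \<le> \<bar>real n * infdist x' K - real n * infdist x K\<bar>"
          unfolding s_def dist_real_def by linarith
        also have "\<dots> = real n * \<bar>infdist x' K - infdist x K\<bar>"
          by (simp add: abs_mult flip: right_diff_distrib)
        also note *
        also have "real n * dist x' x \<le> (real n + 1) * dist x' x"
          by (simp add: ring_distribs)
        also have "\<dots> < e" using that by (simp add: pos_less_divide_eq mult.commute)
        finally show ?thesis .
      qed
      then show "\<exists>d>0. \<forall>x\<in>UNIV. \<forall>x'\<in>UNIV. dist x' x < d \<longrightarrow> dist (s n x') (s n x) < e"
        using \<open>0 < e\<close> by (intro exI[of _ "e / (real n + 1)"]) auto
    qed
    have s01: "0 \<le> s n x" "s n x \<le> 1" for n x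
      by (auto simp: s_def infdist_nonneg)
    have "(\<lambda>n. \<integral>x. \<bar>indicator K x - s n x\<bar> \<partial>M) \<longlonglongrightarrow> 0"
    proof (rule L1_dominated_convergence[where w = "\<lambda>x. 1"])
      show "s n \<in> borel_measurable M" for n
        by (intro continuous_measurable uniformly_continuous_imp_continuous uc)
      show "\<bar>s n x - indicator K x\<bar> \<le> 1" for n x
        using s01[of n x] by (auto simp: indicator_def)
      fix x
      show "(\<lambda>n. s n x) \<longlonglongrightarrow> indicator K x"
      proof (cases "x \<in> K")
        case True
        then show ?thesis by (simp add: s_def)
      next
        case nK: False
        then have pos: "infdist x K > 0"
          using K(1) False by (simp add: infdist_pos_not_in_closed compact_imp_closed)
        obtain N where N: "real N * infdist x K > 1"
          using reals_Archimedean3[OF pos] by blast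
        have "s n x = 0" if "n \<ge> N" for n
        proof -
          have "real N * infdist x K \<le> real n * infdist x K"
            using that pos by (intro mult_right_mono) auto
          with N show ?thesis by (simp add: s_def)
        qed
        then have "eventually (\<lambda>n. s n x = 0) sequentially"
          by (auto simp: eventually_sequentially)
        then show ?thesis using nK by (simp add: tendsto_eventually)
      qed
    qed (use Km in auto)
    then obtain n where n: "\<bar>\<integral>x. \<bar>indicator K x - s n x\<bar> \<partial>M\<bar> < \<epsilon> / 2"
      using assms(3) unfolding LIMSEQ_iff by (metis diff_zero half_gt_zero order_refl real_norm_def)
    have sm: "s n \<in> borel_measurable M"
      by (intro continuous_measurable uniformly_continuous_imp_continuous uc)
    have si: "integrable M (s n)"
      using s01 sm by (intro integrable_bounded[of _ 1]) auto
    have "(\<integral>x. \<bar>indicator A x - s n x\<bar> \<partial>M)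
      \<le> (\<integral>x. \<bar>indicator A x - indicator K x\<bar> + \<bar>indicator K x - s n x\<bar> \<partial>M)"
      using si assms(2) Km by (intro integral_mono) (auto intro!: integrable_real_indicator simp: emeasure_eq_measure)
    also have "\<dots> = (\<integral>x. \<bar>indicator A x - indicator K x\<bar> \<partial>M) + (\<integral>x. \<bar>indicator K x - s n x\<bar> \<partial>M)"
      using si assms(2) Km by (intro Bochner_Integration.integral_add) (auto intro!: integrable_real_indicator simp: emeasure_eq_measure)
    also have "\<dots> < \<epsilon>" using AK n by linarith
    finally show ?thesis
      using uc[of n] s01 by (intro exI[of _ "s n"]) (auto simp: abs_le_iff intro: order_trans[of _ 0])
  qed
qed

text \<open>Again one slot at a time, in the opposite direction: the slots below \<open>n\<close>
  are already indicators, the others still uniformly continuous.\<close>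

lemma fmix_indicator_if_fmix_continuous:
  assumes radon: "radon_measure M"
    and uc: "\<And>\<psi>. (\<And>i. i < k \<Longrightarrow> uniformly_continuous_on UNIV (\<psi> i)) \<Longrightarrow>
      (\<And>i x. i < k \<Longrightarrow> \<bar>\<psi> i x\<bar> \<le> 1) \<Longrightarrow> fmix k \<psi>"
    and A: "\<And>i. i < k \<Longrightarrow> A i \<in> sets M"
  shows "fmix k (\<lambda>i. indicator (A i))"
proof -
  have "fmix k \<psi>"
    if "n \<le> k" "\<And>i. i < k \<Longrightarrow> n \<le> i \<Longrightarrow> uniformly_continuous_on UNIV (\<psi> i) \<and> (\<forall>x. \<bar>\<psi> i x\<bar> \<le> 1)"
      "\<And>i. i < n \<Longrightarrow> \<psi> i = indicator (A i)" for n \<psi>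
    using that
  proof (induction n arbitrary: \<psi>)
    case 0
    then show ?case by (intro uc) auto
  next
    case (Suc n)
    have nk: "n < k" using Suc.prems(1) by simp
    have m: "\<psi> i \<in> borel_measurable M \<and> (\<forall>x. \<bar>\<psi> i x\<bar> \<le> 1)" if "i < k" for i
    proof (cases "Suc n \<le> i")
      case True
      with Suc.prems(2)[of i] that show ?thesis
        by (auto intro: continuous_measurable uniformly_continuous_imp_continuous)
    next
      case False
      then have "\<psi> i = indicator (A i)" using Suc.prems(3)[of i] by simp
      then show ?thesis using A[OF that] by (auto simp: indicator_def)
    qed
    have "fmix k (\<psi>(n := indicator (A n)))"
    proof (rule fmix_upd_L1_closed[OF nk, where C = 1])
      show "integrable M (indicat_real (A n))"
        using A[OF nk] by (auto intro!: integrable_real_indicator simp: emeasure_eq_measure)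
      fix \<epsilon> :: real assume "\<epsilon> > 0"
      from indicator_uniformly_continuous_approx[OF radon A[OF nk] this] obtain b
        where b: "uniformly_continuous_on UNIV b" "\<forall>x. \<bar>b x\<bar> \<le> 1" "(\<integral>x. \<bar>indicator (A n) x - b x\<bar> \<partial>M) < \<epsilon>"
        by blast
      have bm: "b \<in> borel_measurable M"
        by (intro continuous_measurable uniformly_continuous_imp_continuous b)
      have "fmix k (\<psi>(n := b))"
      proof (rule Suc.IH)
        fix i assume "i < k" "n \<le> i"
        then show "uniformly_continuous_on UNIV ((\<psi>(n := b)) i) \<and> (\<forall>x. \<bar>(\<psi>(n := b)) i x\<bar> \<le> 1)"
          using b Suc.prems(2)[of i] by (cases "i = n") auto
      qed (use Suc.prems in auto)
      moreover have "integrable M b"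
        using bm b(2) by (intro integrable_bounded[of _ 1]) auto
      ultimately show "\<exists>b. integrable M b \<and> fmix k (\<psi>(n := b)) \<and> (\<integral>x. \<bar>indicator (A n) x - b x\<bar> \<partial>M) < \<epsilon>"
        using b(3) by blast
    qed (use m in auto)
    moreover have "\<psi> n = indicator (A n)" using Suc.prems(3)[of n] by simp
    ultimately show ?case by (metis fun_upd_triv)
  qed
  from this[of k "\<lambda>i. indicator (A i)"] show ?thesis by auto
qed

section \<open>Reduction to functions of zero mean\<close>

definition skip :: "nat \<Rightarrow> nat \<Rightarrow> nat" where
  "skip n i = (if i < n then i else Suc i)"

lemma prod_skip:
  fixes F :: "nat \<Rightarrow> 'c::comm_monoid_mult"
  assumes "n \<le> k"
  shows "prod F ({..<Suc k} - {n}) = (\<Prod>i<k. F (skip n i))"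
proof (rule prod.reindex_bij_witness[of _ "skip n" "\<lambda>i. if i < n then i else i - 1"])
qed (use assms in \<open>auto simp: skip_def\<close>)

text \<open>Dropping an inner time merges two gaps into one longer than \<open>2 * N\<close>, which
  exceeds \<open>N\<close> only because \<open>N \<ge> 0\<close>.\<close>

lemma gaps_skip:
  assumes "gaps (Suc k) N t" "N \<ge> 0"
  shows "gaps k N (\<lambda>i. t (skip n i))"
  unfolding gaps_def
proof (intro allI impI)
  fix i assume i: "Suc i < k"
  have *: "t j + N < t (Suc j)" if "j < k" for j
    using assms(1) that unfolding gaps_def by simp
  show "t (skip n i) + N < t (skip n (Suc i))"
    using *[of i] *[of "Suc i"] i assms(2) unfolding skip_def by auto
qed

text \<open>A constant slot contributes 1 to the product and to the means, so the deviation is that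
  of the other \<open>k\<close> slots at the other times.\<close>

lemma fmix_upd_const:
  assumes "n \<le> k" and fm: "fmix k (\<lambda>i. \<phi> (skip n i))"
  shows "fmix (Suc k) (\<phi>(n := (\<lambda>x. 1)))"
  unfolding fmix_iff
proof (intro allI impI)
  fix \<epsilon> :: real assume "\<epsilon> > 0"
  obtain N where N: "N \<ge> 0" "\<And>t. gaps k N t \<Longrightarrow> \<bar>dev k (\<lambda>i. \<phi> (skip n i)) t\<bar> < \<epsilon>"
    using fmixD[OF fm \<open>\<epsilon> > 0\<close>] by blast
  have "dev (Suc k) (\<phi>(n := (\<lambda>x. 1))) t = dev k (\<lambda>i. \<phi> (skip n i)) (\<lambda>i. t (skip n i))" for t
  proof -
    have "n < Suc k" using assms(1) by simp
    from dev_upd[OF this] show ?thesis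
      by (simp add: prod_skip[OF assms(1)] dev_def corr_def prob_space[simplified])
  qed
  with N gaps_skip[of k N] show "\<exists>N. \<forall>t. gaps (Suc k) N t \<longrightarrow> \<bar>dev (Suc k) (\<phi>(n := (\<lambda>x. 1))) t\<bar> < \<epsilon>"
    by (intro exI[of _ N]) auto
qed

text \<open>Each slot is split into its mean and a centred part. By linearity the constant falls to
  order \<open>k\<close>, and the centred part continues the induction, in which only the slots
  below \<open>n\<close> may have nonzero mean.\<close>

lemma fmix_if_fmix_zero_mean:
  assumes lower: "\<And>\<psi>. (\<And>i. i < k \<Longrightarrow> \<psi> i \<in> borel_measurable M) \<Longrightarrow>
      (\<And>i x. i < k \<Longrightarrow> \<bar>\<psi> i x\<bar> \<le> 1) \<Longrightarrow> fmix k \<psi>"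
    and zero_mean: "\<And>\<psi>. (\<And>i. i \<le> k \<Longrightarrow> uniformly_continuous_on UNIV (\<psi> i)) \<Longrightarrow>
      (\<And>i x. i \<le> k \<Longrightarrow> \<bar>\<psi> i x\<bar> \<le> 1) \<Longrightarrow> (\<And>i. i \<le> k \<Longrightarrow> (\<integral>x. \<psi> i x \<partial>M) = 0) \<Longrightarrow> fmix (Suc k) \<psi>"
    and \<phi>: "\<And>i. i < Suc k \<Longrightarrow> uniformly_continuous_on UNIV (\<phi> i)"
      "\<And>i x. i < Suc k \<Longrightarrow> \<bar>\<phi> i x\<bar> \<le> 1"
  shows "fmix (Suc k) \<phi>"
proof -
  have "fmix (Suc k) \<psi>"
    if "n \<le> Suc k" "\<And>i. i \<le> k \<Longrightarrow> uniformly_continuous_on UNIV (\<psi> i) \<and> (\<forall>x. \<bar>\<psi> i x\<bar> \<le> 1)"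
      "\<And>i. n \<le> i \<Longrightarrow> i \<le> k \<Longrightarrow> (\<integral>x. \<psi> i x \<partial>M) = 0" for n \<psi>
    using that
  proof (induction n arbitrary: \<psi>)
    case 0
    then show ?case by (intro zero_mean) auto
  next
    case (Suc n)
    have nk: "n < Suc k" "n \<le> k" using Suc.prems(1) by simp_all
    have m: "\<psi> i \<in> borel_measurable M" "\<bar>\<psi> i x\<bar> \<le> 1" if "i \<le> k" for i x
      using Suc.prems(2)[OF that] by (auto intro: continuous_measurable uniformly_continuous_imp_continuous)
    have int: "integrable M (\<psi> n)"
      using m nk by (intro integrable_bounded[of _ 1]) auto
    define c where "c = (\<integral>x. \<psi> n x \<partial>M)"
    have c: "\<bar>c\<bar> \<le> 1" unfolding c_def using m nk by (intro integral_le_bound) auto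
    \<comment> \<open>Centring may double the bound, so half of the centred function is used;
      \<open>\<psi> n\<close> is recovered as \<open>2 * b + c\<close>.\<close>
    define b where "b x = (\<psi> n x - c) / 2" for x
    have b1: "\<bar>b x\<bar> \<le> 1" for x
      using m(2)[OF nk(2), of x] c unfolding b_def abs_le_iff by simp
    have ucb: "uniformly_continuous_on UNIV b"
    proof -
      have "uniformly_continuous_on UNIV (\<psi> n)" using Suc.prems(2) nk by simp
      then have "uniformly_continuous_on UNIV (\<lambda>x. (1/2) *\<^sub>R (\<psi> n x - c))"
        by (intro uniformly_continuous_on_cmul uniformly_continuous_on_diff uniformly_continuous_on_const)
      then show ?thesis unfolding b_def[abs_def] by simp
    qed
    have b0: "(\<integral>x. b x \<partial>M) = 0"
      unfolding b_def using int by (simp add: c_def prob_space[simplified])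
    have intb: "integrable M b" unfolding b_def[abs_def] using int by simp
    have "fmix (Suc k) (\<psi>(n := b))"
    proof (rule Suc.IH)
      fix i assume "i \<le> k"
      then show "uniformly_continuous_on UNIV ((\<psi>(n := b)) i) \<and> (\<forall>x. \<bar>(\<psi>(n := b)) i x\<bar> \<le> 1)"
        using ucb b1 Suc.prems(2)[of i] by (cases "i = n") auto
    next
      fix i assume "n \<le> i" "i \<le> k"
      then show "(\<integral>x. (\<psi>(n := b)) i x \<partial>M) = 0"
        using b0 Suc.prems(3)[of i] by (cases "i = n") auto
    qed (use Suc.prems in auto)
    moreover have "fmix (Suc k) (\<psi>(n := (\<lambda>x. 1)))"
      using nk m by (intro fmix_upd_const lower) (auto simp: skip_def)
    ultimately have "fmix (Suc k) (\<psi>(n := (\<lambda>x. 2 * b x + c * 1)))"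
      using nk m intb by (intro fmix_upd_linear[where C = 1]) auto
    moreover have "(\<lambda>x. 2 * b x + c * 1) = \<psi> n" by (simp add: b_def field_simps fun_eq_iff)
    ultimately show ?case by simp
  qed
  from this[of "Suc k" \<phi>] \<phi> show ?thesis by auto
qed

end

section \<open>Averages and almost measure preserving maps\<close>

text \<open>The sum counts the natural numbers below \<open>n * y\<close>; there are as many as the
  ceiling of \<open>n * y\<close>.\<close>

lemma threshold_sum_approx:
  fixes y :: real
  assumes "0 \<le> y" "y \<le> 1"
  shows "\<bar>real n * y - (\<Sum>k<n. if real k < real n * y then 1 else 0)\<bar> \<le> 1"
proof -
  define z where "z = real n * y"
  have z: "0 \<le> z" "z \<le> real n"
    using assms by (auto simp: z_def mult_left_le)
  have "(\<Sum>k<n. if real k < z then 1 else 0 :: real) = real (card {k \<in> {..<n}. real k < z})"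
    by (simp add: sum.If_cases Int_def)
  also have "{k \<in> {..<n}. real k < z} = {..<nat \<lceil>z\<rceil>}"
    using z by (auto simp: less_ceiling_iff nat_less_iff zless_nat_eq_int_zless)
  also have "real (card {..<nat \<lceil>z\<rceil>}) = of_int \<lceil>z\<rceil>"
    using z by simp
  finally show ?thesis
    unfolding z_def[symmetric] by linarith
qed

text \<open>A discrete layer cake formula: for values in the unit interval, the integral is the mean
  of the measures of the superlevel sets at the levels \<open>k / n\<close>, up to
  \<open>1 / n\<close>. Comparing integrals thus reduces to comparing measures of sets.\<close>

lemma (in prob_space) integral_diff_le_of_superlevel:
  fixes u v :: "'a \<Rightarrow> real"
  assumes u: "u \<in> borel_measurable M" "\<And>x. 0 \<le> u x" "\<And>x. u x \<le> 1"
    and v: "v \<in> borel_measurable M" "\<And>x. 0 \<le> v x" "\<And>x. v x \<le> 1"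
    and le: "\<And>c. c \<ge> 0 \<Longrightarrow> \<bar>prob {x \<in> space M. c < u x} - prob {x \<in> space M. c < v x}\<bar> \<le> e"
  shows "\<bar>(\<integral>x. u x \<partial>M) - (\<integral>x. v x \<partial>M)\<bar> \<le> e"
proof -
  have *: "\<bar>real n * (\<integral>x. w x \<partial>M) - (\<Sum>k<n. prob {x \<in> space M. real k / real n < w x})\<bar> \<le> 1"
    if w: "w \<in> borel_measurable M" "\<And>x. 0 \<le> w x" "\<And>x. w x \<le> 1" and n: "n > 0" for w :: "'a \<Rightarrow> real" and n
  proof -
    let ?W = "\<lambda>k. {x \<in> space M. real k / real n < w x}"
    have W: "?W k \<in> events" for k using w(1) by measurable
    have wi: "integrable M w"
      using w by (intro integrable_const_bound[of _ 1]) auto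
    have Wi: "integrable M (\<lambda>x. indicator (?W k) x :: real)" for k
      using W by (intro integrable_real_indicator) (auto simp: emeasure_eq_measure)
    have "real n * (\<integral>x. w x \<partial>M) - (\<Sum>k<n. prob (?W k))
      = (\<integral>x. real n * w x - (\<Sum>k<n. indicator (?W k) x) \<partial>M)"
      using wi Wi W by simp
    also have "\<bar>\<dots>\<bar> \<le> (\<integral>x. \<bar>real n * w x - (\<Sum>k<n. indicator (?W k) x)\<bar> \<partial>M)"
      by simp
    also have "\<dots> \<le> (\<integral>x. 1 \<partial>M)"
    proof (intro integral_mono)
      fix x assume x: "x \<in> space M"
      have "(\<Sum>k<n. indicator (?W k) x :: real) = (\<Sum>k<n. if real k < real n * w x then 1 else 0)"
        using n x by (intro sum.cong) (auto simp: indicator_def field_simps)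
      with threshold_sum_approx[of "w x" n] w(2,3)
      show "\<bar>real n * w x - (\<Sum>k<n. indicator (?W k) x)\<bar> \<le> 1" by simp
    qed (use wi Wi in auto)
    finally show ?thesis by (simp add: prob_space)
  qed
  have "\<bar>(\<integral>x. u x \<partial>M) - (\<integral>x. v x \<partial>M)\<bar> \<le> e + \<epsilon>" if "\<epsilon> > 0" for \<epsilon>
  proof -
    obtain n where n: "n > 0" "2 / real n < \<epsilon>"
    proof -
      obtain m :: nat where "2 / \<epsilon> < real m" using reals_Archimedean2 by blast
      with that \<open>\<epsilon> > 0\<close> show ?thesis
        using that[of "Suc m"] by (simp add: field_simps)
    qed
    let ?s = "\<lambda>w. \<Sum>k<n. prob {x \<in> space M. real k / real n < w x}"
    have "\<bar>?s u - ?s v\<bar> \<le> (\<Sum>k<n. \<bar>prob {x \<in> space M. real k / real n < u x} - prob {x \<in> space M. real k / real n < v x}\<bar>)"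
      unfolding sum_subtractf[symmetric] by (rule sum_abs)
    also have "\<dots> \<le> (\<Sum>k<n. e)"
      using le by (intro sum_mono) auto
    finally have "\<bar>?s u - ?s v\<bar> \<le> real n * e" by simp
    with *[OF u n(1)] *[OF v n(1)]
    have "\<bar>real n * (\<integral>x. u x \<partial>M) - real n * (\<integral>x. v x \<partial>M)\<bar> \<le> real n * e + 2"
      by linarith
    also have "\<bar>real n * (\<integral>x. u x \<partial>M) - real n * (\<integral>x. v x \<partial>M)\<bar> = real n * \<bar>(\<integral>x. u x \<partial>M) - (\<integral>x. v x \<partial>M)\<bar>"
      by (simp add: abs_mult flip: right_diff_distrib)
    finally have "\<bar>(\<integral>x. u x \<partial>M) - (\<integral>x. v x \<partial>M)\<bar> \<le> e + 2 / real n"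
      using n(1) by (simp add: field_simps)
    with n(2) show ?thesis by simp
  qed
  then show ?thesis by (rule field_le_epsilon)
qed

text \<open>The square of the sum has \<open>n\<close> diagonal terms, each at most
  \<open>B\<^sup>2\<close> in mean, and fewer than \<open>n\<^sup>2\<close> others, each at most
  \<open>e\<close>. Division by \<open>n\<^sup>2\<close> and Cauchy-Schwarz give the bound.\<close>

lemma (in prob_space) L1_average_bound:
  fixes Y :: "nat \<Rightarrow> 'a \<Rightarrow> real"
  assumes n: "n > 0" and Y: "\<And>r. r < n \<Longrightarrow> Y r \<in> borel_measurable M" "\<And>r x. r < n \<Longrightarrow> \<bar>Y r x\<bar> \<le> B"
    and e: "\<And>r r'. r < n \<Longrightarrow> r' < n \<Longrightarrow> r \<noteq> r' \<Longrightarrow> \<bar>\<integral>x. Y r x * Y r' x \<partial>M\<bar> \<le> e" and "e \<ge> 0"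
  shows "(\<integral>x. \<bar>(\<Sum>r<n. Y r x) / real n\<bar> \<partial>M) \<le> sqrt (B\<^sup>2 / real n + e)"
proof -
  define Z where "Z x = (\<Sum>r<n. Y r x)" for x
  have Zm: "Z \<in> borel_measurable M" unfolding Z_def using Y(1) by simp
  have YY: "\<bar>Y r x * Y r' x\<bar> \<le> B\<^sup>2" if "r < n" "r' < n" for r r' x
    using Y(2)[OF that(1), of x] Y(2)[OF that(2), of x]
    unfolding abs_mult power2_eq_square by (intro mult_mono) auto
  have YYi: "integrable M (\<lambda>x. Y r x * Y r' x)" if "r < n" "r' < n" for r r'
    using YY[OF that] Y(1) that by (intro integrable_const_bound[of _ "B\<^sup>2"]) auto
  have Yi: "integrable M (Y r)" if "r < n" for r
    using Y that by (intro integrable_const_bound[of _ B]) auto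
  have Zi: "integrable M Z" unfolding Z_def[abs_def] using Yi by (intro Bochner_Integration.integrable_sum) auto
  have Z2: "(Z x)\<^sup>2 = (\<Sum>r<n. \<Sum>r'<n. Y r x * Y r' x)" for x
    by (simp add: Z_def power2_eq_square sum_product)
  have Z2i: "integrable M (\<lambda>x. (Z x)\<^sup>2)"
    unfolding Z2 using YYi by (intro Bochner_Integration.integrable_sum) auto
  have "(\<integral>x. (Z x)\<^sup>2 \<partial>M) = (\<Sum>r<n. \<Sum>r'<n. \<integral>x. Y r x * Y r' x \<partial>M)"
    unfolding Z2 using YYi
    by (subst Bochner_Integration.integral_sum)
      (auto intro!: Bochner_Integration.integrable_sum sum.cong Bochner_Integration.integral_sum)
  also have "\<dots> \<le> (\<Sum>r<n. \<Sum>r'<n. (if r = r' then B\<^sup>2 else 0) + e)"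
  proof (intro sum_mono)
    fix r r' assume r: "r \<in> {..<n}" "r' \<in> {..<n}"
    show "(\<integral>x. Y r x * Y r' x \<partial>M) \<le> (if r = r' then B\<^sup>2 else 0) + e"
    proof (cases "r = r'")
      case True
      have "(\<integral>x. Y r x * Y r' x \<partial>M) \<le> (\<integral>x. B\<^sup>2 \<partial>M)"
        using r YYi YY[of r r'] by (intro integral_mono) (auto simp: abs_le_iff)
      then show ?thesis using True \<open>e \<ge> 0\<close> by (simp add: prob_space)
    next
      case False
      then show ?thesis using e[of r r'] r by (simp add: abs_le_iff)
    qed
  qed
  also have "\<dots> = real n * B\<^sup>2 + (real n)\<^sup>2 * e"
    by (simp add: sum.distrib sum.delta power2_eq_square algebra_simps)
  finally have le: "(\<integral>x. (Z x)\<^sup>2 \<partial>M) \<le> real n * B\<^sup>2 + (real n)\<^sup>2 * e" .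
  \<comment> \<open>Cauchy-Schwarz, in the form that the variance of \<open>\<bar>Z x\<bar>\<close>
    is nonnegative.\<close>
  have "variance (\<lambda>x. \<bar>Z x\<bar>) = (\<integral>x. \<bar>Z x\<bar>\<^sup>2 \<partial>M) - (\<integral>x. \<bar>Z x\<bar> \<partial>M)\<^sup>2"
    using Zi Z2i by (intro variance_eq) auto
  then have "(\<integral>x. \<bar>Z x\<bar> \<partial>M)\<^sup>2 \<le> (\<integral>x. (Z x)\<^sup>2 \<partial>M)"
    using variance_positive[of "\<lambda>x. \<bar>Z x\<bar>"] by simp
  with le have "(\<integral>x. \<bar>Z x\<bar> \<partial>M)\<^sup>2 / (real n)\<^sup>2 \<le> (real n * B\<^sup>2 + (real n)\<^sup>2 * e) / (real n)\<^sup>2"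
    by (intro divide_right_mono) auto
  also have "\<dots> = B\<^sup>2 / real n + e"
    using n by (simp add: add_divide_distrib power2_eq_square)
  finally have "((\<integral>x. \<bar>Z x\<bar> \<partial>M) / real n)\<^sup>2 \<le> B\<^sup>2 / real n + e"
    by (simp add: power_divide)
  then have "(\<integral>x. \<bar>Z x\<bar> \<partial>M) / real n \<le> sqrt (B\<^sup>2 / real n + e)"
    by (rule real_le_rsqrt)
  then show ?thesis
    by (simp add: Z_def)
qed

text \<open>Taking preimages of subsets of \<open>W\<close> under \<open>g\<close> changes their
  measure by at most \<open>2 * \<delta>\<close>; applied to superlevel sets, this compares the
  integrals.\<close>

lemma (in prob_space) almost_measure_preserving_integral:
  fixes F :: "'a \<Rightarrow> real"
  assumes amp: "almost_measure_preserving \<delta> (restrict_space M W) (restrict_space M W) g X0 Y0"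
    and W: "W \<in> sets M" and "\<delta> \<ge> 0"
    and F: "F \<in> borel_measurable M" "\<And>x. \<bar>F x\<bar> \<le> 1"
  shows "\<bar>(\<integral>x. indicator W x * F (g x) \<partial>M) - (\<integral>x. indicator W x * F x \<partial>M)\<bar> \<le> 4 * \<delta>"
proof -
  have WM: "W \<subseteq> space M" using W by (rule sets.sets_into_space)
  then have spW: "space (restrict_space M W) = W" by (auto simp: space_restrict_space)
  have msW: "measure (restrict_space M W) A = prob A" if "A \<subseteq> W" for A
    using that W by (simp add: measure_restrict_space)
  have stW: "A \<in> sets (restrict_space M W) \<longleftrightarrow> A \<in> sets M \<and> A \<subseteq> W" for A
    using W by (auto simp: sets_restrict_space_iff)
  from amp have g: "g \<in> measurable (restrict_space M W) (restrict_space M W)"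
    and X0: "X0 \<in> events" "X0 \<subseteq> W" and Y0: "Y0 \<in> events" "Y0 \<subseteq> W"
    and Y0': "measure (restrict_space M W) (W - Y0) < \<delta> * measure (restrict_space M W) W"
    and pres': "\<forall>A\<in>sets (restrict_space M W). A \<subseteq> Y0 \<longrightarrow>
      (1 - \<delta>) * measure (restrict_space M W) A \<le> measure (restrict_space M W) (g -` A \<inter> X0)"
    unfolding almost_measure_preserving_def spW by (auto simp: stW)
  have pres: "(1 - \<delta>) * measure (restrict_space M W) A \<le> measure (restrict_space M W) (g -` A \<inter> X0)"
    if "A \<in> events" "A \<subseteq> Y0" "A \<subseteq> W" for A
    using pres' that stW by blast
  have gM: "g -` A \<inter> W \<in> events" if "A \<in> events" "A \<subseteq> W" for A
    using measurable_sets[OF g, of A] that by (simp add: stW spW)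
  have gW: "g x \<in> W" if "x \<in> W" for x
    using measurable_space[OF g, of x] that by (simp add: spW)
  have Y0'': "prob (W - Y0) \<le> \<delta>"
  proof -
    have "prob (W - Y0) < \<delta> * prob W" using Y0' by (simp add: msW)
    also have "\<dots> \<le> \<delta>" using \<open>\<delta> \<ge> 0\<close> by (simp add: mult_left_le)
    finally show ?thesis by simp
  qed
  \<comment> \<open>One \<open>\<delta>\<close> pays for the part of \<open>A\<close> outside the
    proper codomain, the other for the factor \<open>1 - \<delta>\<close>.\<close>
  have lower: "prob A - 2 * \<delta> \<le> prob (g -` A \<inter> W)" if A: "A \<in> events" "A \<subseteq> W" for A
  proof -
    have "A \<subseteq> (A \<inter> Y0) \<union> (W - Y0)" using A by auto
    then have "prob A \<le> prob ((A \<inter> Y0) \<union> (W - Y0))"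
      using A Y0 W by (intro finite_measure_mono) auto
    also have "\<dots> \<le> prob (A \<inter> Y0) + prob (W - Y0)"
      using A Y0 W by (intro measure_Un_le) auto
    finally have 1: "prob A \<le> prob (A \<inter> Y0) + \<delta>" using Y0'' by simp
    have "\<delta> * prob (A \<inter> Y0) \<le> \<delta>" using \<open>\<delta> \<ge> 0\<close> by (simp add: mult_left_le)
    then have "prob (A \<inter> Y0) - \<delta> \<le> (1 - \<delta>) * prob (A \<inter> Y0)" by (simp add: algebra_simps)
    also have "\<dots> \<le> prob (g -` (A \<inter> Y0) \<inter> X0)"
    proof -
      have "A \<inter> Y0 \<subseteq> W" "g -` (A \<inter> Y0) \<inter> X0 \<subseteq> W" using A X0 by auto
      then show ?thesis using pres[of "A \<inter> Y0"] A Y0 by (simp add: msW)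
    qed
    also have "\<dots> \<le> prob (g -` A \<inter> W)"
      using gM[OF A] X0 by (intro finite_measure_mono) auto
    finally show ?thesis using 1 by simp
  qed
  \<comment> \<open>The opposite inequality is the lower bound for \<open>W - A\<close>, since
    \<open>g\<close> maps \<open>W\<close> into itself.\<close>
  have both: "\<bar>prob (g -` A \<inter> W) - prob A\<bar> \<le> 2 * \<delta>" if A: "A \<in> events" "A \<subseteq> W" for A
  proof -
    have "g -` (W - A) \<inter> W = W - (g -` A \<inter> W)" using gW by auto
    then have "prob (g -` (W - A) \<inter> W) = prob W - prob (g -` A \<inter> W)"
      using finite_measure_Diff[OF W gM[OF A]] by auto
    moreover have "prob (W - A) = prob W - prob A"
      using finite_measure_Diff[OF W A(1,2)] .
    ultimately show ?thesis
      using lower[OF A] lower[of "W - A"] A W by auto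
  qed
  \<comment> \<open>Values in the unit interval are required for the comparison of superlevel sets;
    scaling back turns \<open>2 * \<delta>\<close> into \<open>4 * \<delta>\<close>.\<close>
  define G where "G x = (F x + 1) / 2" for x
  have Gm: "G \<in> borel_measurable M" unfolding G_def using F(1) by measurable
  have G01: "0 \<le> G x" "G x \<le> 1" for x
    using F(2)[of x] unfolding G_def abs_le_iff by auto
  have idW: "(\<lambda>x. x) \<in> measurable (restrict_space M W) M"
    by (rule measurable_restrict_space1) simp
  have Fg: "(\<lambda>x. indicator W x * H (g x)) \<in> borel_measurable M" if "H \<in> borel_measurable M" for H :: "'a \<Rightarrow> real"
  proof -
    have "(\<lambda>x. H (g x)) \<in> borel_measurable (restrict_space M W)"
      using measurable_compose[OF measurable_compose[OF g idW] that] .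
    then show ?thesis
      using borel_measurable_restrict_space_iff[of W M "\<lambda>x. H (g x)"] W WM by (simp add: Int_absorb2)
  qed
  have "\<bar>(\<integral>x. indicator W x * G (g x) \<partial>M) - (\<integral>x. indicator W x * G x \<partial>M)\<bar> \<le> 2 * \<delta>"
  proof (rule integral_diff_le_of_superlevel)
    show "(\<lambda>x. indicator W x * G (g x)) \<in> borel_measurable M" by (rule Fg[OF Gm])
    show "(\<lambda>x. indicator W x * G x) \<in> borel_measurable M" using Gm W by measurable
    fix c :: real assume "c \<ge> 0"
    define A where "A = {x \<in> W. c < G x}"
    have "A = W \<inter> {x \<in> space M. c < G x}" using WM by (auto simp: A_def)
    then have A: "A \<in> events" "A \<subseteq> W" using Gm W by (auto simp: A_def)
    have "{x \<in> space M. c < indicator W x * G (g x)} = g -` A \<inter> W"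
      using \<open>c \<ge> 0\<close> WM gW by (auto simp: A_def indicator_def split: if_splits)
    moreover have "{x \<in> space M. c < indicator W x * G x} = A"
      using \<open>c \<ge> 0\<close> WM by (auto simp: A_def indicator_def split: if_splits)
    ultimately show "\<bar>prob {x \<in> space M. c < indicator W x * G (g x)} - prob {x \<in> space M. c < indicator W x * G x}\<bar> \<le> 2 * \<delta>"
      using both[OF A] by simp
  qed (use G01 in \<open>auto simp: indicator_def\<close>)
  moreover have "(\<integral>x. indicator W x * H x \<partial>M) = ((\<integral>x. indicator W x * (H' x) \<partial>M) + prob W) / 2"
    if "(\<lambda>x. indicator W x * H' x) \<in> borel_measurable M" "\<And>x. \<bar>H' x\<bar> \<le> 1" "\<And>x. H x = (H' x + 1) / 2" for H H' :: "'a \<Rightarrow> real"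
  proof -
    have i: "integrable M (\<lambda>x. indicator W x * H' x)"
      using that by (intro integrable_const_bound[of _ 1]) (auto simp: abs_mult indicator_def)
    have i': "integrable M (indicat_real W)" using W by (auto intro!: integrable_real_indicator simp: emeasure_eq_measure)
    have "(\<integral>x. indicator W x * H x \<partial>M) = (\<integral>x. (indicator W x * H' x + indicator W x) / 2 \<partial>M)"
      by (simp add: that(3) algebra_simps)
    also have "\<dots> = ((\<integral>x. indicator W x * (H' x) \<partial>M) + prob W) / 2"
      using i i' W by simp
    finally show ?thesis .
  qed
  from this[OF Fg[OF F(1)] F(2), of "\<lambda>x. G (g x)"] this[of F G] F W
  have "(\<integral>x. indicator W x * G (g x) \<partial>M) = ((\<integral>x. indicator W x * F (g x) \<partial>M) + prob W) / 2"
    "(\<integral>x. indicator W x * G x \<partial>M) = ((\<integral>x. indicator W x * F x \<partial>M) + prob W) / 2"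
    by (auto simp: G_def)
  ultimately show ?thesis by (simp add: abs_le_iff field_simps)
qed

section \<open>Decorrelation from almost invariant weights\<close>

context mp_flow
begin

text \<open>Invariance is asked only up to time \<open>T\<close>. A tower much taller than
  \<open>T\<close> provides this, whereas a mixing flow has no nontrivial invariant sets.\<close>

definition almost_inv :: "real \<Rightarrow> real \<Rightarrow> ('a \<Rightarrow> real) \<Rightarrow> bool" where
  "almost_inv T \<eta> \<sigma> \<longleftrightarrow> (\<forall>r\<in>{0..T}. (\<integral>x. \<bar>\<sigma> (f r x) - \<sigma> x\<bar> \<partial>M) \<le> \<eta>)"

lemma fmix_pair:
  assumes fm: "fmix 2 (\<lambda>i. \<psi>)" and "e > 0"
  shows "\<exists>N\<ge>0. \<forall>a b. \<bar>a - b\<bar> > N \<longrightarrow> \<bar>(\<integral>x. \<psi> (f a x) * \<psi> (f b x) \<partial>M) - (\<integral>x. \<psi> x \<partial>M)\<^sup>2\<bar> < e"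
proof -
  obtain N where N: "N \<ge> 0" "\<And>t. gaps 2 N t \<Longrightarrow> \<bar>dev 2 (\<lambda>i. \<psi>) t\<bar> < e"
    using fmixD[OF fm \<open>e > 0\<close>] by blast
  have *: "\<bar>(\<integral>x. \<psi> (f a x) * \<psi> (f b x) \<partial>M) - (\<integral>x. \<psi> x \<partial>M)\<^sup>2\<bar> < e" if "a + N < b" for a b
    using N(2)[of "\<lambda>i. if i = 0 then a else b"] that
    by (simp add: gaps_def dev_def corr_def numeral_2_eq_2 lessThan_Suc power2_eq_square mult.commute)
  have "\<bar>(\<integral>x. \<psi> (f a x) * \<psi> (f b x) \<partial>M) - (\<integral>x. \<psi> x \<partial>M)\<^sup>2\<bar> < e" if "\<bar>a - b\<bar> > N" for a b
  proof (cases "a < b")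
    case True
    then show ?thesis using *[of a b] that by simp
  next
    case False
    then show ?thesis using *[of b a] that by (simp add: mult.commute)
  qed
  with N(1) show ?thesis by blast
qed

text \<open>Averaging the product along the flow turns mixing of order \<open>k\<close> for the functions
  \<open>\<psi> i \<circ> f r \<cdot> \<psi> i \<circ> f r'\<close> into convergence in \<open>L\<^sup>1\<close>; hence the product decorrelates from every
  almost invariant weight, uniformly in the weight, which may depend on \<open>t\<close>.\<close>

lemma decorrelation_almost_inv:
  assumes mixk: "\<And>\<psi>. (\<And>i. i < k \<Longrightarrow> \<psi> i \<in> borel_measurable M) \<Longrightarrow>
      (\<And>i x. i < k \<Longrightarrow> \<bar>\<psi> i x\<bar> \<le> 1) \<Longrightarrow> fmix k \<psi>"
    and mix2: "\<And>\<psi>. \<psi> \<in> borel_measurable M \<Longrightarrow> (\<And>x. \<bar>\<psi> x\<bar> \<le> 1) \<Longrightarrow> fmix 2 (\<lambda>i. \<psi>)"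
    and \<psi>: "\<And>i. i < k \<Longrightarrow> \<psi> i \<in> borel_measurable M" "\<And>i x. i < k \<Longrightarrow> \<bar>\<psi> i x\<bar> \<le> 1"
    and "\<eta> > 0"
  shows "\<exists>T\<ge>0. \<forall>\<^sub>F t in gap_filter k. \<forall>\<sigma>. \<sigma> \<in> borel_measurable M \<and> (\<forall>x. \<bar>\<sigma> x\<bar> \<le> 1) \<and> almost_inv T \<eta> \<sigma> \<longrightarrow>
    \<bar>(\<integral>x. \<sigma> x * (\<Prod>i<k. \<psi> i (f (t i) x)) \<partial>M) - (\<integral>x. \<sigma> x \<partial>M) * (\<Prod>i<k. \<integral>x. \<psi> i x \<partial>M)\<bar> \<le> 2 * \<eta>"
proof -
  \<comment> \<open>The error budget of the L1 bound is \<open>\<eta>\<^sup>2\<close>: the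
    off-diagonal part \<open>(real k + 3) * e\<close> equals one half, and
    \<open>n > 8 / \<eta>\<^sup>2\<close> keeps the diagonal part \<open>4 / n\<close> below the
    other.\<close>
  define e where "e = \<eta>\<^sup>2 / (2 * (real k + 3))"
  have e: "e > 0" using \<open>\<eta> > 0\<close> by (auto simp: e_def)
  obtain n :: nat where n: "real n > 8 / \<eta>\<^sup>2" using reals_Archimedean2 by blast
  then have n0: "n > 0" using \<open>\<eta> > 0\<close>
    by (metis divide_pos_pos gr_zeroI of_nat_0 order.asym zero_less_numeral zero_less_power)
  have "\<forall>i\<in>{..<k}. \<exists>N\<ge>0. \<forall>a b. \<bar>a - b\<bar> > N \<longrightarrow>
      \<bar>(\<integral>x. \<psi> i (f a x) * \<psi> i (f b x) \<partial>M) - (\<integral>x. \<psi> i x \<partial>M)\<^sup>2\<bar> < e"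
    using \<psi> e by (intro ballI fmix_pair mix2) auto
  from bchoice[OF this] obtain N where N: "\<And>i. i < k \<Longrightarrow> N i \<ge> 0"
    "\<And>i a b. i < k \<Longrightarrow> \<bar>a - b\<bar> > N i \<Longrightarrow>
      \<bar>(\<integral>x. \<psi> i (f a x) * \<psi> i (f b x) \<partial>M) - (\<integral>x. \<psi> i x \<partial>M)\<^sup>2\<bar> < e"
    by auto
  \<comment> \<open>A spacing above every \<open>N i\<close>, so that each \<open>\<psi> i\<close>
    decorrelates from itself between distinct multiples of \<open>q\<close>.\<close>
  define q where "q = (\<Sum>i<k. N i) + 1"
  have q: "q > N i" if "i < k" for i
    using member_le_sum[of i "{..<k}" N] N(1) that by (force simp: q_def)
  have q0: "q > 0" using N(1) by (auto simp: q_def intro!: add_nonneg_pos sum_nonneg)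
  define T where "T = real n * q"
  have T0: "T \<ge> 0" using q0 by (simp add: T_def)
  define c where "c = (\<Prod>i<k. \<integral>x. \<psi> i x \<partial>M)"
  have c1: "\<bar>c\<bar> \<le> 1"
  proof -
    have "\<bar>c\<bar> = (\<Prod>i<k. \<bar>\<integral>x. \<psi> i x \<partial>M\<bar>)" unfolding c_def by (rule abs_prod)
    also have "\<dots> \<le> (\<Prod>i<k. 1)"
      using \<psi> by (intro prod_mono) (auto intro: integral_le_bound)
    finally show ?thesis by simp
  qed
  \<comment> \<open>Two shifted copies of the whole product multiply to one product of order
    \<open>k\<close> at the same times, with these functions in the slots.\<close>
  define \<psi>2 where "\<psi>2 r r' i x = \<psi> i (f (real r * q) x) * \<psi> i (f (real r' * q) x)" for r r' i x
  have \<psi>2m: "\<psi>2 r r' i \<in> borel_measurable M" if "i < k" for r r' i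
    unfolding \<psi>2_def[abs_def] using \<psi>(1)[OF that] by measurable
  have \<psi>2b: "\<bar>\<psi>2 r r' i x\<bar> \<le> 1" if "i < k" for r r' i x
    unfolding \<psi>2_def abs_mult using \<psi>(2)[OF that] by (intro mult_le_one) auto
  have \<psi>2c: "\<bar>(\<Prod>i<k. \<integral>x. \<psi>2 r r' i x \<partial>M) - c\<^sup>2\<bar> \<le> real k * e" if "r \<noteq> r'" for r r'
  proof -
    have "\<bar>real r * q - real r' * q\<bar> \<ge> q"
    proof -
      have "\<bar>real r * q - real r' * q\<bar> = \<bar>real r - real r'\<bar> * q"
        using q0 by (simp add: abs_mult flip: left_diff_distrib)
      moreover have "\<bar>real r - real r'\<bar> \<ge> 1" using that by linarith
      ultimately show ?thesis using q0 by (simp add: mult_right_mono)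
    qed
    then have *: "\<bar>(\<integral>x. \<psi>2 r r' i x \<partial>M) - (\<integral>x. \<psi> i x \<partial>M)\<^sup>2\<bar> \<le> e" if "i < k" for i
      using N(2)[OF that, of "real r * q" "real r' * q"] q[OF that] by (simp add: \<psi>2_def)
    have 1: "\<bar>\<integral>x. \<psi> i x \<partial>M\<bar> \<le> 1" if "i < k" for i
      using \<psi> that by (intro integral_le_bound) auto
    have "c\<^sup>2 = (\<Prod>i<k. (\<integral>x. \<psi> i x \<partial>M)\<^sup>2)" by (simp add: c_def prod_power_distrib)
    then have "norm ((\<Prod>i<k. \<integral>x. \<psi>2 r r' i x \<partial>M) - c\<^sup>2)
      \<le> (\<Sum>i<k. norm ((\<integral>x. \<psi>2 r r' i x \<partial>M) - (\<integral>x. \<psi> i x \<partial>M)\<^sup>2))"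
      using \<psi>2m \<psi>2b 1 by (simp only:, intro norm_prod_diff) (auto intro!: integral_le_bound simp: abs_square_le_1)
    also have "\<dots> \<le> (\<Sum>i<k. e)"
      using * by (intro sum_mono) auto
    finally show ?thesis by simp
  qed
  have "fmix k (\<psi>2 r r')" for r r'
    using \<psi>2m \<psi>2b by (intro mixk) auto
  then have "\<forall>\<^sub>F t in gap_filter k. \<bar>dev k (\<psi>2 r r') t\<bar> < e" for r r'
    using e unfolding fmix_def tendsto_iff by simp
  then have "\<forall>\<^sub>F t in gap_filter k. \<forall>r\<in>{..<n}. \<forall>r'\<in>{..<n}. \<bar>dev k (\<psi>2 r r') t\<bar> < e"
    by (intro eventually_ball_finite ballI) auto
  moreover have "fmix k \<psi>" using \<psi> by (intro mixk) auto
  then have "\<forall>\<^sub>F t in gap_filter k. \<bar>dev k \<psi> t\<bar> < e"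
    using e unfolding fmix_def tendsto_iff by simp
  ultimately have "\<forall>\<^sub>F t in gap_filter k. \<forall>\<sigma>. \<sigma> \<in> borel_measurable M \<and> (\<forall>x. \<bar>\<sigma> x\<bar> \<le> 1) \<and> almost_inv T \<eta> \<sigma> \<longrightarrow>
    \<bar>(\<integral>x. \<sigma> x * (\<Prod>i<k. \<psi> i (f (t i) x)) \<partial>M) - (\<integral>x. \<sigma> x \<partial>M) * (\<Prod>i<k. \<integral>x. \<psi> i x \<partial>M)\<bar> \<le> 2 * \<eta>"
  proof eventually_elim
    case (elim t)
    define G where "G x = (\<Prod>i<k. \<psi> i (f (t i) x))" for x
    have Gm: "G \<in> borel_measurable M"
      unfolding G_def using \<psi> by (intro measurable_prod_flow) auto
    have G1: "\<bar>G x\<bar> \<le> 1" for x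
      unfolding G_def using prod_flow_bound[of "{..<k}" \<psi> 1 t x] \<psi>(2) by auto
    define Y where "Y r x = G (f (real r * q) x) - c" for r x
    have Ym: "Y r \<in> borel_measurable M" for r
      unfolding Y_def[abs_def] using Gm by measurable
    have Y2: "\<bar>Y r x\<bar> \<le> 2" for r x
      unfolding Y_def using G1[of "f (real r * q) x"] c1 by linarith
    have Gr: "integrable M (\<lambda>x. G (f s x))" for s
      using Gm G1 by (intro integrable_bounded[of _ 1]) auto
    have GG: "integrable M (\<lambda>x. G (f s x) * G (f s' x))" for s s'
      using Gr G1 Gm by (intro integrable_mult_bounded[where C = 1]) auto
    have intG: "(\<integral>x. G (f s x) \<partial>M) = corr k \<psi> t" for s
      unfolding integral_flow[OF Gm] by (simp add: G_def[abs_def] corr_def)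
    have intGG: "(\<integral>x. G (f (real r * q) x) * G (f (real r' * q) x) \<partial>M) = corr k (\<psi>2 r r') t" for r r'
      unfolding G_def corr_def \<psi>2_def prod.distrib[symmetric] flow_add' by (simp add: add.commute)
    \<comment> \<open>Of the \<open>k + 3\<close> errors \<open>e\<close>, \<open>k\<close> come
      from the means of the doubled functions, one from their deviation and two from the cross terms
      with \<open>c\<close>.\<close>
    have "(\<integral>x. \<bar>(\<Sum>r<n. Y r x) / real n\<bar> \<partial>M) \<le> sqrt (2\<^sup>2 / real n + (real k + 3) * e)"
    proof (rule L1_average_bound[OF n0])
      fix r r' assume r: "r < n" "r' < n" "r \<noteq> r'"
      have "(\<integral>x. Y r x * Y r' x \<partial>M) = (\<integral>x. G (f (real r * q) x) * G (f (real r' * q) x)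
          - c * G (f (real r * q) x) - c * G (f (real r' * q) x) + c\<^sup>2 \<partial>M)"
        by (simp add: Y_def algebra_simps power2_eq_square)
      also have "\<dots> = corr k (\<psi>2 r r') t - c * corr k \<psi> t - c * corr k \<psi> t + c\<^sup>2"
        using Gr GG by (simp add: intG intGG prob_space[simplified])
      also have "\<dots> = (corr k (\<psi>2 r r') t - c\<^sup>2) - 2 * (c * (corr k \<psi> t - c))"
        by (simp add: algebra_simps power2_eq_square)
      finally have eq: "(\<integral>x. Y r x * Y r' x \<partial>M) = (corr k (\<psi>2 r r') t - c\<^sup>2) - 2 * (c * (corr k \<psi> t - c))" .
      have "\<bar>corr k (\<psi>2 r r') t - (\<Prod>i<k. \<integral>x. \<psi>2 r r' i x \<partial>M)\<bar> < e"
        using elim(1) r by (simp add: dev_def)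
      moreover have "\<bar>corr k \<psi> t - c\<bar> < e" using elim(2) by (simp add: dev_def c_def)
      then have "\<bar>c\<bar> * \<bar>corr k \<psi> t - c\<bar> \<le> 1 * e"
        using c1 by (intro mult_mono) auto
      then have "\<bar>c * (corr k \<psi> t - c)\<bar> \<le> e" by (simp add: abs_mult)
      ultimately show "\<bar>\<integral>x. Y r x * Y r' x \<partial>M\<bar> \<le> (real k + 3) * e"
        unfolding eq using \<psi>2c[OF r(3)] by (simp add: ring_distribs abs_le_iff abs_less_iff)
    qed (use Ym Y2 e in auto)
    also have "\<dots> \<le> sqrt (\<eta>\<^sup>2)"
    proof (rule real_sqrt_le_mono)
      have "2\<^sup>2 / real n \<le> \<eta>\<^sup>2 / 2"
        using n n0 \<open>\<eta> > 0\<close> by (simp add: field_simps)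
      moreover have "(real k + 3) * e = \<eta>\<^sup>2 / 2"
        by (simp add: e_def field_simps)
      ultimately show "2\<^sup>2 / real n + (real k + 3) * e \<le> \<eta>\<^sup>2" by simp
    qed
    also have "sqrt (\<eta>\<^sup>2) = \<eta>" using \<open>\<eta> > 0\<close> by simp
    finally have L1: "(\<integral>x. \<bar>(\<Sum>r<n. Y r x) / real n\<bar> \<partial>M) \<le> \<eta>" .
    show ?case
    proof (intro allI impI, elim conjE)
      fix \<sigma> :: "'a \<Rightarrow> real"
      assume \<sigma>: "\<sigma> \<in> borel_measurable M" "\<forall>x. \<bar>\<sigma> x\<bar> \<le> 1" "almost_inv T \<eta> \<sigma>"
      have \<sigma>i: "integrable M (\<lambda>x. \<sigma> (f s x))" for s
        using \<sigma> by (intro integrable_bounded[of _ 1]) auto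
      have \<sigma>G: "integrable M (\<lambda>x. \<sigma> (f s x) * G (f s' x))" for s s'
        using \<sigma>i G1 Gm by (intro integrable_mult_bounded[where C = 1]) auto
      define I where "I = (\<integral>x. \<sigma> x * G x \<partial>M)"
      \<comment> \<open>Shifting weight and product together leaves \<open>I\<close> unchanged; then
        the shift is taken off the weight at cost \<open>\<eta>\<close>.\<close>
      have Ir: "\<bar>I - (\<integral>x. \<sigma> x * G (f (real r * q) x) \<partial>M)\<bar> \<le> \<eta>" if "r < n" for r
      proof -
        let ?s = "real r * q"
        have "?s \<in> {0..T}" using that q0 by (auto simp: T_def intro: mult_right_mono)
        then have inv: "(\<integral>x. \<bar>\<sigma> (f ?s x) - \<sigma> x\<bar> \<partial>M) \<le> \<eta>"
          using \<sigma>(3) by (simp add: almost_inv_def)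
        have "I = (\<integral>x. \<sigma> (f ?s x) * G (f ?s x) \<partial>M)"
          unfolding I_def using \<sigma>(1) Gm by (subst integral_flow) auto
        then have "I - (\<integral>x. \<sigma> x * G (f ?s x) \<partial>M) = (\<integral>x. (\<sigma> (f ?s x) - \<sigma> x) * G (f ?s x) \<partial>M)"
          using \<sigma>G[of ?s ?s] \<sigma>G[of 0 ?s] by (simp add: left_diff_distrib)
        also have "\<bar>\<dots>\<bar> \<le> (\<integral>x. \<bar>(\<sigma> (f ?s x) - \<sigma> x) * G (f ?s x)\<bar> \<partial>M)" by simp
        also have "\<dots> \<le> (\<integral>x. \<bar>\<sigma> (f ?s x) - \<sigma> x\<bar> \<partial>M)"
        proof (rule integral_mono)
          show "integrable M (\<lambda>x. \<bar>(\<sigma> (f ?s x) - \<sigma> x) * G (f ?s x)\<bar>)"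
            using \<sigma>G[of ?s ?s] \<sigma>G[of 0 ?s] by (simp add: left_diff_distrib)
          show "integrable M (\<lambda>x. \<bar>\<sigma> (f ?s x) - \<sigma> x\<bar>)"
            using \<sigma>i[of ?s] \<sigma>i[of 0] by simp
        qed (use G1 in \<open>auto simp: abs_mult mult_left_le\<close>)
        finally show ?thesis using inv by simp
      qed
      have "real n * I - (\<Sum>r<n. \<integral>x. \<sigma> x * G (f (real r * q) x) \<partial>M)
        = (\<Sum>r<n. I - (\<integral>x. \<sigma> x * G (f (real r * q) x) \<partial>M))"
        by (simp add: sum_subtractf)
      also have "\<bar>\<dots>\<bar> \<le> (\<Sum>r<n. \<bar>I - (\<integral>x. \<sigma> x * G (f (real r * q) x) \<partial>M)\<bar>)"
        by (rule sum_abs)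
      also have "\<dots> \<le> (\<Sum>r<n. \<eta>)" using Ir by (intro sum_mono) auto
      finally have 1: "\<bar>real n * I - (\<Sum>r<n. \<integral>x. \<sigma> x * G (f (real r * q) x) \<partial>M)\<bar> \<le> real n * \<eta>" by simp
      have Yi: "integrable M (\<lambda>x. \<Sum>r<n. Y r x)"
        using Ym Y2 by (intro Bochner_Integration.integrable_sum integrable_bounded[of _ 2]) auto
      have \<sigma>Y: "integrable M (\<lambda>x. \<sigma> x * (\<Sum>r<n. Y r x))"
        using integrable_mult_bounded[OF Yi, of \<sigma> 1] \<sigma> by (simp add: mult.commute)
      have "(\<Sum>r<n. \<integral>x. \<sigma> x * G (f (real r * q) x) \<partial>M) - real n * (c * (\<integral>x. \<sigma> x \<partial>M))
        = (\<Sum>r<n. (\<integral>x. \<sigma> x * G (f (real r * q) x) \<partial>M) - c * (\<integral>x. \<sigma> x \<partial>M))"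
        by (simp add: sum_subtractf)
      also have "\<dots> = (\<Sum>r<n. \<integral>x. \<sigma> x * Y r x \<partial>M)"
      proof (rule sum.cong)
        fix r
        show "(\<integral>x. \<sigma> x * G (f (real r * q) x) \<partial>M) - c * (\<integral>x. \<sigma> x \<partial>M) = (\<integral>x. \<sigma> x * Y r x \<partial>M)"
          using \<sigma>G[of 0 "real r * q"] \<sigma>i[of 0] by (simp add: Y_def right_diff_distrib mult.commute)
      qed simp
      also have "\<dots> = (\<integral>x. (\<Sum>r<n. \<sigma> x * Y r x) \<partial>M)"
      proof (rule Bochner_Integration.integral_sum[symmetric])
        fix r
        show "integrable M (\<lambda>x. \<sigma> x * Y r x)"
          using \<sigma>i[of 0] Y2 Ym by (intro integrable_mult_bounded[where C = 2]) auto
      qed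
      also have "\<bar>\<dots>\<bar> \<le> (\<integral>x. \<bar>\<Sum>r<n. \<sigma> x * Y r x\<bar> \<partial>M)" by simp
      \<comment> \<open>The weight disappears here, which is why the estimate is uniform in
        it.\<close>
      also have "\<dots> \<le> (\<integral>x. \<bar>\<Sum>r<n. Y r x\<bar> \<partial>M)"
        using integrable_abs[OF Yi] integrable_abs[OF \<sigma>Y] \<sigma>(2)
        by (intro integral_mono) (auto simp: abs_mult mult_left_le_one_le simp flip: sum_distrib_left)
      also have "\<dots> \<le> real n * \<eta>"
        using L1 n0 by (simp add: field_simps)
      finally have "\<bar>real n * I - real n * (c * (\<integral>x. \<sigma> x \<partial>M))\<bar> \<le> real n * (2 * \<eta>)"
        using 1 by linarith
      then have "real n * \<bar>I - c * (\<integral>x. \<sigma> x \<partial>M)\<bar> \<le> real n * (2 * \<eta>)"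
        by (simp add: abs_mult flip: right_diff_distrib)
      then have "\<bar>I - c * (\<integral>x. \<sigma> x \<partial>M)\<bar> \<le> 2 * \<eta>"
        using n0 by simp
      then show "\<bar>(\<integral>x. \<sigma> x * (\<Prod>i<k. \<psi> i (f (t i) x)) \<partial>M) - (\<integral>x. \<sigma> x \<partial>M) * (\<Prod>i<k. \<integral>x. \<psi> i x \<partial>M)\<bar> \<le> 2 * \<eta>"
        by (simp add: I_def G_def c_def mult.commute)
    qed
  qed
  with T0 show ?thesis by blast
qed

section \<open>Almost invariance of towers and of their intersections\<close>

lemma almost_inv_mono: "almost_inv T \<eta> \<sigma> \<Longrightarrow> T' \<le> T \<Longrightarrow> \<eta> \<le> \<eta>' \<Longrightarrow> almost_inv T' \<eta>' \<sigma>"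
  unfolding almost_inv_def by (meson atLeastAtMost_iff order_trans)

lemma integrable_indicator_flow:
  assumes "A \<in> sets M"
  shows "integrable M (\<lambda>x. indicator A (f s x) :: real)"
  using assms by (intro integrable_flow integrable_real_indicator) (auto simp: emeasure_eq_measure)

lemma almost_inv_Int:
  assumes A: "A \<in> sets M" "almost_inv T a (indicator A)"
    and B: "B \<in> sets M" "almost_inv T b (indicator B)"
  shows "almost_inv T (a + b) (indicator (A \<inter> B))"
  unfolding almost_inv_def
proof
  fix r assume r: "r \<in> {0..T}"
  let ?d = "\<lambda>A x. \<bar>indicator A (f r x) - indicator A x :: real\<bar>"
  have i: "integrable M (?d A)" if "A \<in> sets M" for A
    using integrable_indicator_flow[OF that, of r] integrable_indicator_flow[OF that, of 0] by simp
  have AB: "A \<inter> B \<in> sets M" using A B by auto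
  have "(\<integral>x. ?d (A \<inter> B) x \<partial>M) \<le> (\<integral>x. ?d A x + ?d B x \<partial>M)"
    using i[OF A(1)] i[OF B(1)] i[OF AB] by (intro integral_mono) (auto simp: indicator_def)
  also have "\<dots> = (\<integral>x. ?d A x \<partial>M) + (\<integral>x. ?d B x \<partial>M)"
    using i[OF A(1)] i[OF B(1)] by simp
  also have "\<dots> \<le> a + b"
    using A(2) B(2) r unfolding almost_inv_def by (intro add_mono) auto
  finally show "(\<integral>x. ?d (A \<inter> B) x \<partial>M) \<le> a + b" .
qed

lemma almost_inv_INT:
  assumes "finite I" "I \<noteq> {}" "\<And>i. i \<in> I \<Longrightarrow> A i \<in> sets M" "\<And>i. i \<in> I \<Longrightarrow> almost_inv T \<eta> (indicator (A i))"
  shows "almost_inv T (real (card I) * \<eta>) (indicator (\<Inter>i\<in>I. A i))"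
  using assms
proof (induction I rule: finite_ne_induct)
  case (insert i I)
  then have "almost_inv T (\<eta> + real (card I) * \<eta>) (indicator (A i \<inter> (\<Inter>i\<in>I. A i)))"
    by (intro almost_inv_Int sets.finite_INT) auto
  with insert show ?case by (simp add: algebra_simps)
qed simp

text \<open>Points of the tower outside its image under \<open>f r\<close> lie on levels below
  \<open>r\<close>. Their shifts by \<open>j * r\<close> with \<open>j < n\<close> occupy disjoint
  ranges of levels inside the tower, so \<open>n\<close> copies of this set fit into a probability
  space.\<close>

lemma tower_shift_measure:
  assumes tower: "tower M f H A" and r: "r > 0" "real n * r \<le> H"
  shows "real n * measure M (A - f r ` A) \<le> 1"
proof -
  from tower obtain B where A: "A \<in> sets M" "A = (\<Union>t\<in>{0..H}. f t ` B)"
    and disj: "\<And>t t'. t \<in> {0..H} \<Longrightarrow> t' \<in> {0..H} \<Longrightarrow> t \<noteq> t' \<Longrightarrow> f t ` B \<inter> f t' ` B = {}"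
    unfolding tower_def by blast
  define D where "D = A - f r ` A"
  have Dm: "D \<in> sets M"
    unfolding D_def flow_image using measurable_sets[OF flow_measurable A(1)] A(1) by auto
  have D: "\<exists>t b. 0 \<le> t \<and> t < r \<and> b \<in> B \<and> x = f t b" if "x \<in> D" for x
  proof -
    have xA: "x \<in> A" "f (- r) x \<notin> A" using that by (auto simp: D_def flow_image)
    then obtain t b where t: "t \<in> {0..H}" "b \<in> B" "x = f t b" unfolding A(2) by blast
    have "\<not> r \<le> t"
    proof
      assume "r \<le> t"
      then have "f (t - r) b \<in> A" unfolding A(2) using t r by auto
      with xA(2) t(3) show False by (simp add: flow_add')
    qed
    with t show ?thesis by auto
  qed
  have shifted: "\<exists>t b. real j * r \<le> t \<and> t < real (Suc j) * r \<and> t \<in> {0..H} \<and> b \<in> B \<and> x = f t b"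
    if "x \<in> f (real j * r) ` D" "j < n" for x j
  proof -
    from that(1) obtain y where "y \<in> D" "x = f (real j * r) y" by blast
    with D[of y] obtain t b where t: "0 \<le> t" "t < r" "b \<in> B" "x = f (real j * r + t) b"
      by (auto simp: flow_add')
    have "real (Suc j) * r \<le> real n * r" using that(2) r by (intro mult_right_mono) auto
    with t r show ?thesis
      by (intro exI[of _ "real j * r + t"] exI[of _ b]) (auto simp: algebra_simps)
  qed
  have "disjoint_family_on (\<lambda>j. f (real j * r) ` D) {..<n}"
    unfolding disjoint_family_on_def
  proof (intro ballI impI)
    fix i j assume ij: "i \<in> {..<n}" "j \<in> {..<n}" "i \<noteq> j"
    show "f (real i * r) ` D \<inter> f (real j * r) ` D = {}"
    proof (rule ccontr)
      assume "\<not> ?thesis"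
      then obtain x where x: "x \<in> f (real i * r) ` D" "x \<in> f (real j * r) ` D" by blast
      obtain t b where t: "real i * r \<le> t" "t < real (Suc i) * r" "t \<in> {0..H}" "b \<in> B" "x = f t b"
        using shifted[OF x(1)] ij by auto
      obtain s c where s: "real j * r \<le> s" "s < real (Suc j) * r" "s \<in> {0..H}" "c \<in> B" "x = f s c"
        using shifted[OF x(2)] ij by auto
      have "t = s" using disj[OF t(3) s(3)] t s by blast
      then have "real i * r < real (Suc j) * r" "real j * r < real (Suc i) * r"
        using t(1,2) s(1,2) by linarith+
      then show False using r ij by simp
    qed
  qed
  moreover have jm: "f (real j * r) ` D \<in> sets M" for j
    unfolding flow_image using measurable_sets[OF flow_measurable Dm] by auto
  moreover have "measure M (f (real j * r) ` D) = measure M D" for j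
  proof -
    have "measure M (f (real j * r) ` D) = measure (distr M M (f (- (real j * r)))) D"
      unfolding flow_image using Dm by (subst measure_distr) auto
    then show ?thesis by (simp add: flow_distr)
  qed
  ultimately have "real n * measure M D = measure M (\<Union>j<n. f (real j * r) ` D)"
    by (subst finite_measure_finite_Union) auto
  also have "\<dots> \<le> 1" by (rule prob_le_1)
  finally show ?thesis by (simp add: D_def)
qed

text \<open>The difference of the two indicators has integral 0, so its L1 norm is twice the
  integral of its positive part. That part is the indicator of \<open>D\<close> composed with
  \<open>f r\<close>, where \<open>D\<close> is the set bounded in the preceding lemma.\<close>

lemma almost_inv_tower:
  assumes tower: "tower M f H A" and n: "n > 0" and T: "real n * T \<le> H"
  shows "almost_inv T (2 / real n) (indicator A)"
  unfolding almost_inv_def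
proof
  fix r assume r: "r \<in> {0..T}"
  show "(\<integral>x. \<bar>indicator A (f r x) - indicator A x :: real\<bar> \<partial>M) \<le> 2 / real n"
  proof (cases "r = 0")
    case False
    with r have r0: "r > 0" by simp
    have "real n * r \<le> H" using r T n by (intro order_trans[OF _ T] mult_left_mono) auto
    from tower_shift_measure[OF tower r0 this]
    have le: "measure M (A - f r ` A) \<le> 1 / real n" using n by (simp add: field_simps)
    have A: "A \<in> sets M" using tower by (simp add: tower_def)
    define D where "D = A - f r ` A"
    have D: "D \<in> sets M"
      unfolding D_def flow_image using measurable_sets[OF flow_measurable A] A by auto
    have "(\<integral>x. \<bar>indicator A (f r x) - indicator A x :: real\<bar> \<partial>M)
      = (\<integral>x. 2 * indicator D (f r x) - (indicator A (f r x) - indicator A x) \<partial>M)"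
      by (intro Bochner_Integration.integral_cong) (auto simp: D_def indicator_def flow_image flow_add')
    also have "\<dots> = 2 * (\<integral>x. indicator D (f r x) \<partial>M) - ((\<integral>x. indicator A (f r x) \<partial>M) - (\<integral>x. indicator A x \<partial>M))"
      using integrable_indicator_flow[OF D, of r] integrable_indicator_flow[OF A, of r]
        integrable_indicator_flow[OF A, of 0] by simp
    also have "\<dots> = 2 * measure M D"
      using A D by (simp add: integral_flow)
    finally show ?thesis using le by (simp add: D_def)
  qed (use n in simp)
qed

section \<open>Almost partitions and common refinements\<close>

lemma almost_partition_measure:
  assumes "almost_partition M \<delta> A I P" "finite I"
  shows "measure M (A - (\<Union>i\<in>I. P i)) \<le> \<delta> * measure M A"
proof -
  define U where "U = (\<Union>a\<in>{a\<in>I. P a \<inter> A \<noteq> {}}. P a)"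
  from assms have A: "A \<in> sets M" "\<And>a. a \<in> I \<Longrightarrow> P a \<in> sets M"
    and le: "measure M ((A - U) \<union> (U - A)) < \<delta> * measure M A"
    unfolding almost_partition_def U_def Let_def by auto
  have U: "U \<in> sets M" unfolding U_def using A assms(2) by (intro sets.finite_UN) auto
  have "measure M (A - (\<Union>i\<in>I. P i)) \<le> measure M ((A - U) \<union> (U - A))"
    using A U assms(2) by (intro finite_measure_mono) (auto simp: U_def)
  with le show ?thesis by simp
qed

text \<open>A point covered by every partition selects one piece from each, hence a member of the
  refinement. So a point that the refinement misses is missed by one of the partitions.\<close>

lemma refinement_measure:
  assumes I: "finite I" and L: "\<And>i. i \<in> I \<Longrightarrow> finite (L i)" and A: "A \<in> sets M"
    and P: "\<And>i l. i \<in> I \<Longrightarrow> l \<in> L i \<Longrightarrow> P i l \<in> sets M"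
    and cover: "\<And>i. i \<in> I \<Longrightarrow> measure M (A - (\<Union>l\<in>L i. P i l)) \<le> e"
  shows "measure M (A - (\<Union>w\<in>PiE I L. \<Inter>i\<in>I. P i (w i))) \<le> real (card I) * e"
proof -
  have Pi: "A - (\<Union>l\<in>L i. P i l) \<in> sets M" if "i \<in> I" for i
    using that P L A by (intro sets.Diff sets.finite_UN) auto
  have "A - (\<Union>w\<in>PiE I L. \<Inter>i\<in>I. P i (w i)) \<subseteq> (\<Union>i\<in>I. A - (\<Union>l\<in>L i. P i l))"
  proof (rule subsetI, rule ccontr)
    fix x assume x: "x \<in> A - (\<Union>w\<in>PiE I L. \<Inter>i\<in>I. P i (w i))"
      and "x \<notin> (\<Union>i\<in>I. A - (\<Union>l\<in>L i. P i l))"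
    then have "\<forall>i\<in>I. \<exists>l. l \<in> L i \<and> x \<in> P i l" by auto
    from bchoice[OF this] obtain w where w: "\<forall>i\<in>I. w i \<in> L i \<and> x \<in> P i (w i)" by blast
    then have "restrict w I \<in> PiE I L" "x \<in> (\<Inter>i\<in>I. P i (restrict w I i))" by auto
    with x show False by blast
  qed
  then have "measure M (A - (\<Union>w\<in>PiE I L. \<Inter>i\<in>I. P i (w i))) \<le> measure M (\<Union>i\<in>I. A - (\<Union>l\<in>L i. P i l))"
    using Pi I by (intro finite_measure_mono sets.finite_UN) auto
  also have "\<dots> \<le> (\<Sum>i\<in>I. measure M (A - (\<Union>l\<in>L i. P i l)))"
    using Pi I by (intro finite_measure_subadditive_finite) auto
  also have "\<dots> \<le> (\<Sum>i\<in>I. e)" using cover by (intro sum_mono) auto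
  finally show ?thesis by simp
qed

section \<open>The shearing estimate\<close>

text \<open>The cutoff by \<open>W\<close> makes this measurable on the whole space: the maps of
  (LUS1) are measurable as maps on the union of the towers.\<close>

definition pullback_prod ::
    "(nat \<Rightarrow> 'a \<Rightarrow> real) \<Rightarrow> nat \<Rightarrow> (nat \<Rightarrow> real) \<Rightarrow> 'a set \<Rightarrow> ('a \<Rightarrow> 'a) \<Rightarrow> 'a \<Rightarrow> real" where
  "pullback_prod \<psi> k s W g x = indicator W x * (\<Prod>i<k. \<psi> i (f (s i) (g x)))"

text \<open>On an intersection of a piece for \<open>g1\<close> with one for \<open>g2\<close>, both
  products are compared with products having constant shifts. The errors \<open>e\<close> and
  \<open>e1\<close> are weighted by the measures of the disjoint intersections and add up to one
  copy; \<open>e2\<close> is counted once per pair and can be chosen after \<open>Z\<close>.\<close>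

lemma off_diagonal_bound:
  fixes S1 S2 :: "'z \<Rightarrow> 'a set" and \<psi> :: "nat \<Rightarrow> 'a \<Rightarrow> real"
  assumes W: "W \<in> sets M" and Z: "finite Z"
    and \<psi>: "\<And>i. i < k \<Longrightarrow> \<psi> i \<in> borel_measurable M" "\<And>i x. i < k \<Longrightarrow> \<bar>\<psi> i x\<bar> \<le> 1"
    and Ym: "pullback_prod \<psi> k s W g1 \<in> borel_measurable M" "pullback_prod \<psi> k s W g2 \<in> borel_measurable M"
    and S1: "\<And>z. z \<in> Z \<Longrightarrow> S1 z \<in> sets M" "\<And>z. z \<in> Z \<Longrightarrow> S1 z \<subseteq> W" "disjoint_family_on S1 Z"
      "measure M (W - (\<Union>z\<in>Z. S1 z)) \<le> a"
    and S2: "\<And>z. z \<in> Z \<Longrightarrow> S2 z \<in> sets M" "\<And>z. z \<in> Z \<Longrightarrow> S2 z \<subseteq> W" "disjoint_family_on S2 Z"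
      "measure M (W - (\<Union>z\<in>Z. S2 z)) \<le> a"
    and close1: "\<And>z i x. z \<in> Z \<Longrightarrow> i < k \<Longrightarrow> x \<in> S1 z \<Longrightarrow>
      \<bar>\<psi> i (f (s i) (g1 x)) - \<psi> i (f (s i + u1 z i) x)\<bar> \<le> e"
    and close2: "\<And>z i x. z \<in> Z \<Longrightarrow> i < k \<Longrightarrow> x \<in> S2 z \<Longrightarrow>
      \<bar>\<psi> i (f (s i) (g2 x)) - \<psi> i (f (s i + u2 z i) x)\<bar> \<le> e"
    and decor: "\<And>z z'. z \<in> Z \<Longrightarrow> z' \<in> Z \<Longrightarrow>
      \<bar>\<integral>x. indicator (S1 z \<inter> S2 z') x * (\<Prod>i<k. \<psi> i (f (s i + u1 z i) x) * \<psi> i (f (s i + u2 z' i) x)) \<partial>M\<bar>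
        \<le> e1 * measure M (S1 z \<inter> S2 z') + e2"
    and "e \<ge> 0" "e1 \<ge> 0"
  shows "\<bar>\<integral>x. pullback_prod \<psi> k s W g1 x * pullback_prod \<psi> k s W g2 x \<partial>M\<bar> \<le> 2 * a + 2 * real k * e + e1 + (real (card Z))\<^sup>2 * e2"
proof -
  define P where "P p = S1 (fst p) \<inter> S2 (snd p)" for p
  define V where "V = (\<Union>p\<in>Z \<times> Z. P p)"
  define G where "G p x = (\<Prod>i<k. \<psi> i (f (s i + u1 (fst p) i) x) * \<psi> i (f (s i + u2 (snd p) i) x))" for p x
  define H where "H x = pullback_prod \<psi> k s W g1 x * pullback_prod \<psi> k s W g2 x" for x
  have ZZ: "finite (Z \<times> Z)" using Z by simp
  have P: "P p \<in> sets M" "P p \<subseteq> W" if "p \<in> Z \<times> Z" for p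
    using S1(1)[of "fst p"] S1(2)[of "fst p"] S2(1)[of "snd p"] that by (auto simp: P_def)
  have V: "V \<in> sets M" unfolding V_def using P ZZ by (intro sets.finite_UN) auto
  have disj: "disjoint_family_on P (Z \<times> Z)"
    unfolding disjoint_family_on_def
  proof (intro ballI impI)
    fix p q assume pq: "p \<in> Z \<times> Z" "q \<in> Z \<times> Z" "p \<noteq> q"
    then have mem: "fst p \<in> Z" "fst q \<in> Z" "snd p \<in> Z" "snd q \<in> Z" by auto
    have "fst p \<noteq> fst q \<or> snd p \<noteq> snd q" using pq(3) by (simp add: prod_eq_iff)
    then have "S1 (fst p) \<inter> S1 (fst q) = {} \<or> S2 (snd p) \<inter> S2 (snd q) = {}"
      using disjoint_family_onD[OF S1(3) mem(1,2)] disjoint_family_onD[OF S2(3) mem(3,4)] by blast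
    then show "P p \<inter> P q = {}" by (auto simp: P_def)
  qed
  have U: "(\<Union>z\<in>Z. S1 z) \<in> sets M" "(\<Union>z\<in>Z. S2 z) \<in> sets M"
    using S1 S2 Z by (auto intro!: sets.finite_UN)
  have "W - V \<subseteq> (W - (\<Union>z\<in>Z. S1 z)) \<union> (W - (\<Union>z\<in>Z. S2 z))"
    by (auto simp: V_def P_def)
  then have "measure M (W - V) \<le> measure M ((W - (\<Union>z\<in>Z. S1 z)) \<union> (W - (\<Union>z\<in>Z. S2 z)))"
    using W U by (intro finite_measure_mono) auto
  also have "\<dots> \<le> measure M (W - (\<Union>z\<in>Z. S1 z)) + measure M (W - (\<Union>z\<in>Z. S2 z))"
    using W U by (intro measure_Un_le) auto
  finally have WV: "measure M (W - V) \<le> 2 * a" using S1(4) S2(4) by simp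
  have pb: "\<bar>\<Prod>i<k. \<psi> i (h i)\<bar> \<le> 1" for h
  proof -
    have "\<bar>\<Prod>i<k. \<psi> i (h i)\<bar> = (\<Prod>i<k. \<bar>\<psi> i (h i)\<bar>)" by (rule abs_prod)
    also have "\<dots> \<le> (\<Prod>i<k. 1)" using \<psi>(2) by (intro prod_mono) auto
    finally show ?thesis by simp
  qed
  have Yb: "\<bar>pullback_prod \<psi> k s W g x\<bar> \<le> 1" for g x
    using pb[of "\<lambda>i. f (s i) (g x)"] by (simp add: pullback_prod_def indicator_def)
  have Hm: "H \<in> borel_measurable M" unfolding H_def using Ym by simp
  have Hb: "\<bar>H x\<bar> \<le> 1" for x
    unfolding H_def abs_mult using Yb by (intro mult_le_one) auto
  have Gm: "G p \<in> borel_measurable M" for p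
    unfolding G_def[abs_def] using \<psi> by (intro borel_measurable_prod borel_measurable_times measurable_flow_comp) auto
  have Gb: "\<bar>G p x\<bar> \<le> 1" for p x
    unfolding G_def prod.distrib abs_mult using pb by (intro mult_le_one) auto
  have ind: "integrable M (\<lambda>x. indicator A x * F x)" if "A \<in> sets M" "F \<in> borel_measurable M" "\<And>x. \<bar>F x\<bar> \<le> 1"
    for A and F :: "'a \<Rightarrow> real"
    using that integrable_indicator_flow[of A 0] by (intro integrable_mult_bounded[where C = 1]) auto
  have split: "H x = indicator (W - V) x * H x + (\<Sum>p\<in>Z \<times> Z. indicator (P p) x * H x)" for x
  proof -
    have "(\<Sum>p\<in>Z \<times> Z. indicator (P p) x :: real) = indicator V x"
      unfolding V_def by (rule indicator_UN_disjoint[OF ZZ disj, symmetric])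
    moreover have "V \<subseteq> W" using P(2) by (auto simp: V_def)
    moreover have "x \<notin> W \<Longrightarrow> H x = 0" by (simp add: H_def pullback_prod_def)
    ultimately show ?thesis by (auto simp: indicator_def simp flip: sum_distrib_right)
  qed
  have "(\<integral>x. H x \<partial>M) = (\<integral>x. indicator (W - V) x * H x + (\<Sum>p\<in>Z \<times> Z. indicator (P p) x * H x) \<partial>M)"
    by (subst split) (rule refl)
  also have "\<dots> = (\<integral>x. indicator (W - V) x * H x \<partial>M) + (\<Sum>p\<in>Z \<times> Z. \<integral>x. indicator (P p) x * H x \<partial>M)"
    using ind[OF _ Hm Hb] W V P
    by (subst Bochner_Integration.integral_add) (auto intro!: Bochner_Integration.integrable_sum Bochner_Integration.integral_sum)
  finally have eq: "(\<integral>x. H x \<partial>M) = (\<integral>x. indicator (W - V) x * H x \<partial>M) + (\<Sum>p\<in>Z \<times> Z. \<integral>x. indicator (P p) x * H x \<partial>M)" .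
  have first: "\<bar>\<integral>x. indicator (W - V) x * H x \<partial>M\<bar> \<le> 2 * a"
  proof -
    have "\<bar>\<integral>x. indicator (W - V) x * H x \<partial>M\<bar> \<le> (\<integral>x. \<bar>indicator (W - V) x * H x\<bar> \<partial>M)" by simp
    also have "\<dots> \<le> (\<integral>x. indicator (W - V) x \<partial>M)"
      using integrable_abs[OF ind[OF _ Hm Hb, of "W - V"]] integrable_indicator_flow[of "W - V" 0] W V Hb
      by (intro integral_mono) (auto simp: indicator_def)
    also have "\<dots> = measure M (W - V)" using W V by simp
    finally show ?thesis using WV by simp
  qed
  have piece: "\<bar>\<integral>x. indicator (P p) x * H x \<partial>M\<bar> \<le> (2 * real k * e + e1) * measure M (P p) + e2" if p: "p \<in> Z \<times> Z" for p
  proof -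
    \<comment> \<open>There are \<open>2 * k\<close> factors bounded by 1, and each changes by at
      most \<open>e\<close>.\<close>
    have diff: "\<bar>H x - G p x\<bar> \<le> 2 * real k * e" if x: "x \<in> P p" for x
    proof -
      let ?a = "\<lambda>i. \<psi> i (f (s i) (g1 x))" and ?b = "\<lambda>i. \<psi> i (f (s i) (g2 x))"
      let ?a' = "\<lambda>i. \<psi> i (f (s i + u1 (fst p) i) x)" and ?b' = "\<lambda>i. \<psi> i (f (s i + u2 (snd p) i) x)"
      have "x \<in> W" using x P(2)[OF p] by auto
      then have "H x - G p x = (\<Prod>i<k. ?a i * ?b i) - (\<Prod>i<k. ?a' i * ?b' i)"
        by (simp add: H_def pullback_prod_def G_def prod.distrib)
      also have "norm \<dots> \<le> (\<Sum>i<k. norm (?a i * ?b i - ?a' i * ?b' i))"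
        using \<psi>(2) by (intro norm_prod_diff) (auto simp: abs_mult intro!: mult_le_one)
      also have "\<dots> \<le> (\<Sum>i<k. 2 * e)"
      proof (intro sum_mono)
        fix i assume "i \<in> {..<k}"
        then have i: "i < k" by simp
        have "?a i * ?b i - ?a' i * ?b' i = (?a i - ?a' i) * ?b i + ?a' i * (?b i - ?b' i)"
          by (simp add: algebra_simps)
        then have "\<bar>?a i * ?b i - ?a' i * ?b' i\<bar> \<le> \<bar>?a i - ?a' i\<bar> * \<bar>?b i\<bar> + \<bar>?a' i\<bar> * \<bar>?b i - ?b' i\<bar>"
          by (metis abs_mult abs_triangle_ineq)
        also have "\<dots> \<le> e * 1 + 1 * e"
          using p x i close1[of "fst p" i x] close2[of "snd p" i x] \<psi>(2)[OF i] \<open>e \<ge> 0\<close>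
          by (intro add_mono mult_mono) (auto simp: P_def)
        finally show "norm (?a i * ?b i - ?a' i * ?b' i) \<le> 2 * e" by simp
      qed
      finally show ?thesis by (simp add: mult.commute mult.left_commute)
    qed
    have "\<bar>(\<integral>x. indicator (P p) x * H x \<partial>M) - (\<integral>x. indicator (P p) x * G p x \<partial>M)\<bar>
      = \<bar>\<integral>x. indicator (P p) x * H x - indicator (P p) x * G p x \<partial>M\<bar>"
      using ind[OF P(1)[OF p] Hm Hb] ind[OF P(1)[OF p] Gm Gb] by simp
    also have "\<dots> \<le> (\<integral>x. \<bar>indicator (P p) x * H x - indicator (P p) x * G p x\<bar> \<partial>M)" by simp
    also have "\<dots> \<le> (\<integral>x. (2 * real k * e) * indicator (P p) x \<partial>M)"
    proof (rule integral_mono)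
      show "integrable M (\<lambda>x. \<bar>indicator (P p) x * H x - indicator (P p) x * G p x\<bar>)"
        using ind[OF P(1)[OF p] Hm Hb] ind[OF P(1)[OF p] Gm Gb] by simp
      show "integrable M (\<lambda>x. 2 * real k * e * indicator (P p) x)"
        using integrable_indicator_flow[OF P(1)[OF p], of 0] by simp
      show "\<bar>indicator (P p) x * H x - indicator (P p) x * G p x\<bar> \<le> 2 * real k * e * indicator (P p) x" for x
        using diff[of x] by (simp add: indicator_def)
    qed
    also have "\<dots> = 2 * real k * e * measure M (P p)" using P(1)[OF p] by simp
    finally have "\<bar>(\<integral>x. indicator (P p) x * H x \<partial>M) - (\<integral>x. indicator (P p) x * G p x \<partial>M)\<bar> \<le> 2 * real k * e * measure M (P p)" .
    moreover have "\<bar>\<integral>x. indicator (P p) x * G p x \<partial>M\<bar> \<le> e1 * measure M (P p) + e2"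
      using decor[of "fst p" "snd p"] p unfolding P_def G_def by auto
    ultimately show ?thesis by (simp add: ring_distribs)
  qed
  have "\<bar>\<Sum>p\<in>Z \<times> Z. \<integral>x. indicator (P p) x * H x \<partial>M\<bar> \<le> (\<Sum>p\<in>Z \<times> Z. \<bar>\<integral>x. indicator (P p) x * H x \<partial>M\<bar>)"
    by (rule sum_abs)
  also have "\<dots> \<le> (\<Sum>p\<in>Z \<times> Z. (2 * real k * e + e1) * measure M (P p) + e2)"
    by (intro sum_mono piece)
  also have "\<dots> = (2 * real k * e + e1) * (\<Sum>p\<in>Z \<times> Z. measure M (P p)) + (real (card Z))\<^sup>2 * e2"
    by (simp add: sum.distrib sum_distrib_left card_cartesian_product power2_eq_square)
  also have "(\<Sum>p\<in>Z \<times> Z. measure M (P p)) = measure M V"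
    unfolding V_def using P disj ZZ by (intro finite_measure_finite_Union[symmetric]) auto
  also have "(2 * real k * e + e1) * measure M V \<le> 2 * real k * e + e1"
    using \<open>e \<ge> 0\<close> \<open>e1 \<ge> 0\<close> by (intro mult_left_le) auto
  finally show ?thesis
    using first unfolding eq[unfolded H_def] H_def by linarith
qed

text \<open>Replacing \<open>x\<close> by \<open>g m x\<close> hardly changes the integral; averaging over \<open>m\<close> and applying
  Cauchy-Schwarz leaves the correlations of \<open>m \<noteq> m'\<close>.\<close>

lemma average_over_maps_bound:
  fixes \<psi> :: "nat \<Rightarrow> 'a \<Rightarrow> real" and n :: nat
  assumes W: "W \<in> sets M" "measure M (UNIV - W) \<le> \<delta>" and \<delta>: "\<delta> \<ge> 0" and n: "n > 0"
    and \<psi>: "\<And>i. i < k \<Longrightarrow> \<psi> i \<in> borel_measurable M" "\<And>i x. i < k \<Longrightarrow> \<bar>\<psi> i x\<bar> \<le> 1"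
    and \<phi>: "\<phi> \<in> borel_measurable M" "\<And>x. \<bar>\<phi> x\<bar> \<le> 1"
      "\<And>x y. dist x y \<le> \<delta> \<Longrightarrow> \<bar>\<phi> x - \<phi> y\<bar> \<le> e"
    and amp: "\<And>m. m < n \<Longrightarrow>
      almost_measure_preserving \<delta> (restrict_space M W) (restrict_space M W) (g m) (X0 m) (Y0 m)"
    and near: "\<And>m x. m < n \<Longrightarrow> x \<in> X0 m \<Longrightarrow> dist (g m x) x \<le> \<delta>"
    and off: "\<And>m m'. m < n \<Longrightarrow> m' < n \<Longrightarrow> m \<noteq> m' \<Longrightarrow>
      (pullback_prod \<psi> k s W (g m)) \<in> borel_measurable M \<Longrightarrow> (pullback_prod \<psi> k s W (g m')) \<in> borel_measurable M \<Longrightarrow>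
      \<bar>\<integral>x. pullback_prod \<psi> k s W (g m) x * pullback_prod \<psi> k s W (g m') x \<partial>M\<bar> \<le> e'"
    and "e' \<ge> 0" "e \<ge> 0"
  shows "\<bar>\<integral>x. \<phi> x * (\<Prod>i<k. \<psi> i (f (s i) x)) \<partial>M\<bar> \<le> 7 * \<delta> + e + sqrt (1 / real n + e')"
proof -
  have spW: "space (restrict_space M W) = W" by (auto simp: space_restrict_space)
  have msW: "measure (restrict_space M W) A = prob A" if "A \<subseteq> W" for A
    using that W by (simp add: measure_restrict_space)
  define F where "F x = (\<Prod>i<k. \<psi> i (f (s i) x))" for x
  have Fm: "F \<in> borel_measurable M"
    unfolding F_def using \<psi> by (intro measurable_prod_flow) auto
  have F1: "\<bar>F x\<bar> \<le> 1" for x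
    unfolding F_def using prod_flow_bound[of "{..<k}" \<psi> 1 s x] \<psi>(2) by auto
  have idW: "(\<lambda>x. x) \<in> measurable (restrict_space M W) M"
    by (rule measurable_restrict_space1) simp
  have Wg: "(\<lambda>x. indicator W x * H (g m x)) \<in> borel_measurable M"
    if "m < n" "H \<in> borel_measurable M" for m and H :: "'a \<Rightarrow> real"
  proof -
    have "g m \<in> measurable (restrict_space M W) (restrict_space M W)"
      using amp[OF that(1)] by (simp add: almost_measure_preserving_def)
    then have "(\<lambda>x. H (g m x)) \<in> borel_measurable (restrict_space M W)"
      using measurable_compose[OF measurable_compose[OF _ idW] that(2)] by blast
    then show ?thesis
      using borel_measurable_restrict_space_iff[of W M "\<lambda>x. H (g m x)"] W by simp
  qed
  have YF: "pullback_prod \<psi> k s W (g m) = (\<lambda>x. indicator W x * F (g m x))" for m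
    by (simp add: pullback_prod_def[abs_def] F_def)
  have Ym: "pullback_prod \<psi> k s W (g m) \<in> borel_measurable M" if "m < n" for m
    unfolding YF by (rule Wg[OF that Fm])
  have Yb: "\<bar>pullback_prod \<psi> k s W (g m) x\<bar> \<le> 1" for m x
    unfolding YF using F1 by (auto simp: indicator_def)
  \<comment> \<open>The full product of \<open>k + 1\<close> factors. Cutting it to \<open>W\<close>
    costs \<open>\<delta>\<close>, inserting \<open>g m\<close> costs \<open>4 * \<delta>\<close>,
    and taking \<open>g m\<close> out of \<open>\<phi>\<close> again costs
    \<open>e + 2 * \<delta>\<close>.\<close>
  define E where "E x = \<phi> x * F x" for x
  have Em: "E \<in> borel_measurable M" unfolding E_def using \<phi> Fm by simp
  have E1: "\<bar>E x\<bar> \<le> 1" for x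
    unfolding E_def abs_mult using \<phi>(2) F1 by (intro mult_le_one) auto
  have ind: "integrable M (\<lambda>x. indicator A x * H x)" if "A \<in> sets M" "H \<in> borel_measurable M" "\<And>x. \<bar>H x\<bar> \<le> 1"
    for A and H :: "'a \<Rightarrow> real"
    using that integrable_indicator_flow[of A 0] by (intro integrable_mult_bounded[where C = 1]) auto
  have one: "\<bar>(\<integral>x. E x \<partial>M) - (\<integral>x. indicator W x * E x \<partial>M)\<bar> \<le> \<delta>"
  proof -
    have i: "integrable M E" using Em E1 by (intro integrable_bounded[of _ 1]) auto
    have C: "UNIV - W \<in> sets M" using W sets.compl_sets[OF W(1)] by simp
    have "\<bar>(\<integral>x. E x \<partial>M) - (\<integral>x. indicator W x * E x \<partial>M)\<bar> = \<bar>\<integral>x. E x - indicator W x * E x \<partial>M\<bar>"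
      using i ind[OF W(1) Em E1] by simp
    also have "\<dots> \<le> (\<integral>x. \<bar>E x - indicator W x * E x\<bar> \<partial>M)" by simp
    also have "\<dots> \<le> (\<integral>x. indicator (UNIV - W) x \<partial>M)"
      using integrable_indicator_flow[OF C, of 0] i ind[OF W(1) Em E1] E1
      by (intro integral_mono) (auto simp: indicator_def)
    also have "\<dots> = measure M (UNIV - W)" using C by simp
    finally show ?thesis using W(2) by simp
  qed
  have two: "\<bar>(\<integral>x. indicator W x * E (g m x) \<partial>M) - (\<integral>x. indicator W x * E x \<partial>M)\<bar> \<le> 4 * \<delta>" if "m < n" for m
    by (rule almost_measure_preserving_integral[OF amp[OF that] W(1) \<delta> Em E1])
  have three: "\<bar>(\<integral>x. indicator W x * E (g m x) \<partial>M) - (\<integral>x. \<phi> x * pullback_prod \<psi> k s W (g m) x \<partial>M)\<bar> \<le> e + 2 * \<delta>" if m: "m < n" for m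
  proof -
    have X0: "X0 m \<in> sets M" "X0 m \<subseteq> W" "prob (W - X0 m) \<le> \<delta>"
    proof -
      have X: "X0 m \<in> sets (restrict_space M W)"
        and l: "measure (restrict_space M W) (W - X0 m) < \<delta> * measure (restrict_space M W) W"
        using amp[OF m] unfolding almost_measure_preserving_def spW by auto
      from X show "X0 m \<in> sets M" "X0 m \<subseteq> W"
        using W by (auto simp: sets_restrict_space_iff)
      have "prob (W - X0 m) < \<delta> * prob W" using l by (simp add: msW)
      also have "\<dots> \<le> \<delta>" using \<delta> by (simp add: mult_left_le)
      finally show "prob (W - X0 m) \<le> \<delta>" by simp
    qed
    have D: "W - X0 m \<in> sets M" using X0 W by auto
    have i1: "integrable M (\<lambda>x. indicator W x * E (g m x))"
      using Wg[OF m Em] E1 by (intro integrable_bounded[of _ 1]) (auto simp: indicator_def)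
    have i2: "integrable M (\<lambda>x. \<phi> x * pullback_prod \<psi> k s W (g m) x)"
      using Ym[OF m] Yb \<phi> by (intro integrable_bounded[of _ 1]) (auto simp: abs_mult intro!: mult_le_one)
    have "\<bar>(\<integral>x. indicator W x * E (g m x) \<partial>M) - (\<integral>x. \<phi> x * pullback_prod \<psi> k s W (g m) x \<partial>M)\<bar>
      = \<bar>\<integral>x. indicator W x * E (g m x) - \<phi> x * pullback_prod \<psi> k s W (g m) x \<partial>M\<bar>"
      using i1 i2 by simp
    also have "\<dots> \<le> (\<integral>x. \<bar>indicator W x * E (g m x) - \<phi> x * pullback_prod \<psi> k s W (g m) x\<bar> \<partial>M)" by simp
    \<comment> \<open>On the proper domain \<open>g m\<close> is close to the identity; on the rest
      of \<open>W\<close> only the bound 1 for \<open>\<phi>\<close> is available.\<close>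
    also have "\<dots> \<le> (\<integral>x. e + 2 * indicator (W - X0 m) x \<partial>M)"
    proof (rule integral_mono)
      show "integrable M (\<lambda>x. \<bar>indicator W x * E (g m x) - \<phi> x * pullback_prod \<psi> k s W (g m) x\<bar>)"
        using i1 i2 by simp
      show "integrable M (\<lambda>x. e + 2 * indicator (W - X0 m) x)"
        using integrable_indicator_flow[OF D, of 0] by simp
      fix x
      have eq: "indicator W x * E (g m x) - \<phi> x * pullback_prod \<psi> k s W (g m) x
        = indicator W x * F (g m x) * (\<phi> (g m x) - \<phi> x)"
        by (simp add: E_def YF algebra_simps)
      have "\<bar>indicator W x * F (g m x)\<bar> \<le> 1" using Yb[of m x] by (simp add: YF)
      then have le: "\<bar>indicator W x * E (g m x) - \<phi> x * pullback_prod \<psi> k s W (g m) x\<bar> \<le> \<bar>\<phi> (g m x) - \<phi> x\<bar>"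
        unfolding eq abs_mult[of "indicator W x * F (g m x)"] by (intro mult_left_le_one_le) auto
      show "\<bar>indicator W x * E (g m x) - \<phi> x * pullback_prod \<psi> k s W (g m) x\<bar> \<le> e + 2 * indicator (W - X0 m) x"
      proof (cases "x \<in> X0 m")
        case True
        then show ?thesis using le \<phi>(3)[OF near[OF m True]] by simp
      next
        case False
        show ?thesis
        proof (cases "x \<in> W")
          case True
          moreover have "\<bar>\<phi> (g m x) - \<phi> x\<bar> \<le> 2" using \<phi>(2)[of x] \<phi>(2)[of "g m x"] by linarith
          ultimately show ?thesis using le False \<open>e \<ge> 0\<close> by simp
        next
          case False
          then show ?thesis using \<open>e \<ge> 0\<close> by (simp add: YF)
        qed
      qed
    qed
    also have "\<dots> = e + 2 * prob (W - X0 m)"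
      using integrable_indicator_flow[OF D, of 0] D by (simp add: prob_space[simplified])
    finally show ?thesis using X0(3) by simp
  qed
  have i2: "integrable M (\<lambda>x. \<phi> x * pullback_prod \<psi> k s W (g m) x)" if "m < n" for m
    using Ym[OF that] Yb \<phi> by (intro integrable_bounded[of _ 1]) (auto simp: abs_mult intro!: mult_le_one)
  have each: "\<bar>(\<integral>x. E x \<partial>M) - (\<integral>x. \<phi> x * pullback_prod \<psi> k s W (g m) x \<partial>M)\<bar> \<le> 7 * \<delta> + e" if "m < n" for m
    using one two[OF that] three[OF that] by linarith
  have "real n * (\<integral>x. E x \<partial>M) - (\<Sum>m<n. \<integral>x. \<phi> x * pullback_prod \<psi> k s W (g m) x \<partial>M)
    = (\<Sum>m<n. (\<integral>x. E x \<partial>M) - (\<integral>x. \<phi> x * pullback_prod \<psi> k s W (g m) x \<partial>M))"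
    by (simp add: sum_subtractf)
  also have "\<bar>\<dots>\<bar> \<le> (\<Sum>m<n. \<bar>(\<integral>x. E x \<partial>M) - (\<integral>x. \<phi> x * pullback_prod \<psi> k s W (g m) x \<partial>M)\<bar>)"
    by (rule sum_abs)
  also have "\<dots> \<le> (\<Sum>m<n. 7 * \<delta> + e)" using each by (intro sum_mono) auto
  finally have A: "\<bar>real n * (\<integral>x. E x \<partial>M) - (\<Sum>m<n. \<integral>x. \<phi> x * pullback_prod \<psi> k s W (g m) x \<partial>M)\<bar> \<le> real n * (7 * \<delta> + e)"
    by simp
  have "(\<Sum>m<n. \<integral>x. \<phi> x * pullback_prod \<psi> k s W (g m) x \<partial>M) = (\<integral>x. (\<Sum>m<n. \<phi> x * pullback_prod \<psi> k s W (g m) x) \<partial>M)"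
    using i2 by (intro Bochner_Integration.integral_sum[symmetric]) auto
  also have "\<bar>\<dots>\<bar> \<le> (\<integral>x. \<bar>\<Sum>m<n. \<phi> x * pullback_prod \<psi> k s W (g m) x\<bar> \<partial>M)" by simp
  \<comment> \<open>This removes the factor at time 0; only the other \<open>k\<close> factors
    remain.\<close>
  also have "\<dots> \<le> (\<integral>x. \<bar>\<Sum>m<n. pullback_prod \<psi> k s W (g m) x\<bar> \<partial>M)"
  proof (rule integral_mono)
    show "integrable M (\<lambda>x. \<bar>\<Sum>m<n. \<phi> x * pullback_prod \<psi> k s W (g m) x\<bar>)"
      using i2 by (intro integrable_abs Bochner_Integration.integrable_sum) auto
    show "integrable M (\<lambda>x. \<bar>\<Sum>m<n. pullback_prod \<psi> k s W (g m) x\<bar>)"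
      using Ym Yb by (intro integrable_abs Bochner_Integration.integrable_sum integrable_bounded[of _ 1]) auto
    show "\<bar>\<Sum>m<n. \<phi> x * pullback_prod \<psi> k s W (g m) x\<bar> \<le> \<bar>\<Sum>m<n. pullback_prod \<psi> k s W (g m) x\<bar>" for x
      using \<phi>(2)[of x] by (auto simp: abs_mult mult_left_le_one_le simp flip: sum_distrib_left)
  qed
  also have "\<dots> \<le> real n * sqrt (1 / real n + e')"
  proof -
    have "(\<integral>x. \<bar>(\<Sum>m<n. pullback_prod \<psi> k s W (g m) x) / real n\<bar> \<partial>M) \<le> sqrt (1\<^sup>2 / real n + e')"
      using n Ym Yb off \<open>e' \<ge> 0\<close> by (intro L1_average_bound) auto
    then show ?thesis using n by (simp add: field_simps)
  qed
  finally have "\<bar>real n * (\<integral>x. E x \<partial>M)\<bar> \<le> real n * (7 * \<delta> + e) + real n * sqrt (1 / real n + e')"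
    using A by linarith
  then have "real n * \<bar>\<integral>x. E x \<partial>M\<bar> \<le> real n * (7 * \<delta> + e + sqrt (1 / real n + e'))"
    by (simp add: abs_mult ring_distribs)
  then show ?thesis using n by (simp add: E_def[abs_def] F_def)
qed

end

text \<open>An index \<open>z = (\<rho>, w)\<close> of the common refinement selects the tower \<open>\<rho>\<close>, the piece
  \<open>w 0\<close> of (LUS2) and, for every \<open>j \<ge> 1\<close>, the piece \<open>w j\<close> of (LUS3); on it \<open>f (t j) \<circ> g m\<close>
  is close to \<open>f (t j + \<tau>)\<close> for the shift \<open>\<tau>\<close> defined here.\<close>

definition refinement_index :: "nat \<Rightarrow> nat \<Rightarrow> nat set \<Rightarrow> (nat \<times> (nat \<Rightarrow> nat)) set" where
  "refinement_index d k L = {1..d} \<times> PiE {0..k} (\<lambda>i. if i = 0 then {1..k} else L)"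

definition time_shift :: "real \<Rightarrow> real \<Rightarrow> nat \<Rightarrow> nat \<times> (nat \<Rightarrow> nat) \<Rightarrow> nat \<Rightarrow> real" where
  "time_shift b \<delta> m z j = (if j = snd z 0 then real m * b else real (snd z j) * \<delta>)"

lemma refinement_indexD:
  assumes "z \<in> refinement_index d k L"
  shows "fst z \<in> {1..d}" "snd z 0 \<in> {1..k}"
  using assms PiE_mem[of "snd z" "{0..k}" "\<lambda>i. if i = 0 then {1..k} else L" 0]
  by (auto simp: refinement_index_def)

lemma finite_refinement_index: "finite L \<Longrightarrow> finite (refinement_index d k L)"
  unfolding refinement_index_def by (intro finite_cartesian_product finite_PiE) auto

context mp_flow
begin

text \<open>The pieces of (LUS2) are common to all \<open>m\<close>, those of (LUS3) depend on
  \<open>m\<close>. Hence pieces for \<open>m\<close> and \<open>m'\<close> can meet only if both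
  select the same index from (LUS2), and the factor with that index then has the shifts
  \<open>m * Ms powr a\<close> and \<open>m' * Ms powr a\<close>. Each piece is an intersection of
  \<open>k + 1\<close> towers of height at least \<open>n * T\<close>, whence its almost
  invariance.\<close>

lemma LUS_refinement:
  fixes R :: "nat \<Rightarrow> 'a set" and d k K n :: nat and Ms \<delta> :: real
  defines "W \<equiv> (\<Union>\<rho>\<in>{1..d}. R \<rho>)" and "L \<equiv> {l :: nat. real l \<le> Ms / \<delta> - 1}"
  defines "Z \<equiv> refinement_index d k L"
  assumes R: "almost_partition M \<delta> (space M) {1..d} R" and "\<delta> \<ge> 0"
    and n: "n > 0" "\<And>\<rho>. \<rho> \<in> {1..d} \<Longrightarrow> real n * T \<le> H \<rho>"
    and lus2: "LUS2 M f a \<delta> k d Ms R H K g t"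
    and lus3: "LUS3 M f \<delta> k d Ms R H K g t"
    and L: "finite L"
  obtains S :: "nat \<Rightarrow> nat \<times> (nat \<Rightarrow> nat) \<Rightarrow> 'a set" where
    "\<And>m z. m \<le> K \<Longrightarrow> z \<in> Z \<Longrightarrow> S m z \<in> sets M"
    "\<And>m z. m \<le> K \<Longrightarrow> z \<in> Z \<Longrightarrow> S m z \<subseteq> W"
    "\<And>m z. m \<le> K \<Longrightarrow> z \<in> Z \<Longrightarrow> almost_inv T (real (Suc k) * (2 / real n)) (indicator (S m z))"
    "\<And>m. m \<le> K \<Longrightarrow> disjoint_family_on (S m) Z"
    "\<And>m. m \<le> K \<Longrightarrow> measure M (W - (\<Union>z\<in>Z. S m z)) \<le> real (Suc k) * \<delta>"
    "\<And>m z j x. m \<le> K \<Longrightarrow> z \<in> Z \<Longrightarrow> j \<in> {1..k} \<Longrightarrow> x \<in> S m z \<Longrightarrow>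
      dist (f (t j) (g m x)) (f (t j + time_shift (Ms powr a) \<delta> m z j) x) \<le> \<delta>"
    "\<And>m m' z z'. m \<le> K \<Longrightarrow> m' \<le> K \<Longrightarrow> z \<in> Z \<Longrightarrow> z' \<in> Z \<Longrightarrow> snd z 0 \<noteq> snd z' 0 \<Longrightarrow> S m z \<inter> S m' z' = {}"
proof -
  from R have Rm: "\<And>\<rho>. \<rho> \<in> {1..d} \<Longrightarrow> R \<rho> \<in> sets M" and Rd: "disjoint_family_on R {1..d}"
    unfolding almost_partition_def by auto
  have "\<forall>\<rho>\<in>{1..d}. \<exists>Tow :: nat \<Rightarrow> 'a set.
        almost_partition M \<delta> (R \<rho>) {1..k} Tow \<and>
        (\<forall>j\<in>{1..k}. tower M f (H \<rho>) (Tow j) \<and> Tow j \<subseteq> R \<rho>) \<and>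
        (\<forall>m\<le>K. \<forall>j\<in>{1..k}. \<forall>x\<in>Tow j.
           dist (f (t j) (g m x)) (f (t j + real m * Ms powr a) x) \<le> \<delta>)"
    using lus2 unfolding LUS2_def .
  from bchoice[OF this] obtain Tow :: "nat \<Rightarrow> nat \<Rightarrow> 'a set" where Tow: "\<forall>\<rho>\<in>{1..d}.
        almost_partition M \<delta> (R \<rho>) {1..k} (Tow \<rho>) \<and>
        (\<forall>j\<in>{1..k}. tower M f (H \<rho>) (Tow \<rho> j) \<and> Tow \<rho> j \<subseteq> R \<rho>) \<and>
        (\<forall>m\<le>K. \<forall>j\<in>{1..k}. \<forall>x\<in>Tow \<rho> j.
           dist (f (t j) (g m x)) (f (t j + real m * Ms powr a) x) \<le> \<delta>)" ..
  have "\<forall>p\<in>{1..d} \<times> {1..k} \<times> {..K}. \<exists>Q :: nat \<Rightarrow> 'a set.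
        almost_partition M \<delta> (R (fst p)) L Q \<and>
        (\<forall>l\<in>L. tower M f (H (fst p)) (Q l) \<and> Q l \<subseteq> R (fst p)) \<and>
        (\<forall>l\<in>L. \<forall>x\<in>Q l. dist (f (t (fst (snd p))) (g (snd (snd p)) x)) (f (t (fst (snd p)) + real l * \<delta>) x) \<le> \<delta>)"
    using lus3 unfolding LUS3_def Let_def L_def by auto
  from bchoice[OF this] obtain Q where Q: "\<forall>p\<in>{1..d} \<times> {1..k} \<times> {..K}.
        almost_partition M \<delta> (R (fst p)) L (Q p) \<and>
        (\<forall>l\<in>L. tower M f (H (fst p)) (Q p l) \<and> Q p l \<subseteq> R (fst p)) \<and>
        (\<forall>l\<in>L. \<forall>x\<in>Q p l. dist (f (t (fst (snd p))) (g (snd (snd p)) x)) (f (t (fst (snd p)) + real l * \<delta>) x) \<le> \<delta>)" ..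
  define Lb where "Lb i = (if i = 0 then {1..k} else L)" for i :: nat
  define P where "P \<rho> m i = (if i = 0 then Tow \<rho> else Q (\<rho>, i, m))" for \<rho> m i
  define S where "S m z = (\<Inter>i\<in>{0..k}. P (fst z) m i (snd z i))" for m z
  have Lb: "finite (Lb i)" for i using L by (simp add: Lb_def)
  have P: "almost_partition M \<delta> (R \<rho>) (Lb i) (P \<rho> m i)"
    "\<And>l. l \<in> Lb i \<Longrightarrow> tower M f (H \<rho>) (P \<rho> m i l)" "\<And>l. l \<in> Lb i \<Longrightarrow> P \<rho> m i l \<subseteq> R \<rho>"
    if "\<rho> \<in> {1..d}" "m \<le> K" "i \<in> {0..k}" for \<rho> m i
    using Tow[rule_format, of \<rho>] Q[rule_format, of "(\<rho>, i, m)"] that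
    by (cases "i = 0"; simp add: P_def Lb_def)+
  have Pm: "P \<rho> m i l \<in> sets M" if "\<rho> \<in> {1..d}" "m \<le> K" "i \<in> {0..k}" "l \<in> Lb i" for \<rho> m i l
    using P(2)[OF that] by (simp add: tower_def)
  have Zeq: "Z = {1..d} \<times> PiE {0..k} Lb"
    unfolding Z_def refinement_index_def Lb_def ..
  have Zw: "snd z i \<in> Lb i" if "z \<in> Z" "i \<in> {0..k}" for z i
    using that PiE_mem[of "snd z" "{0..k}" Lb i] by (auto simp: Zeq)
  have Z1: "fst z \<in> {1..d}" if "z \<in> Z" for z using that by (auto simp: Zeq)
  have SP: "S m z \<subseteq> P (fst z) m i (snd z i)" if "i \<in> {0..k}" for m z i
    using that by (auto simp: S_def)
  have STow: "S m z \<subseteq> Tow (fst z) (snd z 0)" for m z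
    using SP[of 0 m z] by (simp add: P_def)
  have SR: "S m z \<subseteq> R (fst z)" if "m \<le> K" "z \<in> Z" for m z
    using SP[of 0 m z] P(3)[OF Z1[OF that(2)] that(1) _ Zw[OF that(2)], of 0] by auto
  have RR: "R \<rho> \<inter> R \<rho>' = {}" if "\<rho> \<in> {1..d}" "\<rho>' \<in> {1..d}" "\<rho> \<noteq> \<rho>'" for \<rho> \<rho>'
    using Rd that unfolding disjoint_family_on_def by blast
  show ?thesis
  proof
    fix m z assume m: "m \<le> K" and z: "z \<in> Z"
    show "S m z \<in> sets M"
      unfolding S_def using Pm[OF Z1[OF z] m _ Zw[OF z]] by (intro sets.finite_INT) auto
    show "S m z \<subseteq> W" using SR[OF m z] Z1[OF z] by (auto simp: W_def)
    have "almost_inv T (real (card {0..k}) * (2 / real n)) (indicator (S m z))"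
      unfolding S_def using Pm[OF Z1[OF z] m _ Zw[OF z]] P(2)[OF Z1[OF z] m _ Zw[OF z]] n Z1[OF z]
      by (intro almost_inv_INT almost_inv_tower[of "H (fst z)"]) auto
    then show "almost_inv T (real (Suc k) * (2 / real n)) (indicator (S m z))" by simp
    fix j x assume j: "j \<in> {1..k}" and x: "x \<in> S m z"
    show "dist (f (t j) (g m x)) (f (t j + time_shift (Ms powr a) \<delta> m z j) x) \<le> \<delta>"
    proof (cases "j = snd z 0")
      case True
      have "x \<in> Tow (fst z) j" using x STow[of m z] True by auto
      with Tow Z1[OF z] m j True show ?thesis by (auto simp: time_shift_def)
    next
      case False
      have "x \<in> Q (fst z, j, m) (snd z j)" using x SP[of j m z] j by (auto simp: P_def)
      moreover have "snd z j \<in> L" using Zw[OF z, of j] j by (auto simp: Lb_def)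
      ultimately show ?thesis
        using Q[rule_format, of "(fst z, j, m)"] Z1[OF z] m j False by (auto simp: time_shift_def)
    qed
  next
    fix m assume m: "m \<le> K"
    show "disjoint_family_on (S m) Z"
      unfolding disjoint_family_on_def
    proof (intro ballI impI)
      fix z z' assume z: "z \<in> Z" "z' \<in> Z" "z \<noteq> z'"
      show "S m z \<inter> S m z' = {}"
      proof (cases "fst z = fst z'")
        case False
        then show ?thesis using RR[of "fst z" "fst z'"] Z1 z SR[OF m] by blast
      next
        case True
        with z have "snd z \<noteq> snd z'" by (auto simp: prod_eq_iff)
        moreover have "snd z \<in> PiE {0..k} Lb" "snd z' \<in> PiE {0..k} Lb" using z by (auto simp: Zeq)
        ultimately obtain i where i: "i \<in> {0..k}" "snd z i \<noteq> snd z' i" using PiE_ext by blast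
        have "disjoint_family_on (P (fst z) m i) (Lb i)"
          using P(1)[OF Z1[OF z(1)] m i(1)] by (simp add: almost_partition_def)
        then have "P (fst z) m i (snd z i) \<inter> P (fst z) m i (snd z' i) = {}"
          using i Zw z unfolding disjoint_family_on_def by blast
        then show ?thesis using SP[OF i(1), of m z] SP[OF i(1), of m z'] True by auto
      qed
    qed
    let ?D = "\<lambda>\<rho>. R \<rho> - (\<Union>w\<in>PiE {0..k} Lb. \<Inter>i\<in>{0..k}. P \<rho> m i (w i))"
    have Dm: "?D \<rho> \<in> sets M" if "\<rho> \<in> {1..d}" for \<rho>
      using Rm[OF that] Pm[OF that m] Lb
      by (intro sets.Diff sets.finite_UN sets.finite_INT finite_PiE) (auto simp: PiE_mem)
    have "W - (\<Union>z\<in>Z. S m z) \<subseteq> (\<Union>\<rho>\<in>{1..d}. ?D \<rho>)"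
      unfolding W_def Zeq S_def by fastforce
    then have "measure M (W - (\<Union>z\<in>Z. S m z)) \<le> measure M (\<Union>\<rho>\<in>{1..d}. ?D \<rho>)"
      using Dm by (intro finite_measure_mono sets.finite_UN) auto
    also have "\<dots> \<le> (\<Sum>\<rho>\<in>{1..d}. measure M (?D \<rho>))"
      using Dm by (intro finite_measure_subadditive_finite) auto
    \<comment> \<open>The defect of an almost partition is relative to the measure of
      \<open>R \<rho>\<close>, so summation over the towers brings in no factor
      \<open>d\<close>.\<close>
    also have "\<dots> \<le> (\<Sum>\<rho>\<in>{1..d}. real (card {0..k}) * (\<delta> * measure M (R \<rho>)))"
    proof (rule sum_mono)
      fix \<rho> assume \<rho>: "\<rho> \<in> {1..d}"
      show "measure M (?D \<rho>) \<le> real (card {0..k}) * (\<delta> * measure M (R \<rho>))"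
        using Lb Rm[OF \<rho>] Pm[OF \<rho> m] P(1)[OF \<rho> m] by (intro refinement_measure almost_partition_measure) auto
    qed
    also have "\<dots> = real (Suc k) * \<delta> * (\<Sum>\<rho>\<in>{1..d}. measure M (R \<rho>))"
      by (simp add: sum_distrib_left mult.assoc)
    also have "(\<Sum>\<rho>\<in>{1..d}. measure M (R \<rho>)) = measure M W"
      unfolding W_def using Rm Rd by (intro finite_measure_finite_Union[symmetric]) auto
    also have "real (Suc k) * \<delta> * measure M W \<le> real (Suc k) * \<delta>"
      using \<open>\<delta> \<ge> 0\<close> by (intro mult_left_le) auto
    finally show "measure M (W - (\<Union>z\<in>Z. S m z)) \<le> real (Suc k) * \<delta>" .
  next
    fix m m' z z' assume m: "m \<le> K" "m' \<le> K" and z: "z \<in> Z" "z' \<in> Z" and ne: "snd z 0 \<noteq> snd z' 0"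
    show "S m z \<inter> S m' z' = {}"
    proof (cases "fst z = fst z'")
      case False
      then show ?thesis using RR[of "fst z" "fst z'"] Z1 z SR[OF m(1) z(1)] SR[OF m(2) z(2)] by blast
    next
      case True
      have "disjoint_family_on (Tow (fst z)) {1..k}"
        using Tow Z1[OF z(1)] by (simp add: almost_partition_def)
      moreover have "snd z 0 \<in> {1..k}" "snd z' 0 \<in> {1..k}"
        using Zw[OF z(1), of 0] Zw[OF z(2), of 0] by (auto simp: Lb_def)
      ultimately have "Tow (fst z) (snd z 0) \<inter> Tow (fst z) (snd z' 0) = {}"
        using ne unfolding disjoint_family_on_def by blast
      then show ?thesis using STow[of m z] STow[of m' z'] True by auto
    qed
  qed
qed

end

section \<open>Mixing of order k + 1\<close>

lemma gaps_Suc: "gaps (Suc k) N t \<Longrightarrow> gaps k N (\<lambda>i. t (Suc i))"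
  unfolding gaps_def by simp

lemma uniform_modulus:
  fixes \<phi> :: "nat \<Rightarrow> 'a::metric_space \<Rightarrow> real"
  assumes "\<And>i. i \<le> k \<Longrightarrow> uniformly_continuous_on UNIV (\<phi> i)" "e > 0"
  obtains \<delta> where "\<delta> > 0" "\<delta> \<le> e" "\<And>i (x::'a) y. i \<le> k \<Longrightarrow> dist x y \<le> \<delta> \<Longrightarrow> \<bar>\<phi> i x - \<phi> i y\<bar> \<le> e"
proof -
  have "\<forall>i\<in>{..k}. \<exists>r. r > 0 \<and> (\<forall>x y. dist x y < r \<longrightarrow> \<bar>\<phi> i x - \<phi> i y\<bar> < e)"
  proof
    fix i assume "i \<in> {..k}"
    with assms(1)[of i] have "uniformly_continuous_on UNIV (\<phi> i)" by simp
    then show "\<exists>r. r > 0 \<and> (\<forall>x y. dist x y < r \<longrightarrow> \<bar>\<phi> i x - \<phi> i y\<bar> < e)"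
      using \<open>e > 0\<close> unfolding uniformly_continuous_on_def dist_real_def by (metis UNIV_I)
  qed
  from bchoice[OF this] obtain r where r: "\<And>i. i \<le> k \<Longrightarrow> r i > 0"
    "\<And>i x y. i \<le> k \<Longrightarrow> dist x y < r i \<Longrightarrow> \<bar>\<phi> i x - \<phi> i y\<bar> < e" by auto
  define r' where "r' = Min (r ` {..k})"
  have r': "r' > 0" "\<And>i. i \<le> k \<Longrightarrow> r' \<le> r i"
    using r(1) by (auto simp: r'_def)
  show ?thesis
  \<comment> \<open>Halving turns the weak inequality \<open>dist x y \<le> \<delta>\<close> into
    the strict one of uniform continuity; the minimum lets later errors in \<open>\<delta>\<close>
    be absorbed into \<open>e\<close>.\<close>
  proof (rule that[of "min e (r' / 2)"])
    fix i and x y :: 'a assume i: "i \<le> k" and "dist x y \<le> min e (r' / 2)"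
    then have "dist x y < r i" using r'(1) r'(2)[OF i] by simp
    with r(2)[OF i] show "\<bar>\<phi> i x - \<phi> i y\<bar> \<le> e" by (meson less_imp_le)
  qed (use r' \<open>e > 0\<close> in auto)
qed

lemma eventually_powr_ge:
  fixes Mseq :: "nat \<Rightarrow> real"
  assumes "filterlim Mseq at_top sequentially" "a > 0"
  shows "\<exists>s. Mseq s \<ge> X \<and> Mseq s powr a > Y"
proof -
  \<comment> \<open>The maximum with 1 makes the base positive, so that the powers
    \<open>1 / a\<close> and \<open>a\<close> cancel.\<close>
  define y where "y = max 1 Y"
  have "\<forall>\<^sub>F s in sequentially. Mseq s \<ge> max X (y powr (1 / a) + 1)"
    using assms(1) unfolding filterlim_at_top by blast
  then obtain s where s: "Mseq s \<ge> X" "Mseq s \<ge> y powr (1 / a) + 1"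
    by (auto simp: eventually_sequentially)
  have "Y \<le> (y powr (1 / a)) powr a"
    using assms(2) by (simp add: powr_powr y_def)
  also have "\<dots> < Mseq s powr a"
    using s(2) assms(2) by (intro powr_less_mono2) auto
  finally show ?thesis using s(1) by blast
qed

context mp_flow
begin

text \<open>Between \<open>s\<close> and \<open>h\<close> the proof fixes the finite index set
  \<open>Z\<close>, the tolerance \<open>\<eta>\<close> that pays for its pairs, the time
  \<open>T\<close> of almost invariance and the ratio \<open>n\<close> of height to
  \<open>T\<close>. None of these depends on the tuple of times, whereas the maps and pieces
  do.\<close>

lemma LUS_zero_mean_fmix:
  assumes mixk: "\<And>\<psi>. (\<And>i. i < k \<Longrightarrow> \<psi> i \<in> borel_measurable M) \<Longrightarrow>
      (\<And>i x. i < k \<Longrightarrow> \<bar>\<psi> i x\<bar> \<le> 1) \<Longrightarrow> fmix k \<psi>"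
    and mix2: "\<And>\<psi>. \<psi> \<in> borel_measurable M \<Longrightarrow> (\<And>x. \<bar>\<psi> x\<bar> \<le> 1) \<Longrightarrow> fmix 2 (\<lambda>i. \<psi>)"
    and lus: "locally_uniformly_shearing M f" and "k \<ge> 1"
    and uc: "\<And>i. i \<le> k \<Longrightarrow> uniformly_continuous_on UNIV (\<phi> i)"
    and bound: "\<And>i x. i \<le> k \<Longrightarrow> \<bar>\<phi> i x\<bar> \<le> 1"
    and zero: "\<And>i. i \<le> k \<Longrightarrow> (\<integral>x. \<phi> i x \<partial>M) = 0"
  shows "fmix (Suc k) \<phi>"
  unfolding fmix_iff
proof (intro allI impI)
  fix \<epsilon> :: real assume "\<epsilon> > 0"
  \<comment> \<open>The final estimate is \<open>8 * e + sqrt ((4 * real k + 5) * e)\<close>; the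
    two terms of the minimum bound its summands by \<open>\<epsilon> / 5\<close> and
    \<open>\<epsilon> / 2\<close>.\<close>
  define e where "e = min (\<epsilon> / 40) (\<epsilon>\<^sup>2 / (4 * (4 * real k + 5)))"
  have e: "e > 0" using \<open>\<epsilon> > 0\<close> by (simp add: e_def)
  have e_le: "8 * e + sqrt ((4 * real k + 5) * e) < \<epsilon>"
  proof -
    have "(4 * real k + 5) * e \<le> (4 * real k + 5) * (\<epsilon>\<^sup>2 / (4 * (4 * real k + 5)))"
      unfolding e_def by (intro mult_left_mono) auto
    also have "\<dots> = (\<epsilon> / 2)\<^sup>2" by (simp add: power2_eq_square field_simps)
    finally have "sqrt ((4 * real k + 5) * e) \<le> \<epsilon> / 2"
      using \<open>\<epsilon> > 0\<close> by (intro real_le_lsqrt) auto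
    moreover have "8 * e \<le> \<epsilon> / 5" by (simp add: e_def)
    ultimately show ?thesis using \<open>\<epsilon> > 0\<close> by linarith
  qed
  have meas: "\<phi> i \<in> borel_measurable M" if "i \<le> k" for i
    by (intro continuous_measurable uniformly_continuous_imp_continuous uc that)
  obtain \<delta> where \<delta>: "\<delta> > 0" "\<delta> \<le> e" and modulus: "\<And>i (x::'a) y. i \<le> k \<Longrightarrow> dist x y \<le> \<delta> \<Longrightarrow> \<bar>\<phi> i x - \<phi> i y\<bar> \<le> e"
    using uniform_modulus[of k \<phi> e] uc e by blast
  define K where "K = nat \<lfloor>1 / \<delta>\<rfloor>"
  \<comment> \<open>The maps are numbered from 0 to \<open>K\<close>, so the diagonal terms
    contribute \<open>1 / Suc K\<close> under the square root.\<close>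
  have K: "1 / real (Suc K) \<le> \<delta>"
  proof -
    have "1 / \<delta> \<le> real (Suc K)"
      using \<delta>(1) unfolding K_def by (simp add: of_nat_nat) linarith
    then show ?thesis using \<delta>(1) by (simp add: field_simps)
  qed
  obtain a :: real and d :: nat and Mseq :: "nat \<Rightarrow> real" where a: "0 < a" and Mseq: "filterlim Mseq at_top sequentially"
    and lus': "\<forall>\<delta>>0. \<forall>k\<ge>1. \<exists>M0 :: real. M0 > 1 / \<delta>\<^sup>2 \<and>
          (\<forall>s. \<forall>h :: real. Mseq s \<ge> M0 \<and> h \<ge> M0 \<longrightarrow>
            (\<exists>(t0 :: real) (R :: nat \<Rightarrow> 'a set) (H :: nat \<Rightarrow> real).
               t0 \<ge> max (Mseq s) h \<and>
               almost_partition M \<delta> (space M) {1..d} R \<and>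
               (\<forall>\<rho>\<in>{1..d}. tower M f (H \<rho>) (R \<rho>) \<and>
                  h powr (1/2) \<le> H \<rho> \<and> H \<rho> \<le> h powr (3/2)) \<and>
               (\<forall>t. time_tuple (Suc k) t \<and> time_gap (Suc k) t > ereal t0 \<longrightarrow>
                  (let K = nat \<lfloor>1 / \<delta>\<rfloor> in
                   \<exists>g :: nat \<Rightarrow> 'a \<Rightarrow> 'a.
                     LUS1 M f \<delta> d h R K g \<and>
                     LUS2 M f a \<delta> k d (Mseq s) R H K g t \<and>
                     LUS3 M f \<delta> k d (Mseq s) R H K g t))))"
    using lus unfolding locally_uniformly_shearing_def by blast
  obtain M0 where M0: "M0 > 1 / \<delta>\<^sup>2" and lus0: "\<forall>s. \<forall>h :: real. Mseq s \<ge> M0 \<and> h \<ge> M0 \<longrightarrow>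
            (\<exists>(t0 :: real) (R :: nat \<Rightarrow> 'a set) (H :: nat \<Rightarrow> real).
               t0 \<ge> max (Mseq s) h \<and>
               almost_partition M \<delta> (space M) {1..d} R \<and>
               (\<forall>\<rho>\<in>{1..d}. tower M f (H \<rho>) (R \<rho>) \<and>
                  h powr (1/2) \<le> H \<rho> \<and> H \<rho> \<le> h powr (3/2)) \<and>
               (\<forall>t. time_tuple (Suc k) t \<and> time_gap (Suc k) t > ereal t0 \<longrightarrow>
                  (let K = nat \<lfloor>1 / \<delta>\<rfloor> in
                   \<exists>g :: nat \<Rightarrow> 'a \<Rightarrow> 'a.
                     LUS1 M f \<delta> d h R K g \<and>
                     LUS2 M f a \<delta> k d (Mseq s) R H K g t \<and>
                     LUS3 M f \<delta> k d (Mseq s) R H K g t)))"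
    using lus' \<delta>(1) \<open>k \<ge> 1\<close> by blast
  have M0': "M0 > 0" using M0 \<delta>(1) by (meson less_trans divide_pos_pos zero_less_one zero_less_power)
  have "\<exists>N\<ge>0. \<forall>a b. \<bar>a - b\<bar> > N \<longrightarrow> \<bar>\<integral>x. \<phi> i (f a x) * \<phi> i (f b x) \<partial>M\<bar> < e" if "i \<le> k" for i
    using fmix_pair[OF mix2 e, of "\<phi> i"] meas[OF that] bound[OF that] zero[OF that] by simp
  then have "\<forall>i\<in>{..k}. \<exists>N\<ge>0. \<forall>a b. \<bar>a - b\<bar> > N \<longrightarrow> \<bar>\<integral>x. \<phi> i (f a x) * \<phi> i (f b x) \<partial>M\<bar> < e"
    by simp
  from bchoice[OF this] obtain Np where Np: "\<And>i. i \<le> k \<Longrightarrow> Np i \<ge> 0"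
    "\<And>i a b. i \<le> k \<Longrightarrow> \<bar>a - b\<bar> > Np i \<Longrightarrow> \<bar>\<integral>x. \<phi> i (f a x) * \<phi> i (f b x) \<partial>M\<bar> < e"
    by auto
  \<comment> \<open>Distinct multiples of \<open>Mseq s powr a\<close> must be farther apart than
    every \<open>Np i\<close>; this is where \<open>Mseq\<close> tending to infinity enters.\<close>
  obtain s where s: "Mseq s \<ge> M0" "Mseq s powr a > Max (Np ` {..k})"
    using eventually_powr_ge[OF Mseq a] by blast
  define b where "b = Mseq s powr a"
  have b: "b > Np i" if "i \<le> k" for i
    using s(2) that by (auto simp: b_def)
  have pair: "\<bar>\<integral>x. \<phi> i (f (real m * b) x) * \<phi> i (f (real m' * b) x) \<partial>M\<bar> \<le> e" if "i \<le> k" "m \<noteq> m'" for i m m'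
  proof -
    have b0: "b \<ge> 0" by (simp add: b_def)
    have "\<bar>real m * b - real m' * b\<bar> = \<bar>real m - real m'\<bar> * b"
      using b0 by (simp add: abs_mult flip: left_diff_distrib)
    moreover have "\<bar>real m - real m'\<bar> \<ge> 1" using that(2) by linarith
    then have "1 * b \<le> \<bar>real m - real m'\<bar> * b" using b0 by (intro mult_right_mono) auto
    ultimately have "\<bar>real m * b - real m' * b\<bar> > Np i" using b[OF that(1)] by linarith
    from Np(2)[OF that(1) this] show ?thesis by simp
  qed
  \<comment> \<open>With \<open>\<delta>\<close> and \<open>s\<close> fixed, this is a fixed finite
    set; so only finitely many shifts occur, whatever \<open>h\<close> and \<open>t\<close>
    are.\<close>
  define L where "L = {l :: nat. real l \<le> Mseq s / \<delta> - 1}"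
  have L: "finite L"
  proof (rule finite_subset)
    show "L \<subseteq> {..nat \<lceil>Mseq s / \<delta>\<rceil>}"
      unfolding L_def by (auto simp: le_nat_iff) linarith
  qed simp
  define Z where "Z = refinement_index d k L"
  have Z: "finite Z" unfolding Z_def by (rule finite_refinement_index[OF L])
  \<comment> \<open>Each pair of pieces costs \<open>2 * \<eta>\<close>, and there are
    \<open>(card Z)\<^sup>2\<close> pairs; the added 1 rules out a zero denominator.\<close>
  define \<eta> where "\<eta> = e / (2 * ((real (card Z))\<^sup>2 + 1))"
  have \<eta>: "\<eta> > 0" using e unfolding \<eta>_def by (intro divide_pos_pos) (auto intro: add_nonneg_pos)
  have \<eta>_le: "(real (card Z))\<^sup>2 * (2 * \<eta>) \<le> e"
  proof -
    have "2 * \<eta> * ((real (card Z))\<^sup>2 + 1) = e"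
      unfolding \<eta>_def by (simp add: field_simps add_nonneg_eq_0_iff)
    then show ?thesis using \<eta> by (simp add: algebra_simps)
  qed
  define u where "u m z i = time_shift b \<delta> m z (Suc i)" for m z i
  \<comment> \<open>The two sheared copies of one factor, for a pair of maps and a pair of pieces.
    There are finitely many such \<open>q\<close>, so a single threshold \<open>N1\<close> serves
    them all.\<close>
  define \<Psi> where "\<Psi> q i x = (case q of (m, m', z, z') \<Rightarrow> \<phi> (Suc i) (f (u m z i) x) * \<phi> (Suc i) (f (u m' z' i) x))"
    for q :: "nat \<times> nat \<times> (nat \<times> (nat \<Rightarrow> nat)) \<times> (nat \<times> (nat \<Rightarrow> nat))" and i x
  have \<Psi>m: "\<Psi> q i \<in> borel_measurable M" if "i < k" for q i
  proof -
    obtain m m' z z' where q: "q = (m, m', z, z')" by (cases q)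
    show ?thesis
      using meas[of "Suc i"] that unfolding \<Psi>_def[abs_def] q by simp
  qed
  have \<Psi>b: "\<bar>\<Psi> q i x\<bar> \<le> 1" if "i < k" for q i x
    using bound[of "Suc i"] that unfolding \<Psi>_def by (auto simp: abs_mult split: prod.split intro!: mult_le_one)
  let ?Q = "{..K} \<times> {..K} \<times> Z \<times> Z"
  define decorr where "decorr q \<tau> t \<longleftrightarrow> (\<forall>\<sigma>. \<sigma> \<in> borel_measurable M \<and> (\<forall>x. \<bar>\<sigma> x\<bar> \<le> 1) \<and> almost_inv \<tau> \<eta> \<sigma> \<longrightarrow>
    \<bar>(\<integral>x. \<sigma> x * (\<Prod>i<k. \<Psi> q i (f (t i) x)) \<partial>M) - (\<integral>x. \<sigma> x \<partial>M) * (\<Prod>i<k. \<integral>x. \<Psi> q i x \<partial>M)\<bar> \<le> 2 * \<eta>)"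
    for q \<tau> t
  have "\<exists>\<tau>\<ge>0. \<forall>\<^sub>F t in gap_filter k. decorr q \<tau> t" for q
    unfolding decorr_def using \<Psi>m \<Psi>b \<eta> by (intro decorrelation_almost_inv mixk mix2) auto
  then obtain Tq where Tq: "\<And>q. Tq q \<ge> 0" "\<And>q. \<forall>\<^sub>F t in gap_filter k. decorr q (Tq q) t"
    by metis
  have Qfin: "finite ?Q" using Z by simp
  define T where "T = (\<Sum>q\<in>?Q. Tq q)"
  have T: "Tq q \<le> T" if "q \<in> ?Q" for q
    unfolding T_def using Qfin Tq(1) that by (intro member_le_sum) auto
  have "\<forall>\<^sub>F t in gap_filter k. \<forall>q\<in>?Q. decorr q (Tq q) t"
    using Qfin Tq(2) by (intro eventually_ball_finite) auto
  then obtain N1 where N1: "\<And>t q. gaps k N1 t \<Longrightarrow> q \<in> ?Q \<Longrightarrow> decorr q (Tq q) t"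
    unfolding eventually_gap_filter by blast
  \<comment> \<open>Two pieces get intersected, each with defect \<open>Suc k * (2 / n)\<close>;
    together they may cost \<open>\<eta>\<close>.\<close>
  obtain n where n: "n > 0" "2 * (real (Suc k) * (2 / real n)) \<le> \<eta>"
  proof -
    obtain n :: nat where n: "real n > 4 * real (Suc k) / \<eta>" using reals_Archimedean2 by blast
    moreover have "4 * real (Suc k) / \<eta> > 0" using \<eta> by simp
    ultimately have "real n > 0" by linarith
    with n \<eta> show ?thesis by (intro that[of n]) (auto simp: field_simps)
  qed
  \<comment> \<open>The square makes the least admissible height \<open>h powr (1/2)\<close> at
    least \<open>n * T\<close>.\<close>
  define h where "h = max M0 ((real n * T)\<^sup>2)"
  have h: "h \<ge> M0" "h \<ge> 0" using M0' by (auto simp: h_def)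
  have hT: "real n * T \<le> h powr (1 / 2)"
    unfolding powr_half_sqrt[OF h(2)] by (rule real_le_rsqrt) (simp add: h_def)
  obtain t0 :: real and R :: "nat \<Rightarrow> 'a set" and H :: "nat \<Rightarrow> real" where
    t0: "t0 \<ge> max (Mseq s) h" and R: "almost_partition M \<delta> (space M) {1..d} R"
    and H: "\<forall>\<rho>\<in>{1..d}. tower M f (H \<rho>) (R \<rho>) \<and> h powr (1/2) \<le> H \<rho> \<and> H \<rho> \<le> h powr (3/2)"
    and shear: "\<forall>t. time_tuple (Suc k) t \<and> time_gap (Suc k) t > ereal t0 \<longrightarrow>
                  (let K = nat \<lfloor>1 / \<delta>\<rfloor> in
                   \<exists>g :: nat \<Rightarrow> 'a \<Rightarrow> 'a.
                     LUS1 M f \<delta> d h R K g \<and>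
                     LUS2 M f a \<delta> k d (Mseq s) R H K g t \<and>
                     LUS3 M f \<delta> k d (Mseq s) R H K g t)"
    using lus0[rule_format, of s h] s(1) h(1) by blast
  have t0': "t0 \<ge> 0" using t0 h(2) by simp
  define W where "W = (\<Union>\<rho>\<in>{1..d}. R \<rho>)"
  have W: "W \<in> sets M" "measure M (UNIV - W) \<le> \<delta>"
  proof -
    show "W \<in> sets M" unfolding W_def using R by (intro sets.finite_UN) (auto simp: almost_partition_def)
    show "measure M (UNIV - W) \<le> \<delta>"
      using almost_partition_measure[OF R] by (simp add: W_def prob_space[simplified])
  qed
  have main: "\<bar>corr (Suc k) \<phi> t\<bar> < \<epsilon>" if t: "t 0 = 0" "gaps (Suc k) (max N1 t0 + 1) t" for t
  proof -
    have tt: "time_tuple (Suc k) t" "time_gap (Suc k) t > ereal t0"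
      using time_tuple_gapsI[OF t, of t0] t0' by auto
    obtain g :: "nat \<Rightarrow> 'a \<Rightarrow> 'a" where lus1: "LUS1 M f \<delta> d h R K g"
      and lus2: "LUS2 M f a \<delta> k d (Mseq s) R H K g t"
      and lus3: "LUS3 M f \<delta> k d (Mseq s) R H K g t"
      using shear tt unfolding K_def Let_def by blast
    have gk: "gaps k N1 (\<lambda>i. t (Suc i))"
      using gaps_mono[OF gaps_Suc[OF t(2)], of N1] by simp
    have "\<forall>m\<in>{..K}. \<exists>XY. almost_measure_preserving \<delta> (restrict_space M W) (restrict_space M W) (g m) (fst XY) (snd XY) \<and>
        (\<forall>x\<in>fst XY. dist (g m x) x \<le> \<delta>)"
    proof
      fix m assume "m \<in> {..K}"
      then obtain X0 Y0 where "almost_measure_preserving \<delta> (restrict_space M W) (restrict_space M W) (g m) X0 Y0"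
        "\<forall>x\<in>X0. dist (g m x) x \<le> \<delta>"
        using lus1 unfolding LUS1_def Let_def W_def[symmetric] atMost_iff by meson
      then show "\<exists>XY. almost_measure_preserving \<delta> (restrict_space M W) (restrict_space M W) (g m) (fst XY) (snd XY) \<and>
        (\<forall>x\<in>fst XY. dist (g m x) x \<le> \<delta>)"
        by (intro exI[of _ "(X0, Y0)"]) simp
    qed
    from bchoice[OF this] obtain XY where XY: "\<And>m. m \<le> K \<Longrightarrow>
        almost_measure_preserving \<delta> (restrict_space M W) (restrict_space M W) (g m) (fst (XY m)) (snd (XY m))"
      "\<And>m x. m \<le> K \<Longrightarrow> x \<in> fst (XY m) \<Longrightarrow> dist (g m x) x \<le> \<delta>"
      by auto
    have nT: "real n * T \<le> H \<rho>" if "\<rho> \<in> {1..d}" for \<rho> using H hT that by fastforce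
    obtain S where S: "\<And>m z. m \<le> K \<Longrightarrow> z \<in> Z \<Longrightarrow> S m z \<in> sets M"
      "\<And>m z. m \<le> K \<Longrightarrow> z \<in> Z \<Longrightarrow> S m z \<subseteq> W"
      "\<And>m z. m \<le> K \<Longrightarrow> z \<in> Z \<Longrightarrow> almost_inv T (real (Suc k) * (2 / real n)) (indicator (S m z))"
      "\<And>m. m \<le> K \<Longrightarrow> disjoint_family_on (S m) Z"
      "\<And>m. m \<le> K \<Longrightarrow> measure M (W - (\<Union>z\<in>Z. S m z)) \<le> real (Suc k) * \<delta>"
      and Sclose: "\<And>m z j x. m \<le> K \<Longrightarrow> z \<in> Z \<Longrightarrow> j \<in> {1..k} \<Longrightarrow> x \<in> S m z \<Longrightarrow>
        dist (f (t j) (g m x)) (f (t j + time_shift b \<delta> m z j) x) \<le> \<delta>"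
      and Sdisj: "\<And>m m' z z'. m \<le> K \<Longrightarrow> m' \<le> K \<Longrightarrow> z \<in> Z \<Longrightarrow> z' \<in> Z \<Longrightarrow> snd z 0 \<noteq> snd z' 0 \<Longrightarrow> S m z \<inter> S m' z' = {}"
      using LUS_refinement[OF R less_imp_le[OF \<delta>(1)] n(1) nT lus2 lus3 L[unfolded L_def],
          folded L_def W_def b_def, folded Z_def] by blast
    define \<psi> where "\<psi> i = \<phi> (Suc i)" for i
    have \<psi>: "\<psi> i \<in> borel_measurable M" "\<bar>\<psi> i x\<bar> \<le> 1" if "i < k" for i x
      using meas[of "Suc i"] bound[of "Suc i"] that by (auto simp: \<psi>_def)
    have close: "\<bar>\<psi> i (f (t (Suc i)) (g m x)) - \<psi> i (f (t (Suc i) + u m z i) x)\<bar> \<le> e"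
      if "m \<le> K" "z \<in> Z" "i < k" "x \<in> S m z" for m z i x
      unfolding \<psi>_def u_def using that Sclose[of m z "Suc i" x] by (intro modulus) auto
    define e' where "e' = 2 * (real (Suc k) * \<delta>) + 2 * real k * e + e + e"
    have off: "\<bar>\<integral>x. pullback_prod \<psi> k (\<lambda>i. t (Suc i)) W (g m) x * pullback_prod \<psi> k (\<lambda>i. t (Suc i)) W (g m') x \<partial>M\<bar> \<le> e'"
      if m: "m < Suc K" "m' < Suc K" "m \<noteq> m'"
        and Ym: "pullback_prod \<psi> k (\<lambda>i. t (Suc i)) W (g m) \<in> borel_measurable M"
          "pullback_prod \<psi> k (\<lambda>i. t (Suc i)) W (g m') \<in> borel_measurable M" for m m'
    proof -
      have mK: "m \<le> K" "m' \<le> K" using m by auto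
      have decor: "\<bar>\<integral>x. indicator (S m z \<inter> S m' z') x *
            (\<Prod>i<k. \<psi> i (f (t (Suc i) + u m z i) x) * \<psi> i (f (t (Suc i) + u m' z' i) x)) \<partial>M\<bar>
          \<le> e * measure M (S m z \<inter> S m' z') + 2 * \<eta>" if z: "z \<in> Z" "z' \<in> Z" for z z'
      \<comment> \<open>Pieces that select different indices in (LUS2) are disjoint. Otherwise the
        sheared shifts for \<open>m\<close> and \<open>m'\<close> meet in one factor, whose mean is
        small.\<close>
      proof (cases "snd z 0 = snd z' 0")
        case False
        then have "S m z \<inter> S m' z' = {}" using Sdisj mK z by blast
        then show ?thesis using \<eta> by simp
      next
        case True
        let ?q = "(m, m', z, z')" and ?S = "S m z \<inter> S m' z'"
        have q: "?q \<in> ?Q" using mK z by auto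
        have Sm: "?S \<in> sets M" using S(1) mK z by auto
        have inv: "almost_inv (Tq ?q) \<eta> (indicator ?S)"
          using almost_inv_Int[OF S(1)[OF mK(1) z(1)] S(3)[OF mK(1) z(1)] S(1)[OF mK(2) z(2)] S(3)[OF mK(2) z(2)]]
            T[OF q] n(2) by (elim almost_inv_mono) auto
        have "\<bar>(\<integral>x. indicator ?S x * (\<Prod>i<k. \<Psi> ?q i (f (t (Suc i)) x)) \<partial>M)
            - (\<integral>x. indicator ?S x \<partial>M) * (\<Prod>i<k. \<integral>x. \<Psi> ?q i x \<partial>M)\<bar> \<le> 2 * \<eta>"
        proof (intro N1[OF gk q, unfolded decorr_def, rule_format] conjI inv)
          show "\<forall>x. \<bar>indicator ?S x :: real\<bar> \<le> 1" by (simp add: indicator_def)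
        qed (use Sm in simp)
        moreover have "\<Psi> ?q i (f (t (Suc i)) x) = \<psi> i (f (t (Suc i) + u m z i) x) * \<psi> i (f (t (Suc i) + u m' z' i) x)" for i x
          by (simp add: \<Psi>_def \<psi>_def flow_add' add.commute)
        ultimately have *: "\<bar>(\<integral>x. indicator ?S x * (\<Prod>i<k. \<psi> i (f (t (Suc i) + u m z i) x) * \<psi> i (f (t (Suc i) + u m' z' i) x)) \<partial>M)
            - measure M ?S * (\<Prod>i<k. \<integral>x. \<Psi> ?q i x \<partial>M)\<bar> \<le> 2 * \<eta>"
          using Sm by simp
        have le1: "\<bar>\<Prod>i<k. \<integral>x. \<Psi> ?q i x \<partial>M\<bar> \<le> e"
        proof -
          have "snd z 0 \<in> {1..k}" using refinement_indexD z(1) unfolding Z_def by blast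
          \<comment> \<open>The factor selected by (LUS2) in both pieces. Its number drops by one
            because slot \<open>i\<close> of \<open>\<psi>\<close> belongs to time
            \<open>t (Suc i)\<close>.\<close>
          then obtain i0 where i0: "snd z 0 = Suc i0" "i0 < k" by (cases "snd z 0") auto
          have "\<Psi> ?q i0 x = \<phi> (Suc i0) (f (real m * b) x) * \<phi> (Suc i0) (f (real m' * b) x)" for x
            using True i0 by (simp add: \<Psi>_def u_def time_shift_def)
          then have le: "\<bar>\<integral>x. \<Psi> ?q i0 x \<partial>M\<bar> \<le> e"
            using pair[of "Suc i0" m m'] i0 m by simp
          have "\<bar>\<Prod>i\<in>{..<k} - {i0}. \<integral>x. \<Psi> ?q i x \<partial>M\<bar> = (\<Prod>i\<in>{..<k} - {i0}. \<bar>\<integral>x. \<Psi> ?q i x \<partial>M\<bar>)"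
            by (rule abs_prod)
          also have "\<dots> \<le> (\<Prod>i\<in>{..<k} - {i0}. 1)"
            using \<Psi>m[of _ ?q] \<Psi>b[of _ ?q] by (intro prod_mono) (auto intro!: integral_le_bound)
          finally have "\<bar>\<Prod>i\<in>{..<k} - {i0}. \<integral>x. \<Psi> ?q i x \<partial>M\<bar> \<le> 1" by simp
          with le have "\<bar>\<integral>x. \<Psi> ?q i0 x \<partial>M\<bar> * \<bar>\<Prod>i\<in>{..<k} - {i0}. \<integral>x. \<Psi> ?q i x \<partial>M\<bar> \<le> e * 1"
            using e by (intro mult_mono) auto
          then show ?thesis
            using i0 by (subst prod.remove[of _ i0]) (auto simp: abs_mult)
        qed
        have "\<bar>measure M ?S * (\<Prod>i<k. \<integral>x. \<Psi> ?q i x \<partial>M)\<bar> \<le> e * measure M ?S"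
          unfolding abs_mult using mult_left_mono[OF le1, of "measure M ?S"] by (simp add: mult.commute)
        with * show ?thesis by linarith
      qed
      have "\<bar>\<integral>x. pullback_prod \<psi> k (\<lambda>i. t (Suc i)) W (g m) x * pullback_prod \<psi> k (\<lambda>i. t (Suc i)) W (g m') x \<partial>M\<bar>
        \<le> 2 * (real (Suc k) * \<delta>) + 2 * real k * e + e + (real (card Z))\<^sup>2 * (2 * \<eta>)"
      proof (rule off_diagonal_bound[where ?u1.0 = "u m" and ?u2.0 = "u m'" and ?S1.0 = "S m" and ?S2.0 = "S m'"])
        show "\<And>z i x. z \<in> Z \<Longrightarrow> i < k \<Longrightarrow> x \<in> S m z \<Longrightarrow>
            \<bar>\<psi> i (f (t (Suc i)) (g m x)) - \<psi> i (f (t (Suc i) + u m z i) x)\<bar> \<le> e"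
          using close mK by blast
        show "\<And>z i x. z \<in> Z \<Longrightarrow> i < k \<Longrightarrow> x \<in> S m' z \<Longrightarrow>
            \<bar>\<psi> i (f (t (Suc i)) (g m' x)) - \<psi> i (f (t (Suc i) + u m' z i) x)\<bar> \<le> e"
          using close mK by blast
        show "\<And>z z'. z \<in> Z \<Longrightarrow> z' \<in> Z \<Longrightarrow> \<bar>\<integral>x. indicator (S m z \<inter> S m' z') x *
            (\<Prod>i<k. \<psi> i (f (t (Suc i) + u m z i) x) * \<psi> i (f (t (Suc i) + u m' z' i) x)) \<partial>M\<bar>
          \<le> e * measure M (S m z \<inter> S m' z') + 2 * \<eta>"
          by (rule decor)
      qed (use S[OF mK(1)] S[OF mK(2)] W Z \<psi> Ym e in auto)
      then show ?thesis using \<eta>_le by (simp add: e'_def)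
    qed
    have "e' \<ge> 0" using e \<delta>(1) by (simp add: e'_def)
    have "\<bar>\<integral>x. \<phi> 0 x * (\<Prod>i<k. \<psi> i (f (t (Suc i)) x)) \<partial>M\<bar> \<le> 7 * \<delta> + e + sqrt (1 / real (Suc K) + e')"
    proof (rule average_over_maps_bound[where g = g and ?X0.0 = "\<lambda>m. fst (XY m)" and ?Y0.0 = "\<lambda>m. snd (XY m)"])
      show "\<And>x y. dist x y \<le> \<delta> \<Longrightarrow> \<bar>\<phi> 0 x - \<phi> 0 y\<bar> \<le> e" by (rule modulus) auto
      show "\<And>m m'. m < Suc K \<Longrightarrow> m' < Suc K \<Longrightarrow> m \<noteq> m' \<Longrightarrow>
        pullback_prod \<psi> k (\<lambda>i. t (Suc i)) W (g m) \<in> borel_measurable M \<Longrightarrow>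
        pullback_prod \<psi> k (\<lambda>i. t (Suc i)) W (g m') \<in> borel_measurable M \<Longrightarrow>
        \<bar>\<integral>x. pullback_prod \<psi> k (\<lambda>i. t (Suc i)) W (g m) x * pullback_prod \<psi> k (\<lambda>i. t (Suc i)) W (g m') x \<partial>M\<bar> \<le> e'"
        by (rule off)
    qed (use W \<delta>(1) \<psi> XY meas[of 0] bound[of 0] e \<open>e' \<ge> 0\<close> in auto)
    also have "(\<integral>x. \<phi> 0 x * (\<Prod>i<k. \<psi> i (f (t (Suc i)) x)) \<partial>M) = corr (Suc k) \<phi> t"
      unfolding corr_def prod.lessThan_Suc_shift by (simp add: \<psi>_def t(1))
    \<comment> \<open>Since \<open>\<delta> \<le> e\<close>, the number \<open>e'\<close> is at most
      \<open>(4 * real k + 4) * e\<close>; the diagonal term \<open>1 / Suc K\<close> supplies the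
      fifth \<open>e\<close>.\<close>
    also have "7 * \<delta> + e + sqrt (1 / real (Suc K) + e') \<le> 8 * e + sqrt ((4 * real k + 5) * e)"
    proof -
      have "real (Suc k) * \<delta> \<le> real (Suc k) * e" using \<delta> by (intro mult_left_mono) auto
      then have "1 / real (Suc K) + e' \<le> (4 * real k + 5) * e"
        using K \<delta> unfolding e'_def by (simp add: algebra_simps)
      then have "sqrt (1 / real (Suc K) + e') \<le> sqrt ((4 * real k + 5) * e)"
        by (rule real_sqrt_le_mono)
      with \<delta> show ?thesis by linarith
    qed
    finally show ?thesis using e_le by linarith
  qed
  \<comment> \<open>Gaps and correlations are unchanged when all times are translated, so the first
    time may be moved to 0.\<close>
  have "\<bar>dev (Suc k) \<phi> t\<bar> < \<epsilon>" if t: "gaps (Suc k) (max N1 t0 + 1) t" for t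
  proof -
    have "dev (Suc k) \<phi> t = corr (Suc k) \<phi> t" using zero by (simp add: dev_def)
    moreover have "corr (Suc k) \<phi> (\<lambda>i. t i + - t 0) = corr (Suc k) \<phi> t"
      using meas by (intro corr_shift) auto
    moreover have "\<bar>corr (Suc k) \<phi> (\<lambda>i. t i + - t 0)\<bar> < \<epsilon>"
      using t by (intro main) (simp_all only: gaps_shift add.right_inverse)
    ultimately show ?thesis by simp
  qed
  then show "\<exists>N. \<forall>t. gaps (Suc k) N t \<longrightarrow> \<bar>dev (Suc k) \<phi> t\<bar> < \<epsilon>" by blast
qed

text \<open>Order 2 decorrelates two shifts of the same factor, order \<open>k\<close> the factors
  at distinct times; hence both are assumed.\<close>

lemma LUS_imp_mixing_of_order_Suc:
  assumes radon: "radon_measure M" and lus: "locally_uniformly_shearing M f"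
    and mix2: "mixing_of_order 2 M f" and mixk: "mixing_of_order k M f" and "k \<ge> 1"
  shows "mixing_of_order (Suc k) M f"
proof -
  have fmixk: "fmix k \<psi>" if "\<And>i. i < k \<Longrightarrow> \<psi> i \<in> borel_measurable M" "\<And>i x. i < k \<Longrightarrow> \<bar>\<psi> i x\<bar> \<le> 1" for \<psi>
    by (rule fmix_bounded[OF mixing_of_order_imp_fmix[OF mixk] that])
  have fmix2: "fmix 2 (\<lambda>i. \<psi>)" if "\<psi> \<in> borel_measurable M" "\<And>x. \<bar>\<psi> x\<bar> \<le> 1" for \<psi>
    by (rule fmix_bounded[OF mixing_of_order_imp_fmix[OF mix2] that])
  have "fmix (Suc k) \<psi>" if "\<And>i. i < Suc k \<Longrightarrow> uniformly_continuous_on UNIV (\<psi> i)"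
    "\<And>i x. i < Suc k \<Longrightarrow> \<bar>\<psi> i x\<bar> \<le> 1" for \<psi>
    by (rule fmix_if_fmix_zero_mean[OF fmixk LUS_zero_mean_fmix[OF fmixk fmix2 lus \<open>k \<ge> 1\<close>] that])
  then show ?thesis
    by (rule fmix_imp_mixing_of_order[OF fmix_indicator_if_fmix_continuous[OF radon]])
qed

end

theorem theorem6p8:
  fixes \<mu> :: "'a :: complete_space measure" and f :: "real \<Rightarrow> 'a \<Rightarrow> 'a"
  assumes "locally_compact_space (euclidean :: 'a topology)"
    and "sigma_compact_space (euclidean :: 'a topology)"
    and "radon_measure \<mu>" and "prob_space \<mu>"
    and "measure_preserving_flow \<mu> f"
    and "mixing \<mu> f"
    and "locally_uniformly_shearing \<mu> f"
  shows "mixing_of_all_orders \<mu> f"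
  unfolding mixing_of_all_orders_def
proof (intro allI impI)
  interpret prob_space \<mu> by fact
  interpret mp_flow \<mu> f
    using assms(3,5) by unfold_locales (auto simp: radon_measure_def)
  fix k :: nat assume "2 \<le> k"
  then show "mixing_of_order k \<mu> f"
  proof (induction k rule: dec_induct)
    case base
    then show ?case using assms(6) by (simp add: mixing_def)
  next
    case (step k)
    then show ?case
      using assms(3,6,7) by (intro LUS_imp_mixing_of_order_Suc) (auto simp: mixing_def)
  qed
qed

end
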